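(* Let $m,d,p,q$ be positive integers. Let $\varphi:\mathbb{S}^{m}\rightarrow\mathbb{S}^d$ be an eigenmap of degree $p$, and let $\Phi:\mathbb{R}^{m+1}\rightarrow\mathbb{R}^{d+1}$ be the associated $(d+1)$-tuple of homogeneous harmonic polynomials of degree $p$ (so $\Phi|_{\mathbb{S}^m}=\varphi$). Set $$\nu^{(p)}(x):=\frac{\Phi(x)}{\|x\|^{p}},\qquad x\in\mathbb{R}^{m+1}\setminus\{0\}.$$ Let $W$ be an orthogonal $\mathrm{SO}(m+1)$-module and let $D$ be a nonzero $\mathrm{SO}(m+1)$-module homomorphism of $W$ into $(\mathcal{H}_p^{\mathbb{R}^{m+1}})^{\star}\otimes\mathcal{H}_q^{\mathbb{R}^{m+1}}$. Define $$\nu^{(q)}:\mathbb{R}^{m+1}\setminus\{0\}\rightarrow W\otimes\mathbb{R}^{d+1}\cong\mathbb{R}^{(d+1)\dim W},\qquad x\mapsto\frac{1}{\|x\|^{q}}\big(\|x\|^{p}\nu^{(p)}(x)\big)^D=\frac{1}{\|x\|^{q}}\,\Phi^D(x).$$ Then (each component of) the map $\nu^{(q)}$ is a homogeneous polynomial in the variables $y_i:=\frac{x_i}{\|x\|}$, $i=1,\dots,m+1$, and $\nu^{(q)}$ satisfies the following properties: (1) $\nu^{(q)}$ is sphere-valued, i.e. $\|\nu^{(q)}(x)\|^2=1$ for all $x\in\mathbb{R}^{m+1}\setminus\{0\}$; (2) the energy density of $\nu^{(q)}$ is given by $\|\nabla \nu^{(q)}(x)\|^2=\frac{q(q+m-1)}{\|x\|^2}$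 for all $x\in\mathbb{R}^{m+1}\setminus\{0\}$; (3) $\nu^{(q)}$ is a harmonic map (to the unit sphere), i.e. it solves $\Delta \nu^{(q)}+\|\nabla \nu^{(q)}\|^2\nu^{(q)}=0$ on $\mathbb{R}^{m+1}\setminus\{0\}$.
   Context: Notation. $\mathbb{S}^k\subset\mathbb{R}^{k+1}$ is the Euclidean unit sphere. $\Delta=\sum_i\partial^2/\partial x_i^2$ is the Euclidean Laplacian, acting componentwise, and $\|\nabla u\|^2=\sum_{i,\alpha}(\partial u^\alpha/\partial x_i)^2$. $\mathcal{H}_p^{\mathbb{R}^{m+1}}$ is the real vector space of homogeneous harmonic polynomials of degree $p$ in $m+1$ variables; restriction to $\mathbb{S}^m$ identifies it with the space of spherical harmonics of order $p$ on $\mathbb{S}^m$. It is equipped with the natural action of $\mathrm{SO}(m+1)$, $(a\cdot h)(x)=h(a^{-1}x)$, and the invariant scalar product $$\langle h_1,h_2\rangle=\frac{\dim\mathcal{H}_p^{\mathbb{R}^{m+1}}}{\operatorname{vol}(\mathbb{S}^m)}\int_{\mathbb{S}^m}h_1h_2\,dv$$ (and likewise for $q$). A map $\varphi:\mathbb{S}^m\to\mathbb{S}^d$ is an eigenmap of degree $p$ if all components of $\varphi$, viewed as a map into $\mathbb{R}^{d+1}$, are spherical harmonics of order $p$, i.e. restrictions to $\mathbb{S}^m$ of elements of $\mathcal{H}_p^{\mathbb{R}^{m+1}}$. An orthogonal $\mathrm{SO}(m+1)$-module $W$ is a finite-dimensional real inner product space on which $\mathrm{SO}(m+1)$ acts linearly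 by isometries. Given a nonzero $\mathrm{SO}(m+1)$-module homomorphism $D:W\to(\mathcal{H}_p^{\mathbb{R}^{m+1}})^{\star}\otimes\mathcal{H}_q^{\mathbb{R}^{m+1}}=\operatorname{Hom}(\mathcal{H}_p^{\mathbb{R}^{m+1}},\mathcal{H}_q^{\mathbb{R}^{m+1}})$, write $D_e:\mathcal{H}_p^{\mathbb{R}^{m+1}}\to\mathcal{H}_q^{\mathbb{R}^{m+1}}$ for the linear map associated with $e\in W$. Let $\{e_i\}$ be an orthonormal basis of $W$ and define $\iota:\mathcal{H}_q^{\mathbb{R}^{m+1}}\to W\otimes\mathcal{H}_p^{\mathbb{R}^{m+1}}$ by $\iota(h')=\sum_i e_i\otimes D_{e_i}^{T}h'$, where $^T$ denotes the adjoint with respect to the scalar products above; its adjoint satisfies $\iota^T(e\otimes h)=D_eh$. It is known that $\iota^T\circ\iota=c(D)\cdot\mathrm{Id}$ for a constant $c(D)\in\mathbb{R}$ (that is, $\sum_i D_{e_i}D_{e_i}^T=c(D)\,\mathrm{Id}$ on $\mathcal{H}_q^{\mathbb{R}^{m+1}}$); $c(D)>0$ since $D\neq0$. For a polynomial map $f=(f^1,\dots,f^{d+1}):\mathbb{R}^{m+1}\to\mathbb{R}^{d+1}$ with components in $\mathcal{H}_p^{\mathbb{R}^{m+1}}$, the map $f^D:\mathbb{R}^{m+1}\to W\otimes\mathbb{R}^{d+1}$ is the map with components $$(f^D)_i^j=c(D)^{-\frac12}D_{e_i}f^j$$ with respect to the orthonormal basis $\{e_i\}$ of $W$ and the standard basis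 of $\mathbb{R}^{d+1}$. *)

theory Defs
  imports "HOL-Analysis.Analysis" "HOL-Library.Function_Algebras"
begin

text \<open>
  Functions into a real vector space form a real vector space under pointwise operations (addition
  is supplied by \<^theory>\<open>HOL-Library.Function_Algebras\<close>). Spaces of polynomials are subspaces of it,
  so that the library's \<^const>\<open>dim\<close>, \<^const>\<open>span\<close> and \<^const>\<open>linear\<close> apply to them.
\<close>

instantiation "fun" :: (type, real_vector) real_vector
begin

definition scaleR_fun_def: "c *\<^sub>R f = (\<lambda>x. c *\<^sub>R f x)"

instance
  by standard (auto simp: scaleR_fun_def fun_eq_iff algebra_simps)

end


section \<open>Homogeneous harmonic polynomials\<close>

definition homogeneous_polynomial :: "nat \<Rightarrow> (real^'n \<Rightarrow> real) \<Rightarrow> bool" where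
  "homogeneous_polynomial k h \<longleftrightarrow>
     (\<exists>c :: ('n \<Rightarrow> nat) \<Rightarrow> real.
        \<forall>x. h x = (\<Sum>\<alpha> | (\<Sum>i\<in>UNIV. \<alpha> i) = k. c \<alpha> * (\<Prod>i\<in>UNIV. (x $ i) ^ \<alpha> i)))"

text \<open>The sum above ranges over a finite set of multi-indices:\<close>

lemma finite_multi_indices: "finite {\<alpha> :: 'n::finite \<Rightarrow> nat. (\<Sum>i\<in>UNIV. \<alpha> i) = k}"
proof (rule finite_subset)
  show "{\<alpha> :: 'n \<Rightarrow> nat. (\<Sum>i\<in>UNIV. \<alpha> i) = k} \<subseteq> (UNIV :: 'n set) \<rightarrow>\<^sub>E {..k}"
    by (auto intro!: member_le_sum)
  show "finite ((UNIV :: 'n set) \<rightarrow>\<^sub>E {..k})"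
    by (rule finite_PiE) auto
qed

text \<open>
  Partial derivatives of vector-valued maps. They are meaningful wherever the map is differentiable
  along the coordinate direction.
\<close>

definition partial :: "'n \<Rightarrow> (real^'n \<Rightarrow> 'b::real_normed_vector) \<Rightarrow> real^'n \<Rightarrow> 'b" where
  "partial i u x = vector_derivative (\<lambda>t. u (x + t *\<^sub>R axis i 1)) (at 0)"

definition laplacian :: "(real^'n \<Rightarrow> 'b::real_normed_vector) \<Rightarrow> real^'n \<Rightarrow> 'b" where
  "laplacian u x = (\<Sum>i\<in>UNIV. partial i (partial i u) x)"

definition energy_density :: "(real^'n \<Rightarrow> 'b::real_normed_vector) \<Rightarrow> real^'n \<Rightarrow> real" where
  "energy_density u x = (\<Sum>i\<in>UNIV. (norm (partial i u x))\<^sup>2)"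

definition harmonic_polynomials :: "nat \<Rightarrow> (real^'n \<Rightarrow> real) set" ("\<H>") where
  "\<H> p = {h. homogeneous_polynomial p h \<and> (\<forall>x. laplacian h x = 0)}"


section \<open>The invariant scalar product\<close>

text \<open>
  The surface measure of the unit sphere of an $N$-dimensional space: by polar coordinates, the area
  of a Borel set $A$ of the sphere is $N$ times the Lebesgue measure of the part of the punctured
  unit ball that projects radially into $A$.
\<close>

definition sphere_measure :: "(real^'n) measure" where
  "sphere_measure = scale_measure (of_nat CARD('n))
     (distr (restrict_space lborel (ball 0 1 - {0})) (restrict_space borel (sphere 0 1))
        (\<lambda>x. x /\<^sub>R norm x))"

definition harmonic_inner :: "nat \<Rightarrow> (real^'n \<Rightarrow> real) \<Rightarrow> (real^'n \<Rightarrow> real) \<Rightarrow> real" where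
  "harmonic_inner p h\<^sub>1 h\<^sub>2 =
     real (dim (\<H> p :: (real^'n \<Rightarrow> real) set)) / measure (sphere_measure :: (real^'n) measure) (sphere 0 1)
       * (LINT x | sphere_measure. h\<^sub>1 x * h\<^sub>2 x)"


section \<open>Module homomorphisms into Hom(H_p, H_q)\<close>

definition rot_action :: "real^'n^'n \<Rightarrow> (real^'n \<Rightarrow> real) \<Rightarrow> (real^'n \<Rightarrow> real)" where
  "rot_action a h = (\<lambda>x. h (matrix_inv a *v x))"

definition orthogonal_SO_module :: "(real^'n^'n \<Rightarrow> 'w::euclidean_space \<Rightarrow> 'w) \<Rightarrow> bool" where
  "orthogonal_SO_module \<rho> \<longleftrightarrow>
     (\<forall>a. rotation_matrix a \<longrightarrow> orthogonal_transformation (\<rho> a)) \<and>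
     \<rho> (mat 1) = id \<and>
     (\<forall>a b. rotation_matrix a \<longrightarrow> rotation_matrix b \<longrightarrow> \<rho> (a ** b) = \<rho> a \<circ> \<rho> b)"

text \<open>
  Linear maps between spaces of harmonic polynomials are represented by operators on all functions,
  of which only the values on the domain matter.
\<close>

definition harmonic_Hom :: "nat \<Rightarrow> nat \<Rightarrow> ((real^'n \<Rightarrow> real) \<Rightarrow> (real^'n \<Rightarrow> real)) set" where
  "harmonic_Hom p q =
     {A. (\<forall>h\<in>\<H> p. A h \<in> \<H> q) \<and>
         (\<forall>h\<in>\<H> p. \<forall>g\<in>\<H> p. A (h + g) = A h + A g) \<and>
         (\<forall>c. \<forall>h\<in>\<H> p. A (c *\<^sub>R h) = c *\<^sub>R A h)}"

definition harmonic_adjoint ::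
  "nat \<Rightarrow> nat \<Rightarrow> ((real^'n \<Rightarrow> real) \<Rightarrow> (real^'n \<Rightarrow> real)) \<Rightarrow> ((real^'n \<Rightarrow> real) \<Rightarrow> (real^'n \<Rightarrow> real))" where
  "harmonic_adjoint p q A h' =
     (THE g. g \<in> \<H> p \<and> (\<forall>h\<in>\<H> p. harmonic_inner q (A h) h' = harmonic_inner p h g))"

definition module_hom_to_Hom ::
  "nat \<Rightarrow> nat \<Rightarrow> (real^'n^'n \<Rightarrow> 'w::euclidean_space \<Rightarrow> 'w) \<Rightarrow>
     ('w \<Rightarrow> (real^'n \<Rightarrow> real) \<Rightarrow> (real^'n \<Rightarrow> real)) \<Rightarrow> bool" where
  "module_hom_to_Hom p q \<rho> D \<longleftrightarrow>
     (\<forall>e. D e \<in> harmonic_Hom p q) \<and>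
     (\<forall>h\<in>\<H> p. linear (\<lambda>e. D e h)) \<and>
     (\<forall>a. rotation_matrix a \<longrightarrow>
        (\<forall>e. \<forall>h\<in>\<H> p. D (\<rho> a e) h = rot_action a (D e (rot_action (matrix_inv a) h))))"

definition orthonormal_basis :: "'w::euclidean_space set \<Rightarrow> bool" where
  "orthonormal_basis B \<longleftrightarrow> pairwise orthogonal B \<and> (\<forall>e\<in>B. norm e = 1) \<and> span B = UNIV"

definition hom_constant ::
  "nat \<Rightarrow> nat \<Rightarrow> 'w::euclidean_space set \<Rightarrow> ('w \<Rightarrow> (real^'n \<Rightarrow> real) \<Rightarrow> (real^'n \<Rightarrow> real)) \<Rightarrow> real" where
  "hom_constant p q B D =
     (THE c. \<forall>h'\<in>\<H> q. (\<Sum>e\<in>B. D e (harmonic_adjoint p q (D e) h')) = c *\<^sub>R h')"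

text \<open>
  The tensor product of \<open>'w\<close> with \<open>real^'k\<close> is represented by the Euclidean space \<open>'w^'k\<close>; the component
  of \<open>v\<close> with respect to the basis vector \<open>e\<close> and the \<open>j\<close>-th standard basis vector is \<open>v $ j \<bullet> e\<close>.
\<close>

definition D_transform ::
  "nat \<Rightarrow> nat \<Rightarrow> 'w::euclidean_space set \<Rightarrow> ('w \<Rightarrow> (real^'n \<Rightarrow> real) \<Rightarrow> (real^'n \<Rightarrow> real)) \<Rightarrow>
     (real^'n \<Rightarrow> real^'k) \<Rightarrow> real^'n \<Rightarrow> 'w^'k" where
  "D_transform p q B D f x =
     (\<chi> j. \<Sum>e\<in>B. (hom_constant p q B D powr (-1/2) * D e (\<lambda>y. f y $ j) x) *\<^sub>R e)"


section \<open>Eigenmaps\<close>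

definition eigenmap :: "nat \<Rightarrow> (real^'n \<Rightarrow> real^'k) \<Rightarrow> bool" where
  "eigenmap p \<phi> \<longleftrightarrow>
     \<phi> \<in> sphere 0 1 \<rightarrow> sphere 0 1 \<and>
     (\<forall>j. \<exists>h\<in>\<H> p. \<forall>x\<in>sphere 0 1. \<phi> x $ j = h x)"

end

theory Submission
  imports Defs
begin

text \<open>
  For a unit vector \<open>x\<close>, the sum of the \<open>(D\<^sub>e \<Phi>\<^sup>j(x))\<^sup>2\<close> over \<open>e\<close> and \<open>j\<close> is the value of a linear functional at
  the kernel \<open>C = \<Sum>\<^sub>j \<Phi>\<^sup>j \<otimes> \<Phi>\<^sup>j\<close>, and by equivariance this functional is invariant under the rotations fixing \<open>x\<close>.
  Since \<open>\<phi>\<close> is sphere-valued, \<open>C\<close> agrees on the diagonal with the reproducing kernel of \<open>H\<^sub>p\<close>, so the difference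
  lies in the space of symmetric kernels in \<open>H\<^sub>p \<otimes> H\<^sub>p\<close> that vanish on the diagonal. There the functional is
  represented by an element which is itself invariant under the stabiliser of \<open>x\<close>, and such a kernel is zero.
  Hence the sum has the same value as for the reproducing kernel, which is \<open>c(D)\<close>. The same vanishing
  principle shows that \<open>\<Sum>\<^sub>e D\<^sub>e D\<^sub>e\<^sup>T\<close> is a scalar. Given \<open>\<bar>\<nu>\<bar> = 1\<close>, the remaining claims follow
  because \<open>\<bar>x\<bar>\<^sup>-\<^sup>q h\<close> is, for \<open>h\<close> in \<open>H\<^sub>q\<close>, an eigenfunction of \<open>\<bar>x\<bar>\<^sup>2 \<Delta>\<close> with eigenvalue \<open>-q(q + m - 1)\<close>.
\<close>

section \<open>Directional derivatives of polynomial functions\<close>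

text \<open>In representation theory the vanishing principle says that the symmetric square of H_p
  has no class-one component in the kernel of restriction to the diagonal. Here decomposition into
  irreducibles is replaced by polynomial calculus. A kernel invariant under the rotations about e_p
  is annihilated by the sum of the generators acting in its two variables, so both variables have
  the same Casimir operator; its eigenvalue on harmonic polynomials of degree k in n variables is,
  up to a factor, k (k + n - 2), and this recovers degrees without any classification. Only SO is
  available, not O. For m = 1 the stabiliser of a point is trivial and invariance says nothing; what
  helps then is that a harmonic polynomial in the single remaining variable has degree at most 1.
  This is the source of the low-degree exceptions. The factor dim/vol in the scalar product makes
  the reproducing kernel equal to 1 on the diagonal of the sphere, exactly the value of the sum of
  the squared components of an eigenmap. Hence no factor intervenes between the sum of squares and
  c(D). The trace defining c(D) is itself an invariant kernel, compared with the reproducing kernel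
  of H_q.\<close>

abbreviation (input) "poly_fun \<equiv> real_polynomial_function"

lemmas poly_of_linear = real_polynomial_function.intros(1)
  and poly_of_const = real_polynomial_function.intros(2)
  and poly_plus = real_polynomial_function.intros(3)
  and poly_times = real_polynomial_function.intros(4)

text \<open>Directions range over an arbitrary normed space, so that one calculus serves functions
  of a single vector and kernels on pairs of vectors. Since \<open>vector_derivative\<close> is
  total, most rules below are confined to polynomial functions.\<close>

definition dird :: "'a::real_normed_vector \<Rightarrow> ('a \<Rightarrow> real) \<Rightarrow> 'a \<Rightarrow> real" where
  "dird v f x = vector_derivative (\<lambda>t. f (x + t *\<^sub>R v)) (at 0)"

abbreviation (input) laplace :: "('i \<Rightarrow> 'a) \<Rightarrow> ('a::real_normed_vector \<Rightarrow> real) \<Rightarrow> 'a \<Rightarrow> real" where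
  "laplace v f x \<equiv> \<Sum>a\<in>UNIV. dird (v a) (dird (v a) f) x"

lemma partial_eq_dird: "partial i f = dird (axis i 1) f"
  by (simp add: partial_def dird_def fun_eq_iff)

lemma dird_unique:
  assumes "((\<lambda>t. f (x + t *\<^sub>R v)) has_real_derivative d) (at 0)"
  shows "dird v f x = d"
  using assms vector_derivative_at
  unfolding dird_def has_real_derivative_iff_has_vector_derivative by blast

text \<open>Asking for a polynomial derivative rather than just a derivative makes the induction
  close; together with \<open>dird_unique\<close> it yields differentiability and the closure
  \<open>poly_dird\<close>, so that derivatives can be iterated.\<close>

lemma poly_has_dird:
  assumes "poly_fun f"
  shows "\<exists>f'. poly_fun f' \<and>
    (\<forall>x. ((\<lambda>t. f (x + t *\<^sub>R v)) has_real_derivative f' x) (at 0))"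
  using assms
proof induct
  case (linear f)
  then interpret bounded_linear f .
  have "((\<lambda>t. f (x + t *\<^sub>R v)) has_real_derivative f v) (at 0)" for x
    unfolding add scaleR by (auto intro!: derivative_eq_intros)
  then show ?case by (intro exI[of _ "\<lambda>_. f v"]) auto
next
  case (const c)
  show ?case by (rule exI[of _ "\<lambda>_. 0"]) auto
next
  case (add f g)
  then obtain f' g' where
    "poly_fun f'" "poly_fun g'"
    "\<And>x. ((\<lambda>t. f (x + t *\<^sub>R v)) has_real_derivative f' x) (at 0)"
    "\<And>x. ((\<lambda>t. g (x + t *\<^sub>R v)) has_real_derivative g' x) (at 0)" by blast
  then show ?case
    by (intro exI[of _ "\<lambda>x. f' x + g' x"]) (auto intro!: derivative_eq_intros)
next
  case (mult f g)
  then obtain f' g' where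
    "poly_fun f'" "poly_fun g'"
    "\<And>x. ((\<lambda>t. f (x + t *\<^sub>R v)) has_real_derivative f' x) (at 0)"
    "\<And>x. ((\<lambda>t. g (x + t *\<^sub>R v)) has_real_derivative g' x) (at 0)" by blast
  with mult(1,3) show ?case
    by (intro exI[of _ "\<lambda>x. f' x * g x + g' x * f x"]) (auto intro!: derivative_eq_intros)
qed

lemma has_dird_0:
  assumes "poly_fun f"
  shows "((\<lambda>t. f (x + t *\<^sub>R v)) has_real_derivative dird v f x) (at 0)"
  using poly_has_dird[OF assms, of v] dird_unique by metis

lemma has_dird:
  assumes "poly_fun f"
  shows "((\<lambda>t. f (x + t *\<^sub>R v)) has_real_derivative dird v f (x + s *\<^sub>R v)) (at s)"
proof -
  have "((\<lambda>t. f ((x + s *\<^sub>R v) + t *\<^sub>R v)) has_real_derivative dird v f (x + s *\<^sub>R v)) (at 0)"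
    by (rule has_dird_0[OF assms])
  then have "((\<lambda>t. f (x + (t + s) *\<^sub>R v)) has_real_derivative dird v f (x + s *\<^sub>R v)) (at 0)"
    by (simp add: scaleR_add_left algebra_simps)
  then show ?thesis
    using DERIV_shift[of "\<lambda>t. f (x + t *\<^sub>R v)" _ 0 s] by simp
qed

lemma poly_dird [intro]:
  assumes "poly_fun f"
  shows "poly_fun (dird v f)"
proof -
  obtain f' where "poly_fun f'"
    "\<And>x. ((\<lambda>t. f (x + t *\<^sub>R v)) has_real_derivative f' x) (at 0)"
    using poly_has_dird[OF assms] by metis
  then show ?thesis
    using dird_unique[of f _ v] by (metis (no_types, lifting) ext)
qed

lemma poly_dird_funpow [intro]:
  "poly_fun f \<Longrightarrow> poly_fun ((dird v ^^ n) f)"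
  by (induct n) auto

lemma dird_linear: "bounded_linear f \<Longrightarrow> dird v f = (\<lambda>_. f v)"
proof
  fix x assume "bounded_linear f"
  then interpret bounded_linear f .
  show "dird v f x = f v"
    unfolding add scaleR by (rule dird_unique) (auto simp: add scaleR intro!: derivative_eq_intros)
qed

lemma dird_const [simp]: "dird v (\<lambda>_. c) = (\<lambda>_. 0)"
  by (rule ext, rule dird_unique) auto

lemma dird_add:
  assumes "poly_fun f" "poly_fun g"
  shows "dird v (\<lambda>x. f x + g x) = (\<lambda>x. dird v f x + dird v g x)"
  by (rule ext, rule dird_unique) (auto intro!: derivative_eq_intros has_dird_0 assms)

lemma dird_diff:
  assumes "poly_fun f" "poly_fun g"
  shows "dird v (\<lambda>x. f x - g x) = (\<lambda>x. dird v f x - dird v g x)"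
  by (rule ext, rule dird_unique) (auto intro!: derivative_eq_intros has_dird_0 assms)

lemma dird_mult:
  assumes "poly_fun f" "poly_fun g"
  shows "dird v (\<lambda>x. f x * g x) = (\<lambda>x. dird v f x * g x + f x * dird v g x)"
  by (rule ext, rule dird_unique) (auto intro!: derivative_eq_intros has_dird_0 assms)

lemma dird_cmult:
  assumes "poly_fun f"
  shows "dird v (\<lambda>x. c * f x) = (\<lambda>x. c * dird v f x)"
  by (rule ext, rule dird_unique) (auto intro!: derivative_eq_intros has_dird_0 assms)

lemma dird_uminus:
  assumes "poly_fun f"
  shows "dird v (\<lambda>x. - f x) = (\<lambda>x. - dird v f x)"
  using dird_cmult[OF assms, of v "-1"] by simp

lemma dird_sum:
  assumes "\<And>i. i \<in> I \<Longrightarrow> poly_fun (f i)"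
  shows "dird v (\<lambda>x. \<Sum>i\<in>I. f i x) = (\<lambda>x. \<Sum>i\<in>I. dird v (f i) x)"
  by (rule ext, rule dird_unique) (auto intro!: derivative_eq_intros has_dird_0 assms)

text \<open>Symmetry of second derivatives is algebraic here: both sides obey the same sum and
  product rules, and both vanish on linear functions.\<close>

lemma dird_commute:
  assumes "poly_fun f"
  shows "dird v (dird w f) = dird w (dird v f)"
  using assms
proof induct
  case (linear f)
  then show ?case by (simp add: dird_linear)
next
  case (add f g)
  then show ?case by (simp add: dird_add poly_dird)
next
  case (mult f g)
  then show ?case
    by (simp add: dird_mult dird_add poly_dird poly_times fun_eq_iff algebra_simps)
qed auto

lemma dird_funpow_commute:
  assumes "poly_fun f"
  shows "dird v ((dird w ^^ n) f) = (dird w ^^ n) (dird v f)"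
proof (induct n)
  case (Suc n)
  show ?case
    using dird_commute[OF poly_dird_funpow[OF assms, of n w], of v w] Suc by simp
qed simp

lemma dird_funpow_commute2:
  assumes "poly_fun f"
  shows "(dird v ^^ m) ((dird w ^^ n) f) = (dird w ^^ n) ((dird v ^^ m) f)"
  using assms by (induct m) (auto simp: dird_funpow_commute poly_dird_funpow)

lemma dird_compose_linear:
  assumes "linear L"
  shows "dird v (\<lambda>x. f (L x)) = (\<lambda>x. dird (L v) f (L x))"
  unfolding dird_def linear_add[OF assms] linear_scale[OF assms] ..

lemma dird_funpow_compose_linear:
  assumes "linear L" "L v = w"
  shows "(dird v ^^ n) (\<lambda>x. f (L x)) = (\<lambda>x. (dird w ^^ n) f (L x))"
  by (induct n) (simp_all add: dird_compose_linear[OF assms(1)] assms(2))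

lemma poly_compose_linear [intro]:
  assumes "poly_fun f" "bounded_linear L"
  shows "poly_fun (\<lambda>x. f (L x))"
  using real_polynomial_function_compose[OF polynomial_function_bounded_linear[OF assms(2)] assms(1)]
  by (simp add: o_def)

lemma poly_continuous:
  "poly_fun f \<Longrightarrow> continuous_on S f"
  using continuous_on_polymonial_function real_polynomial_function_eq by blast

lemma dird_add_dir:
  assumes "poly_fun f"
  shows "dird (v + w) f = (\<lambda>x. dird v f x + dird w f x)"
  using assms
proof induct
  case (linear f)
  then show ?case by (simp add: dird_linear bounded_linear.linear linear_add)
next
  case (add f g)
  then show ?case by (simp add: dird_add fun_eq_iff)
next
  case (mult f g)
  then show ?case by (simp add: dird_mult fun_eq_iff algebra_simps)
qed auto

lemma dird_scale_dir:
  assumes "poly_fun f"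
  shows "dird (c *\<^sub>R v) f = (\<lambda>x. c * dird v f x)"
  using assms
proof induct
  case (linear f)
  then show ?case by (simp add: dird_linear bounded_linear.linear linear_scale)
next
  case (add f g)
  then show ?case by (simp add: dird_add fun_eq_iff algebra_simps)
next
  case (mult f g)
  then show ?case by (simp add: dird_mult fun_eq_iff algebra_simps)
qed auto

lemma dird_zero_dir [simp]: "dird 0 f = (\<lambda>_. 0)"
  by (rule ext, rule dird_unique) auto

lemma dird_sum_dir:
  assumes "poly_fun f"
  shows "dird (\<Sum>i\<in>I. c i *\<^sub>R v i) f x = (\<Sum>i\<in>I. c i * dird (v i) f x)"
proof (cases "finite I")
  case True
  then show ?thesis
    by induct (simp_all add: dird_add_dir[OF assms] dird_scale_dir[OF assms])
qed auto

lemma dird_along_zero_const: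
  assumes "poly_fun f" "\<And>s. dird v f (x + s *\<^sub>R v) = 0"
  shows "f (x + t *\<^sub>R v) = f x"
proof -
  have "(\<lambda>t. f (x + t *\<^sub>R v)) t = (\<lambda>t. f (x + t *\<^sub>R v)) 0"
    by (rule DERIV_isconst_all[of "\<lambda>t. f (x + t *\<^sub>R v)"])
      (metis has_dird[OF assms(1)] assms(2))
  then show ?thesis by simp
qed

section \<open>Homogeneity in part of the variables\<close>

text \<open>Homogeneity under the dilations of the image of a projection \<open>P\<close>: \<open>P = id\<close> gives the
  usual notion, and the projections of a product give homogeneity in one of two vector variables.\<close>

definition homog :: "('a::real_normed_vector \<Rightarrow> 'a) \<Rightarrow> nat \<Rightarrow> ('a \<Rightarrow> real) \<Rightarrow> bool" where
  "homog P k f \<longleftrightarrow> (\<forall>t x. f (x + (t - 1) *\<^sub>R P x) = t ^ k * f x)"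

lemma homog_id_iff: "homog (\<lambda>x. x) k f \<longleftrightarrow> (\<forall>t x. f (t *\<^sub>R x) = t ^ k * f x)"
  unfolding homog_def by (simp add: algebra_simps)

lemma homog_compose_linear:
  assumes "homog P k f" "linear L" "\<And>x. L (P' x) = P (L x)"
  shows "homog P' k (\<lambda>x. f (L x))"
  using assms by (simp add: homog_def linear_add linear_scale)

text \<open>The dilation with factor 0 erases the \<open>P\<close>-part of the argument, while 0^0 =
  1 keeps the value.\<close>

lemma homog_0_eq:
  assumes "homog P 0 f" "linear P" "P v = v"
  shows "f (x + s *\<^sub>R v) = f x"
proof -
  have "f (x + s *\<^sub>R v) = f ((x + s *\<^sub>R v) + (0 - 1) *\<^sub>R P (x + s *\<^sub>R v))"
    using assms(1) unfolding homog_def by (metis power_0 mult_1)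
  also have "\<dots> = f (x + (0 - 1) *\<^sub>R P x)"
    using assms(2,3) by (simp add: linear_add linear_scale algebra_simps)
  also have "\<dots> = f x"
    using assms(1) unfolding homog_def by (metis power_0 mult_1)
  finally show ?thesis .
qed

lemma homog_0_dird:
  assumes "homog P 0 f" "linear P" "P v = v"
  shows "dird v f = (\<lambda>_. 0)"
  by (rule ext, rule dird_unique) (simp add: homog_0_eq[OF assms])

lemma dilation_linear: "linear P \<Longrightarrow> linear (\<lambda>x. x + c *\<^sub>R P x)"
  by (auto simp: linear_iff algebra_simps)

lemma homog_dird:
  assumes f: "poly_fun f" and h: "homog P (Suc k) f" and P: "linear P" "P v = v"
  shows "homog P k (dird v f)"
  unfolding homog_def
proof (intro allI)
  fix t x
  \<comment> \<open>Differentiating the homogeneity identity leaves a factor \<open>t\<close> on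
    both sides, so this settles only nonzero \<open>t\<close>; the value at 0 is then obtained by
    continuity in \<open>t\<close>.\<close>
  have *: "t * dird v f (x + (t - 1) *\<^sub>R P x) = t * (t ^ k * dird v f x)" for t
  proof -
    have "dird v (\<lambda>x. f (x + (t - 1) *\<^sub>R P x)) x = dird v (\<lambda>x. t ^ Suc k * f x) x"
      using h by (simp add: homog_def)
    then have "dird (v + (t - 1) *\<^sub>R v) f (x + (t - 1) *\<^sub>R P x) = t ^ Suc k * dird v f x"
      by (simp add: dird_compose_linear[OF dilation_linear[OF P(1)]] P(2) dird_cmult[OF f] del: power_Suc)
    moreover have "v + (t - 1) *\<^sub>R v = t *\<^sub>R v" by (simp add: algebra_simps)
    ultimately show ?thesis
      by (simp add: dird_scale_dir[OF f])
  qed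
  show "dird v f (x + (t - 1) *\<^sub>R P x) = t ^ k * dird v f x"
  proof (cases "t = 0")
    case False
    then show ?thesis using *[of t] by simp
  next
    case True
    have "continuous_on UNIV (\<lambda>t. dird v f (x + (t - 1) *\<^sub>R P x) - t ^ k * dird v f x)"
      by (intro continuous_intros continuous_on_compose2[OF poly_continuous[OF poly_dird[OF f], of UNIV]]) auto
    then have "isCont (\<lambda>t. dird v f (x + (t - 1) *\<^sub>R P x) - t ^ k * dird v f x) 0"
      by (simp add: continuous_on_eq_continuous_at)
    then have "((\<lambda>t. dird v f (x + (t - 1) *\<^sub>R P x) - t ^ k * dird v f x)
        \<longlongrightarrow> dird v f (x + (0 - 1) *\<^sub>R P x) - 0 ^ k * dird v f x) (at 0)"
      by (rule isContD)
    moreover have "((\<lambda>t. dird v f (x + (t - 1) *\<^sub>R P x) - t ^ k * dird v f x) \<longlongrightarrow> 0) (at 0)"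
    proof (rule tendsto_eventually, rule eventually_at_filter[THEN iffD2], rule always_eventually,
        intro allI impI)
      fix t :: real assume "t \<noteq> 0"
      then show "dird v f (x + (t - 1) *\<^sub>R P x) - t ^ k * dird v f x = 0" using *[of t] by simp
    qed
    ultimately have "dird v f (x + (0 - 1) *\<^sub>R P x) - 0 ^ k * dird v f x = 0"
      by (rule tendsto_unique[OF at_neq_bot])
    then show ?thesis using True by simp
  qed
qed

lemma homog_dird_other:
  assumes f: "poly_fun f" and h: "homog P k f" and P: "linear P" "P v = 0"
  shows "homog P k (dird v f)"
  unfolding homog_def
proof (intro allI)
  fix t x
  have "dird v (\<lambda>x. f (x + (t - 1) *\<^sub>R P x)) x = dird v (\<lambda>x. t ^ k * f x) x"
    using h by (simp add: homog_def)
  then show "dird v f (x + (t - 1) *\<^sub>R P x) = t ^ k * dird v f x"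
    by (simp add: dird_compose_linear[OF dilation_linear[OF P(1)]] P(2) dird_cmult[OF f])
qed

lemma homog_dird_funpow:
  assumes f: "poly_fun f" and h: "homog P k f" and P: "linear P" "P v = v" and "j \<le> k"
  shows "homog P (k - j) ((dird v ^^ j) f)"
  using \<open>j \<le> k\<close>
proof (induct j)
  case (Suc j)
  then have "homog P (Suc (k - Suc j)) ((dird v ^^ j) f)" by (simp add: Suc_diff_Suc)
  then show ?case
    unfolding funpow.simps o_apply by (rule homog_dird[OF poly_dird_funpow[OF f] _ P])
qed (simp add: h)

lemma homog_dird_funpow_other:
  assumes f: "poly_fun f" and h: "homog P k f" and P: "linear P" "P v = 0"
  shows "homog P k ((dird v ^^ j) f)"
proof (induct j)
  case (Suc j)
  then show ?case
    unfolding funpow.simps o_apply by (rule homog_dird_other[OF poly_dird_funpow[OF f] _ P])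
qed (simp add: h)

lemma dird_funpow_zero: "(dird v ^^ j) (\<lambda>_. 0) = (\<lambda>_. 0)"
  by (induct j) simp_all

lemma homog_dird_nilpotent:
  assumes f: "poly_fun f" and h: "homog P k f" and P: "linear P" "P v = v" and "k < j"
  shows "(dird v ^^ j) f = (\<lambda>_. 0)"
proof -
  have "(dird v ^^ Suc k) f = (\<lambda>_. 0)"
    using homog_0_dird[OF homog_dird_funpow[OF f h P order_refl, unfolded diff_self_eq_0] P]
    unfolding funpow.simps o_apply .
  then have "(dird v ^^ (j - Suc k)) ((dird v ^^ Suc k) f) = (\<lambda>_. 0)"
    by (simp add: dird_funpow_zero)
  then have "(dird v ^^ (j - Suc k + Suc k)) f = (\<lambda>_. 0)"
    by (simp only: funpow_add o_apply)
  then show ?thesis using \<open>k < j\<close> by simp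
qed

lemma homog_euler:
  assumes f: "poly_fun f" and h: "homog P k f"
  shows "dird (P x) f x = k * f x"
proof -
  have "((\<lambda>t. f (x + t *\<^sub>R P x)) has_real_derivative dird (P x) f x) (at 0)"
    by (rule has_dird_0[OF f])
  moreover have "f (x + t *\<^sub>R P x) = (1 + t) ^ k * f x" for t
    using h[unfolded homog_def, rule_format, of x "1 + t"] by simp
  ultimately have "((\<lambda>t. (1 + t) ^ k * f x) has_real_derivative dird (P x) f x) (at 0)"
    by simp
  moreover have "((\<lambda>t. (1 + t) ^ k * f x) has_real_derivative k * f x) (at 0)"
    by (auto intro!: derivative_eq_intros)
  ultimately show ?thesis by (rule DERIV_unique)
qed

text \<open>A Taylor expansion along a line without remainder term: nilpotency of the derivative is
  the base of the induction, and in the step the derivative vanishes along the whole line, which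
  makes \<open>f\<close> constant there.\<close>

lemma taylor_vanish:
  assumes "poly_fun f" "(dird v ^^ n) f = (\<lambda>_. 0)"
    and "\<And>j. (dird v ^^ j) f x = 0"
  shows "f (x + s *\<^sub>R v) = 0"
  using assms
proof (induct n arbitrary: f s)
  case (Suc n)
  have "dird v f (x + s *\<^sub>R v) = 0" for s
  proof (rule Suc.hyps)
    show "(dird v ^^ n) (dird v f) = (\<lambda>_. 0)"
      using Suc.prems(2) by (simp only: funpow_Suc_right o_apply)
    show "(dird v ^^ j) (dird v f) x = 0" for j
      using Suc.prems(3)[of "Suc j"] by (simp only: funpow_Suc_right o_apply)
  qed (use Suc.prems(1) in auto)
  then have "f (x + s *\<^sub>R v) = f x"
    by (rule dird_along_zero_const[OF Suc.prems(1)])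
  then show ?case using Suc.prems(3)[of 0] by simp
qed simp

text \<open>By Euler's relation the j-th derivative along \<open>v\<close> at \<open>v\<close> is k
  (k - 1) ... (k - j + 1) times the value at \<open>v\<close>.\<close>

lemma homog_vanish_at_direction:
  assumes f: "poly_fun f" and h: "homog (\<lambda>x. x) k f" and "f v = 0"
  shows "(dird v ^^ j) f v = 0"
proof (induct j)
  case (Suc j)
  show ?case
  proof (cases "j \<le> k")
    case True
    have "dird v ((dird v ^^ j) f) v = (k - j) * (dird v ^^ j) f v"
      by (rule homog_euler[OF poly_dird_funpow[OF f] homog_dird_funpow[OF f h _ _ True]])
        (simp_all add: linear_id[unfolded id_def])
    then show ?thesis using Suc by simp
  next
    case False
    then show ?thesis
      using homog_dird_nilpotent[OF f h, of v "Suc j"] by (simp add: linear_id[unfolded id_def])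
  qed
qed (simp add: assms)

section \<open>The Casimir operator on harmonic polynomials\<close>

text \<open>The generator of rotations in the (a, b)-plane. Keeping the coordinates \<xi> and the
  frame \<open>v\<close> as parameters allows it to act on one variable of a kernel only.\<close>

definition angular :: "('i \<Rightarrow> 'a \<Rightarrow> real) \<Rightarrow> ('i \<Rightarrow> 'a::real_normed_vector) \<Rightarrow> 'i \<Rightarrow> 'i \<Rightarrow> ('a \<Rightarrow> real) \<Rightarrow> 'a \<Rightarrow> real" where
  "angular \<xi> v a b f = (\<lambda>x. \<xi> a x * dird (v b) f x - \<xi> b x * dird (v a) f x)"

lemma poly_angular:
  assumes "poly_fun f" "bounded_linear (\<xi> a)" "bounded_linear (\<xi> b)"
  shows "poly_fun (angular \<xi> v a b f)"
  unfolding angular_def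
  by (intro real_polynomial_function_diff poly_times
      poly_of_linear poly_dird assms)

text \<open>The parameter \<delta> is 1 for \<open>a = b\<close> and 0 otherwise, so that the
  Casimir sum can run over all ordered pairs.\<close>

lemma angular_twice:
  assumes f: "poly_fun f"
    and \<xi>: "bounded_linear (\<xi> a)" "bounded_linear (\<xi> b)"
    and dual: "\<xi> a (v a) = 1" "\<xi> b (v b) = 1" "\<xi> a (v b) = \<delta>" "\<xi> b (v a) = \<delta>"
  shows "angular \<xi> v a b (angular \<xi> v a b f) x =
    (\<xi> a x)\<^sup>2 * dird (v b) (dird (v b) f) x + (\<xi> b x)\<^sup>2 * dird (v a) (dird (v a) f) x
    - 2 * (\<xi> a x * (\<xi> b x * dird (v b) (dird (v a) f) x))
    - \<xi> a x * dird (v a) f x - \<xi> b x * dird (v b) f x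
    + \<delta> * (\<xi> a x * dird (v b) f x + \<xi> b x * dird (v a) f x)"
proof -
  have 1: "dird w (angular \<xi> v a b f) x =
     (\<xi> a w * dird (v b) f x + \<xi> a x * dird w (dird (v b) f) x)
     - (\<xi> b w * dird (v a) f x + \<xi> b x * dird w (dird (v a) f) x)" for w
    unfolding angular_def using f \<xi>
    by (subst dird_diff) (auto simp: dird_mult poly_of_linear dird_linear poly_dird)
  have 2: "dird (v a) (dird (v b) f) = dird (v b) (dird (v a) f)"
    by (rule dird_commute[OF f])
  show ?thesis
    unfolding angular_def[of \<xi> v a b "angular \<xi> v a b f"] 1 2 dual
    by (simp add: algebra_simps power2_eq_square)
qed

text \<open>With E the Euler operator and N = \<open>card A\<close>, the sum of the squared
  generators over unordered pairs is |x|^2 Laplace - E (E + N - 2); on a harmonic function only the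
  second part survives, and ordered pairs double it. The set \<open>A\<close> may omit coordinates,
  which is how the rotations about a pole are treated.\<close>

lemma casimir:
  fixes \<xi> :: "'i \<Rightarrow> 'a::real_normed_vector \<Rightarrow> real" and k :: nat and f :: "'a \<Rightarrow> real"
  assumes A: "finite A" and f: "poly_fun f"
    and \<xi>: "\<And>a. a \<in> A \<Longrightarrow> bounded_linear (\<xi> a)"
    and dual: "\<And>a b. a \<in> A \<Longrightarrow> b \<in> A \<Longrightarrow> \<xi> a (v b) = (if a = b then 1 else 0)"
    and lap: "\<And>x. (\<Sum>a\<in>A. dird (v a) (dird (v a) f) x) = 0"
    and euler: "\<And>x. (\<Sum>a\<in>A. \<xi> a x * dird (v a) f x) = k * f x"
  shows "(\<Sum>a\<in>A. \<Sum>b\<in>A. angular \<xi> v a b (angular \<xi> v a b f) x) = - 2 * real k * (real k + card A - 2) * f x"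
proof -
  \<comment> \<open>Euler's relation differentiated along \<open>v b\<close>; it evaluates the mixed
    second derivatives in the double sum.\<close>
  have eb: "(\<Sum>a\<in>A. \<xi> a x * dird (v b) (dird (v a) f) x) = (real k - 1) * dird (v b) f x" if "b \<in> A" for b
  proof -
    have "dird (v b) (\<lambda>x. \<Sum>a\<in>A. \<xi> a x * dird (v a) f x) x = dird (v b) (\<lambda>x. k * f x) x"
      by (simp add: euler)
    also have "dird (v b) (\<lambda>x. \<Sum>a\<in>A. \<xi> a x * dird (v a) f x) x
        = (\<Sum>a\<in>A. dird (v b) (\<lambda>x. \<xi> a x * dird (v a) f x) x)"
      by (rule dird_sum[THEN fun_cong])
        (intro poly_times poly_of_linear poly_dird f \<xi>)
    also have "\<dots> = (\<Sum>a\<in>A. (if a = b then dird (v a) f x else 0) + \<xi> a x * dird (v b) (dird (v a) f) x)"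
      using f \<xi> dual that
      by (intro sum.cong) (auto simp: dird_mult poly_of_linear dird_linear poly_dird)
    also have "\<dots> = dird (v b) f x + (\<Sum>a\<in>A. \<xi> a x * dird (v b) (dird (v a) f) x)"
      using that A by (simp add: sum.distrib)
    finally show ?thesis by (simp add: dird_cmult[OF f] algebra_simps)
  qed
  let ?X = "\<lambda>a b. (\<xi> a x)\<^sup>2 * dird (v b) (dird (v b) f) x + (\<xi> b x)\<^sup>2 * dird (v a) (dird (v a) f) x
    - 2 * (\<xi> a x * (\<xi> b x * dird (v b) (dird (v a) f) x))
    - \<xi> a x * dird (v a) f x - \<xi> b x * dird (v b) f x
    + (if a = b then 2 * (\<xi> a x * dird (v a) f x) else 0)"
  have "(\<Sum>a\<in>A. \<Sum>b\<in>A. angular \<xi> v a b (angular \<xi> v a b f) x) = (\<Sum>a\<in>A. \<Sum>b\<in>A. ?X a b)"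
  proof (intro sum.cong refl)
    fix a b assume "a \<in> A" "b \<in> A"
    then show "angular \<xi> v a b (angular \<xi> v a b f) x = ?X a b"
      by (subst angular_twice[OF f \<xi> \<xi>, where \<delta> = "if a = b then 1 else 0"]) (auto simp: dual)
  qed
  also have "\<dots> = (\<Sum>a\<in>A. \<Sum>b\<in>A. (\<xi> a x)\<^sup>2 * dird (v b) (dird (v b) f) x)
     + (\<Sum>a\<in>A. \<Sum>b\<in>A. (\<xi> b x)\<^sup>2 * dird (v a) (dird (v a) f) x)
     - 2 * (\<Sum>a\<in>A. \<Sum>b\<in>A. \<xi> a x * (\<xi> b x * dird (v b) (dird (v a) f) x))
     - (\<Sum>a\<in>A. \<Sum>b\<in>A. \<xi> a x * dird (v a) f x) - (\<Sum>a\<in>A. \<Sum>b\<in>A. \<xi> b x * dird (v b) f x)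
     + 2 * (\<Sum>a\<in>A. \<xi> a x * dird (v a) f x)"
    using A by (simp add: sum.distrib sum_subtractf sum_distrib_left)
  also have "(\<Sum>a\<in>A. \<Sum>b\<in>A. (\<xi> a x)\<^sup>2 * dird (v b) (dird (v b) f) x) = 0"
    by (simp add: sum_distrib_left[symmetric] lap)
  also have "(\<Sum>a\<in>A. \<Sum>b\<in>A. (\<xi> b x)\<^sup>2 * dird (v a) (dird (v a) f) x) = 0"
    by (subst sum.swap) (simp add: sum_distrib_left[symmetric] lap)
  also have "(\<Sum>a\<in>A. \<Sum>b\<in>A. \<xi> a x * (\<xi> b x * dird (v b) (dird (v a) f) x))
     = (\<Sum>b\<in>A. \<xi> b x * (\<Sum>a\<in>A. \<xi> a x * dird (v b) (dird (v a) f) x))"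
    by (subst sum.swap) (simp add: sum_distrib_left mult_ac)
  also have "\<dots> = (\<Sum>b\<in>A. \<xi> b x * ((real k - 1) * dird (v b) f x))"
    using eb by simp
  also have "\<dots> = (real k - 1) * (k * f x)"
    by (simp add: euler[symmetric] sum_distrib_left mult_ac)
  also have "(\<Sum>a\<in>A. \<Sum>b\<in>A. \<xi> a x * dird (v a) f x) = card A * (k * f x)"
    by (simp add: euler[symmetric] sum_distrib_left)
  also have "(\<Sum>a\<in>A. \<Sum>b\<in>A. \<xi> b x * dird (v b) f x) = card A * (k * f x)"
    by (simp add: euler)
  also have "(\<Sum>a\<in>A. \<xi> a x * dird (v a) f x) = k * f x" by (rule euler)
  finally show ?thesis by (simp add: algebra_simps)
qed

section \<open>Harmonic functions determined at a point\<close>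

lemma linear_self: "linear (\<lambda>x. x)"
  by (simp add: linear_iff)

text \<open>Setting x_b to 0 is a projection of the whole space, so coefficients with respect to
  powers of x_b stay functions on the same type.\<close>

definition erase_coord :: "'n \<Rightarrow> real^'n \<Rightarrow> real^'n" where
  "erase_coord b x = x - (x $ b) *\<^sub>R axis b 1"

lemma bounded_linear_erase_coord: "bounded_linear (erase_coord b)"
proof -
  have "linear (erase_coord b)"
    by (auto simp: erase_coord_def linear_iff algebra_simps)
  then show ?thesis by (rule linear_conv_bounded_linear[THEN iffD1])
qed

lemmas linear_erase_coord = bounded_linear.linear[OF bounded_linear_erase_coord]

lemma erase_coord_axis: "erase_coord b (axis c 1) = (if c = b then 0 else axis c 1)"
  by (auto simp: erase_coord_def axis_def)

lemma erase_coord_nth: "erase_coord b x $ c = (if c = b then 0 else x $ c)"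
  by (auto simp: erase_coord_def axis_def)

lemma erase_coord_split: "x = erase_coord b x + (x $ b) *\<^sub>R axis b 1"
  by (simp add: erase_coord_def)

lemma axis_expansion: "(x::real^'n) = (\<Sum>a\<in>UNIV. (x $ a) *\<^sub>R axis a 1)"
  using basis_expansion[of x] by (simp add: scalar_mult_eq_scaleR)

lemma dird_coord_mult:
  assumes "bounded_linear l" "l v = 0" "poly_fun f"
  shows "(dird v ^^ j) (\<lambda>x. l x * f x) = (\<lambda>x. l x * (dird v ^^ j) f x)"
proof (induct j)
  case (Suc j)
  then show ?case
    using assms by (simp add: dird_mult poly_of_linear dird_linear poly_dird_funpow)
qed simp

lemma dird_funpow_diff:
  assumes "poly_fun f" "poly_fun g"
  shows "(dird v ^^ j) (\<lambda>x. f x - g x) = (\<lambda>x. (dird v ^^ j) f x - (dird v ^^ j) g x)"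
  by (induct j) (simp_all add: dird_diff poly_dird_funpow assms)

lemma dird_funpow_sum:
  assumes "\<And>i. i \<in> I \<Longrightarrow> poly_fun (f i)"
  shows "(dird v ^^ j) (\<lambda>x. \<Sum>i\<in>I. f i x) = (\<lambda>x. \<Sum>i\<in>I. (dird v ^^ j) (f i) x)"
  by (induct j) (simp_all add: dird_sum poly_dird_funpow assms)

abbreviation (input) "coord \<equiv> (\<lambda>a (x::real^'n). x $ a)"
abbreviation (input) "unitv \<equiv> (\<lambda>a. axis a 1 :: real^'n)"

lemma homog_euler_coord:
  fixes f :: "real^'n \<Rightarrow> real"
  assumes "poly_fun f" "homog (\<lambda>x. x) k f"
  shows "(\<Sum>a\<in>UNIV. x $ a * dird (axis a 1) f x) = k * f x"
  using homog_euler[OF assms, of x] dird_sum_dir[OF assms(1), of "\<lambda>a. x $ a" "\<lambda>a. axis a 1" UNIV x]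
  by (simp only: axis_expansion[symmetric])

lemma sum_if_zero:
  fixes g :: "'n::finite \<Rightarrow> real"
  shows "(\<Sum>a\<in>UNIV. if a = b then 0 else g a) = (\<Sum>a\<in>UNIV. g a) - g b"
proof -
  have "(\<Sum>a\<in>UNIV. if a = b then 0 else g a) = (\<Sum>a\<in>UNIV. g a - (if a = b then g a else 0))"
    by (rule sum.cong) simp_all
  also have "\<dots> = (\<Sum>a\<in>UNIV. g a) - (\<Sum>a\<in>UNIV. if a = b then g a else 0)"
    by (rule sum_subtractf)
  also have "(\<Sum>a\<in>UNIV. if a = b then g a else 0) = g b"
    by simp
  finally show ?thesis .
qed

lemma homog_id_0_const:
  assumes "homog (\<lambda>x. x) 0 f"
  shows "f x = f y"
  using homog_0_eq[OF assms linear_self refl, of y 1 "x - y"] by simp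

text \<open>The coefficient of the highest power of \<open>x\<^sub>b\<close> in \<open>f\<close> is harmonic and annihilated by the rotations in the
  remaining variables, so its Casimir eigenvalue is 0 and its degree is at most 1. It is then determined by
  the value and the gradient of \<open>f\<close> at \<open>e\<^sub>b\<close>.\<close>

lemma zonal_vanish:
  fixes f :: "real^'n \<Rightarrow> real"
  assumes f: "poly_fun f" and h: "homog (\<lambda>x. x) k f"
    and bA: "b \<notin> A" and indep: "\<And>c. c \<notin> insert b A \<Longrightarrow> dird (axis c 1) f = (\<lambda>_. 0)"
    and lap: "\<And>x. laplace unitv f x = 0"
    and val: "f (axis b 1) = 0" and grad: "\<And>c. dird (axis c 1) f (axis b 1) = 0"
    and inv: "\<And>c d. c \<in> A \<Longrightarrow> d \<in> A \<Longrightarrow> angular coord unitv c d f = (\<lambda>_. 0)"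
  shows "f = (\<lambda>_. 0)"
proof (rule ccontr)
  let ?D = "dird (axis b 1 :: real^'n)"
  note id = linear_self
  \<comment> \<open>j! times the coefficient of x_b^j in \<open>f\<close>, as a function of the
    other coordinates.\<close>
  define F where "F j x = (?D ^^ j) f (erase_coord b x)" for j x
  assume "f \<noteq> (\<lambda>_. 0)"
  have D0: "(?D ^^ j) f = (\<lambda>_. 0)" if "k < j" for j
    by (rule homog_dird_nilpotent[OF f h id refl that])
  have ex: "\<exists>j. F j \<noteq> (\<lambda>_. 0)"
  proof (rule ccontr)
    assume "\<not> ?thesis"
    then have *: "(?D ^^ j) f (erase_coord b x) = 0" for j x
      by (simp add: F_def fun_eq_iff)
    have "f x = 0" for x
      using taylor_vanish[OF f D0[OF lessI] *, of x "x $ b"] erase_coord_split[of x b] by simp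
    with \<open>f \<noteq> (\<lambda>_. 0)\<close> show False by auto
  qed
  have bound: "j \<le> k" if "F j \<noteq> (\<lambda>_. 0)" for j
  proof (rule ccontr)
    assume "\<not> j \<le> k"
    then have "F j x = 0" for x using D0[of j] by (simp add: F_def)
    with that show False by (simp add: fun_eq_iff)
  qed
  define J where "J = (GREATEST j. F j \<noteq> (\<lambda>_. 0))"
  have J: "F J \<noteq> (\<lambda>_. 0)"
    unfolding J_def by (rule GreatestI_ex_nat[OF ex bound])
  have Jmax: "F j = (\<lambda>_. 0)" if "J < j" for j
  proof (rule ccontr)
    assume "F j \<noteq> (\<lambda>_. 0)"
    then have "j \<le> J" unfolding J_def using bound by (intro Greatest_le_nat[where b = k])
    with that show False by simp
  qed
  define i where "i = k - J"
  have Jk: "J \<le> k" using bound J by blast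
  have DJh: "homog (\<lambda>x. x) i ((?D ^^ J) f)"
    unfolding i_def by (rule homog_dird_funpow[OF f h id refl Jk])
  have pF: "poly_fun (F j)" for j
    unfolding F_def[abs_def] by (rule poly_compose_linear[OF poly_dird_funpow[OF f] bounded_linear_erase_coord])
  have hF: "homog (\<lambda>x. x) i (F J)"
    using DJh by (simp add: homog_id_iff F_def linear_scale[OF linear_erase_coord])
  have dF: "dird (axis c 1) (F j) = (\<lambda>x. if c = b then 0 else (?D ^^ j) (dird (axis c 1) f) (erase_coord b x))" for c j
  proof -
    have "dird (axis c 1) (F j) = (\<lambda>x. dird (erase_coord b (axis c 1)) ((?D ^^ j) f) (erase_coord b x))"
      unfolding F_def[abs_def] by (rule dird_compose_linear[OF linear_erase_coord])
    then show ?thesis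
      by (cases "c = b") (simp_all add: erase_coord_axis dird_funpow_commute[OF f, of "axis c 1"])
  qed
  have ddF: "dird (axis c 1) (dird (axis c 1) (F j)) =
      (\<lambda>x. if c = b then 0 else (?D ^^ j) (dird (axis c 1) (dird (axis c 1) f)) (erase_coord b x))" for c j
  proof (cases "c = b")
    case False
    have "dird (axis c 1) (\<lambda>x. (?D ^^ j) (dird (axis c 1) f) (erase_coord b x))
       = (\<lambda>x. dird (erase_coord b (axis c 1)) ((?D ^^ j) (dird (axis c 1) f)) (erase_coord b x))"
      by (rule dird_compose_linear[OF linear_erase_coord])
    with False show ?thesis
      by (simp add: dF erase_coord_axis dird_funpow_commute[OF poly_dird[OF f], of "axis c 1"])
  qed (simp add: dF)
  have indF: "dird (axis c 1) (F j) = (\<lambda>_. 0)" if "c \<notin> A" for c j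
    unfolding dF using indep[of c] that by (cases "c = b") (auto simp: dird_funpow_zero)
  \<comment> \<open>The coefficient of x_b^J in the Laplace equation of \<open>f\<close> shows that
    the Laplacian of \<open>F J\<close> is minus \<open>F (J + 2)\<close>, which is 0 by maximality
    of \<open>J\<close>.\<close>
  have lapF: "(\<Sum>a\<in>UNIV. dird (axis a 1) (dird (axis a 1) (F J)) x) = 0" for x
  proof -
    have "(\<Sum>a\<in>UNIV. dird (axis a 1) (dird (axis a 1) (F J)) x)
       = (\<Sum>a\<in>UNIV. (?D ^^ J) (dird (axis a 1) (dird (axis a 1) f)) (erase_coord b x))
         - (?D ^^ J) (?D (?D f)) (erase_coord b x)"
      unfolding ddF by (rule sum_if_zero)
    also have "(\<Sum>a\<in>UNIV. (?D ^^ J) (dird (axis a 1) (dird (axis a 1) f)) (erase_coord b x))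
       = (?D ^^ J) (\<lambda>x. \<Sum>a\<in>UNIV. dird (axis a 1) (dird (axis a 1) f) x) (erase_coord b x)"
      by (subst dird_funpow_sum) (auto intro!: poly_dird f)
    also have "\<dots> = 0" by (simp add: lap dird_funpow_zero)
    also have "(?D ^^ J) (?D (?D f)) = (?D ^^ Suc (Suc J)) f"
      by (simp only: funpow_Suc_right o_apply)
    also have "(?D ^^ Suc (Suc J)) f (erase_coord b x) = F (Suc (Suc J)) x"
      unfolding F_def ..
    also have "\<dots> = 0" using Jmax[of "Suc (Suc J)"] by simp
    finally show ?thesis by simp
  qed
  have sumA: "(\<Sum>a\<in>UNIV. g a) = (\<Sum>a\<in>A. g a)" if "\<And>a. a \<notin> A \<Longrightarrow> g a = 0" for g :: "'n \<Rightarrow> real"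
    using that by (intro sum.mono_neutral_right) auto
  have eulA: "(\<Sum>a\<in>A. x $ a * dird (axis a 1) (F J) x) = i * F J x" for x
    using homog_euler_coord[OF pF hF, of x] by (subst (asm) sumA) (simp_all add: indF)
  have lapA: "(\<Sum>a\<in>A. dird (axis a 1) (dird (axis a 1) (F J)) x) = 0" for x
    using lapF[of x] by (subst (asm) sumA) (simp_all add: indF)
  \<comment> \<open>The generator does not involve x_b, hence commutes with \<open>?D\<close> and
    with erasing x_b.\<close>
  have invF: "angular coord unitv c d (F J) = (\<lambda>_. 0)" if "c \<in> A" "d \<in> A" for c d
  proof
    fix x
    have ne: "c \<noteq> b" "d \<noteq> b" using that bA by auto
    have cx: "(axis b 1 :: real^'n) $ c = 0" "(axis b 1 :: real^'n) $ d = 0"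
      using ne by (auto simp: axis_def)
    have pc: "poly_fun (\<lambda>x. x $ c * dird (axis d 1) f x)" for c d
      by (intro poly_times poly_of_linear
          bounded_linear_vec_nth poly_dird f)
    have "0 = (?D ^^ J) (angular coord unitv c d f) (erase_coord b x)"
      using inv[OF that] by (simp add: dird_funpow_zero)
    also have "\<dots> = x $ c * (?D ^^ J) (dird (axis d 1) f) (erase_coord b x)
        - x $ d * (?D ^^ J) (dird (axis c 1) f) (erase_coord b x)"
      unfolding angular_def
      by (simp add: dird_funpow_diff[OF pc[of c d] pc[of d c]] dird_coord_mult[OF bounded_linear_vec_nth]
          cx poly_dird[OF f] erase_coord_nth ne)
    finally show "angular coord unitv c d (F J) x = 0"
      by (simp add: angular_def dF ne)
  qed
  have C: "(\<Sum>a\<in>A. \<Sum>b\<in>A. angular coord unitv a b (angular coord unitv a b (F J)) x)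
      = - 2 * real i * (real i + card A - 2) * F J x" for x
    by (rule casimir[OF finite pF bounded_linear_vec_nth _ lapA eulA]) (simp add: axis_def)
  have angular0: "angular coord unitv a b (\<lambda>_. 0) = (\<lambda>_. 0)" for a b
    by (simp add: angular_def)
  \<comment> \<open>The generators annihilate \<open>F J\<close>, so the Casimir eigenvalue has to
    vanish: i = 0 or i + \<open>card A\<close> = 2.\<close>
  have Z: "- 2 * real i * (real i + card A - 2) * F J x = 0" for x
    unfolding C[symmetric] by (simp add: invF angular0)
  obtain x0 where x0: "F J x0 \<noteq> 0" using J by auto
  have "i = 0 \<or> real i + real (card A) = 2" using Z[of x0] x0 by simp
  \<comment> \<open>A coefficient of degree 0 is constant, so it can be read off at e_b, where
    \<open>val\<close> forces all derivatives along e_b to vanish.\<close>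
  moreover have "i \<noteq> 0"
  proof
    assume i: "i = 0"
    have "(?D ^^ J) f (erase_coord b x0) = (?D ^^ J) f (axis b 1)"
      by (rule homog_id_0_const[OF DJh[unfolded i]])
    also have "\<dots> = 0" by (rule homog_vanish_at_direction[OF f h val])
    finally show False using x0 by (simp add: F_def)
  qed
  \<comment> \<open>For a linear coefficient, its value at \<open>w\<close> is its derivative along
    \<open>w\<close>, a constant that can again be read off at e_b; there the vanishing gradient
    takes the part of \<open>val\<close>.\<close>
  moreover have "i \<noteq> 1"
  proof
    assume i: "i = 1"
    define w where "w = erase_coord b x0"
    have k: "k = Suc (k - 1)" and Jk: "J \<le> k - 1" "k - 1 - J = 0" using i unfolding i_def by auto
    have h1: "homog (\<lambda>x. x) (k - 1) (dird w f)"
      by (rule homog_dird[OF f _ id refl]) (subst k[symmetric], rule h)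
    have "(?D ^^ J) f w = dird w ((?D ^^ J) f) w"
      using homog_euler[OF poly_dird_funpow[OF f] DJh, of w] i by simp
    also have "\<dots> = (?D ^^ J) (dird w f) w"
      by (simp add: dird_funpow_commute[OF f])
    also have "\<dots> = (?D ^^ J) (dird w f) (axis b 1)"
      by (rule homog_id_0_const[OF homog_dird_funpow[OF poly_dird[OF f] h1 id refl Jk(1), unfolded Jk(2)]])
    also have "\<dots> = 0"
    proof (rule homog_vanish_at_direction[OF poly_dird[OF f] h1])
      show "dird w f (axis b 1) = 0"
        using dird_sum_dir[OF f, of "\<lambda>a. w $ a" "\<lambda>a. axis a 1" UNIV "axis b 1"]
        by (simp add: grad axis_expansion[symmetric])
    qed
    finally show False using x0 by (simp add: F_def w_def)
  qed
  \<comment> \<open>This removes the last root, i = 2 with no coordinates left: for i at least 2 and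
    nonempty \<open>A\<close> the sum i + \<open>card A\<close> exceeds 2.\<close>
  moreover have "A \<noteq> {}"
  proof
    assume "A = {}"
    then have "real i * F J x0 = 0" using eulA[of x0] by simp
    with x0 \<open>i \<noteq> 0\<close> show False by simp
  qed
  then have "card A > 0" by (simp add: card_gt_0_iff)
  ultimately show False by linarith
qed

section \<open>Rotations\<close>

definition rotation :: "(real^'n \<Rightarrow> real^'n) \<Rightarrow> bool" where
  "rotation T \<longleftrightarrow> orthogonal_transformation T \<and> det (matrix T) = 1"

lemma poly_has_derivative:
  assumes "poly_fun f"
  shows "(f has_derivative (\<lambda>v. dird v f x)) (at x)"
  using assms
proof induct
  case (linear f)
  then show ?case
    by (simp add: dird_linear bounded_linear_imp_has_derivative)
next
  case (add f g)
  then show ?case by (simp add: dird_add has_derivative_add)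
next
  case (mult f g)
  show ?case
    unfolding dird_mult[OF mult(1,3)]
    using has_derivative_mult[OF mult(2,4)] by (simp add: add.commute)
qed simp

lemma poly_chain:
  assumes "poly_fun f" "(\<gamma> has_vector_derivative v) (at t)"
  shows "((\<lambda>t. f (\<gamma> t)) has_real_derivative dird v f (\<gamma> t)) (at t)"
proof -
  have "((\<lambda>t. f (\<gamma> t)) has_derivative (\<lambda>s. dird (s *\<^sub>R v) f (\<gamma> t))) (at t)"
    using has_derivative_compose[OF assms(2)[unfolded has_vector_derivative_def]
        poly_has_derivative[OF assms(1), of "\<gamma> t"]] .
  then show ?thesis
    by (simp add: has_field_derivative_def dird_scale_dir[OF assms(1)] mult_commute_abs)
qed

text \<open>The rotation by the angle \<open>t\<close> in the (c, d)-plane, written as the identity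
  plus a correction so that the derivative at 0 and the fixed axes are immediate.\<close>

definition plane_rot :: "'n \<Rightarrow> 'n \<Rightarrow> real \<Rightarrow> real^'n \<Rightarrow> real^'n" where
  "plane_rot c d t x = x + ((cos t - 1) * x $ c - sin t * x $ d) *\<^sub>R axis c 1
     + (sin t * x $ c + (cos t - 1) * x $ d) *\<^sub>R axis d 1"

lemma linear_plane_rot: "linear (plane_rot c d t)"
  by (auto simp: plane_rot_def linear_iff algebra_simps)

lemma axis_inner_unit:
  "c \<noteq> d \<Longrightarrow> (axis c 1 :: real^'n) \<bullet> axis d 1 = 0" "(axis c 1 :: real^'n) \<bullet> axis c 1 = 1"
  by (simp_all add: inner_axis_axis)

lemma norm_plane_rot:
  assumes "c \<noteq> d"
  shows "norm (plane_rot c d t x) = norm x"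
proof -
  define \<alpha> where "\<alpha> = (cos t - 1) * x $ c - sin t * x $ d"
  define \<beta> where "\<beta> = sin t * x $ c + (cos t - 1) * x $ d"
  have "plane_rot c d t x \<bullet> plane_rot c d t x = x \<bullet> x + 2 * \<alpha> * x $ c + 2 * \<beta> * x $ d + \<alpha>\<^sup>2 + \<beta>\<^sup>2"
    unfolding plane_rot_def \<alpha>_def[symmetric] \<beta>_def[symmetric]
    by (simp add: inner_add_left inner_add_right inner_axis inner_commute[of "axis c 1"]
        inner_commute[of "axis d 1"] axis_inner_unit assms assms[symmetric] algebra_simps power2_eq_square)
      (simp add: axis_def assms assms[symmetric])
  also have "2 * \<alpha> * x $ c + 2 * \<beta> * x $ d + \<alpha>\<^sup>2 + \<beta>\<^sup>2 = ((sin t)\<^sup>2 + (cos t)\<^sup>2 - 1) * ((x $ c)\<^sup>2 + (x $ d)\<^sup>2)"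
  proof -
    have "2 * ((k - 1) * X - s * Y) * X + 2 * (s * X + (k - 1) * Y) * Y + ((k - 1) * X - s * Y)\<^sup>2
        + (s * X + (k - 1) * Y)\<^sup>2 = (s\<^sup>2 + k\<^sup>2 - 1) * (X\<^sup>2 + Y\<^sup>2)" for s k X Y :: real
      by (simp add: power2_eq_square algebra_simps)
    then show ?thesis unfolding \<alpha>_def \<beta>_def .
  qed
  then have "x \<bullet> x + 2 * \<alpha> * x $ c + 2 * \<beta> * x $ d + \<alpha>\<^sup>2 + \<beta>\<^sup>2 = x \<bullet> x" by simp
  finally show ?thesis by (simp add: norm_eq)
qed

lemma plane_rotation_plane_rot:
  assumes "c \<noteq> d"
  shows "plane_rot c d t \<circ> plane_rot c d t = plane_rot c d (2 * t)"
proof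
  fix x
  have 3: "plane_rot c d t x $ a = x $ a" if "a \<noteq> c" "a \<noteq> d" for a t x
    using that by (simp add: plane_rot_def axis_def)
  have 4: "plane_rot c d t x $ c = cos t * x $ c - sin t * x $ d" "plane_rot c d t x $ d = sin t * x $ c + cos t * x $ d" for t x
    using assms by (simp_all add: plane_rot_def axis_def algebra_simps)
  show "(plane_rot c d t \<circ> plane_rot c d t) x = plane_rot c d (2 * t) x"
  proof (rule vec_eq_iff[THEN iffD2], rule allI)
    fix a
    show "(plane_rot c d t \<circ> plane_rot c d t) x $ a = plane_rot c d (2 * t) x $ a"
    proof (cases "a = c \<or> a = d")
      case True
      then show ?thesis
        unfolding o_apply
        by (elim disjE; simp only: 4 cos_double sin_double) (simp_all add: algebra_simps power2_eq_square)
    qed (simp add: 3)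
  qed
qed

text \<open>The determinant need not be expanded: the rotation is the square of the one by half the
  angle, whose determinant is 1 or -1.\<close>

lemma rotation_plane_rot:
  assumes "c \<noteq> d"
  shows "rotation (plane_rot c d t)"
proof -
  have o: "orthogonal_transformation (plane_rot c d t)" for t
    by (simp add: orthogonal_transformation linear_plane_rot norm_plane_rot[OF assms])
  have "\<bar>det (matrix (plane_rot c d (t/2)))\<bar> = 1"
    by (rule orthogonal_transformation_det[OF o])
  then have "det (matrix (plane_rot c d (t/2))) * det (matrix (plane_rot c d (t/2))) = 1"
    by (metis abs_mult_self_eq mult_1)
  then have "det (matrix (plane_rot c d (t/2) \<circ> plane_rot c d (t/2))) = 1"
    by (simp add: matrix_compose linear_plane_rot det_mul)
  then have "det (matrix (plane_rot c d t)) = 1"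
    by (simp add: plane_rotation_plane_rot[OF assms])
  with o show ?thesis by (simp add: rotation_def)
qed

lemma plane_rot_fix: "a \<noteq> c \<Longrightarrow> a \<noteq> d \<Longrightarrow> plane_rot c d t (axis a 1) = axis a 1"
  by (simp add: plane_rot_def axis_def)

lemma plane_rot_0: "plane_rot c d 0 x = x"
  by (simp add: plane_rot_def)

lemma plane_rot_deriv:
  "((\<lambda>t. plane_rot c d t x) has_vector_derivative (x $ c *\<^sub>R axis d 1 - x $ d *\<^sub>R axis c 1)) (at 0)"
  unfolding plane_rot_def by (auto intro!: derivative_eq_intros)

text \<open>The reflection in the hyperplane orthogonal to e_b - u; it fixes the axis
  \<open>o'\<close> because that axis is orthogonal to both vectors. A reflection serves instead of
  a rotation fixing the axis, which need not exist in dimension 2.\<close>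

lemma reflection_exists:
  fixes u :: "real^'n"
  assumes "norm u = 1" "u $ o' = 0" "b \<noteq> o'"
  obtains T :: "real^'n \<Rightarrow> real^'n" where "orthogonal_transformation T" "\<And>x. T (T x) = x"
    "T (axis b 1) = u" "T (axis o' 1) = axis o' 1"
proof (cases "u = axis b 1")
  case True
  show ?thesis
    by (rule that[of "\<lambda>x. x"]) (auto simp: True orthogonal_transformation linear_self)
next
  case False
  define w where "w = axis b 1 - u"
  define T where "T x = x - (2 * (w \<bullet> x) / (w \<bullet> w)) *\<^sub>R w" for x
  have w0: "w \<bullet> w \<noteq> 0" using False by (simp add: w_def)
  have lin: "linear T"
    by (auto simp: T_def linear_iff inner_add_right algebra_simps add_divide_distrib)
  have nT: "norm (T x) = norm x" for x
  proof -
    define c where "c = 2 * (w \<bullet> x) / (w \<bullet> w)"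
    have c: "c * (w \<bullet> w) = 2 * (w \<bullet> x)" using w0 by (simp add: c_def)
    have "T x \<bullet> T x = x \<bullet> x - 2 * c * (w \<bullet> x) + c * (c * (w \<bullet> w))"
      unfolding T_def c_def[symmetric]
      by (simp add: inner_diff_left inner_diff_right inner_commute[of x w] algebra_simps)
    also have "\<dots> = x \<bullet> x" unfolding c by simp
    finally show ?thesis by (simp add: norm_eq)
  qed
  have TT: "T (T x) = x" for x
  proof -
    have "w \<bullet> T x = - (w \<bullet> x)" using w0 by (simp add: T_def inner_diff_right)
    then show ?thesis unfolding T_def[of "T x"] by (simp add: T_def)
  qed
  have uu: "u \<bullet> u = 1" using assms(1) by (simp add: norm_eq_1)
  have bb: "(axis b 1 :: real^'n) \<bullet> axis b 1 = 1" by (rule axis_inner_unit)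
  have "w \<bullet> w = 2 * (w \<bullet> axis b 1)"
  proof -
    have "A - P - (Q - R) = 2 * (A - P)" if "R = 1" "A = 1" "P = Q" for A P Q R :: real
      using that by simp
    then show ?thesis
      unfolding w_def inner_diff_left inner_diff_right using uu bb inner_commute by blast
  qed
  then have "T (axis b 1) = axis b 1 - w" using w0 by (simp add: T_def)
  then have "T (axis b 1) = u" by (simp add: w_def)
  moreover have "w \<bullet> axis o' 1 = 0"
    using assms by (simp add: w_def inner_diff_left inner_axis) (simp add: axis_def)
  then have "T (axis o' 1) = axis o' 1" by (simp add: T_def)
  ultimately show ?thesis
    by (intro that[of T]) (auto simp: orthogonal_transformation lin nT TT)
qed

text \<open>The determinant of \<open>T\<close> enters twice, so conjugation by a reflection
  preserves orientation.\<close>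

lemma rot_conj:
  fixes T S :: "real^'n \<Rightarrow> real^'n"
  assumes "orthogonal_transformation T" "\<And>x. T (T x) = x" "rotation S"
  shows "rotation (\<lambda>x. T (S (T x)))"
proof -
  have oS: "orthogonal_transformation S" using assms(3) by (simp add: rotation_def)
  have oST: "orthogonal_transformation (S \<circ> T)"
    by (rule orthogonal_transformation_compose[OF oS assms(1)])
  have o: "orthogonal_transformation (T \<circ> (S \<circ> T))"
    by (rule orthogonal_transformation_compose[OF assms(1) oST])
  have lin: "linear T" "linear S" "linear (S \<circ> T)"
    using assms(1) oS oST by (auto simp: orthogonal_transformation_linear)
  have "T \<circ> T = id" using assms(2) by auto
  then have "det (matrix T) * det (matrix T) = 1"
    using matrix_compose[OF lin(1) lin(1)] by (metis det_mul matrix_id)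
  moreover have "det (matrix (T \<circ> (S \<circ> T))) = det (matrix T) * (det (matrix S) * det (matrix T))"
    by (simp add: matrix_compose lin det_mul)
  ultimately have "det (matrix (T \<circ> (S \<circ> T))) = 1"
    using assms(3) by (simp add: rotation_def)
  with o show ?thesis by (simp add: rotation_def o_def)
qed

text \<open>The Laplacian does not depend on the orthonormal frame. The map \<open>L\<close> carries
  the frame into the space where \<open>f\<close> lives, for instance into one variable of a
  kernel.\<close>

lemma lap_orthogonal:
  fixes f :: "'a::real_normed_vector \<Rightarrow> real" and T :: "real^'n \<Rightarrow> real^'n"
  assumes f: "poly_fun f" and L: "linear L" and T: "orthogonal_transformation T"
  shows "(\<Sum>a\<in>UNIV. dird (L (T (axis a 1))) (dird (L (T (axis a 1))) f) x)
       = (\<Sum>a\<in>UNIV. dird (L (axis a 1)) (dird (L (axis a 1)) f) x)"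
proof -
  define M where "M c a = T (axis a 1) $ c" for c a
  let ?v = "\<lambda>c. L (axis c 1)"
  have LT: "L (T (axis a 1)) = (\<Sum>c\<in>UNIV. M c a *\<^sub>R ?v c)" for a
  proof -
    have "L (T (axis a 1)) = L (\<Sum>c\<in>UNIV. M c a *\<^sub>R axis c 1)"
      unfolding M_def by (subst axis_expansion) (rule refl)
    then show ?thesis by (simp add: linear_sum[OF L] linear_scale[OF L])
  qed
  have orth: "(\<Sum>a\<in>UNIV. M c a * M d a) = (if c = d then 1 else 0)" for c d
  proof -
    have "orthogonal_matrix (matrix T)"
      using T orthogonal_transformation_matrix by blast
    then have "(matrix T ** transpose (matrix T)) $ c $ d = mat 1 $ c $ d"
      by (simp add: orthogonal_matrix_def)
    then show ?thesis
      by (simp add: matrix_matrix_mult_def transpose_def matrix_def mat_def M_def)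
  qed
  have "dird (L (T (axis a 1))) (dird (L (T (axis a 1))) f) x
      = (\<Sum>c\<in>UNIV. \<Sum>d\<in>UNIV. M c a * (M d a * dird (?v c) (dird (?v d) f) x))" for a
  proof -
    have 1: "dird (L (T (axis a 1))) f = (\<lambda>x. \<Sum>d\<in>UNIV. M d a * dird (?v d) f x)"
      unfolding LT by (rule ext, rule dird_sum_dir[OF f])
    have p: "poly_fun (\<lambda>x. M d a * dird (?v d) f x)" for d
      by (intro poly_plus poly_times poly_of_const poly_dird f)
    show ?thesis
      unfolding 1 unfolding LT
      by (subst dird_sum_dir)
        (auto intro!: real_polynomial_function_sum p simp: dird_sum[OF p] dird_cmult[OF poly_dird[OF f]] sum_distrib_left)
  qed
  then have "(\<Sum>a\<in>UNIV. dird (L (T (axis a 1))) (dird (L (T (axis a 1))) f) x)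
      = (\<Sum>a\<in>UNIV. \<Sum>c\<in>UNIV. \<Sum>d\<in>UNIV. M c a * (M d a * dird (?v c) (dird (?v d) f) x))"
    by simp
  also have "\<dots> = (\<Sum>c\<in>UNIV. \<Sum>d\<in>UNIV. \<Sum>a\<in>UNIV. M c a * (M d a * dird (?v c) (dird (?v d) f) x))"
    by (subst sum.swap, rule sum.cong[OF refl], subst sum.swap, rule refl)
  also have "\<dots> = (\<Sum>c\<in>UNIV. \<Sum>d\<in>UNIV. (\<Sum>a\<in>UNIV. M c a * M d a) * dird (?v c) (dird (?v d) f) x)"
    by (simp add: sum_distrib_right mult.assoc)
  also have "\<dots> = (\<Sum>c\<in>UNIV. dird (?v c) (dird (?v c) f) x)"
    unfolding orth
  proof (rule sum.cong[OF refl])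
    fix c
    have "(\<Sum>d\<in>UNIV. (if c = d then 1 else 0) * dird (?v c) (dird (?v d) f) x)
        = (\<Sum>d\<in>UNIV. if c = d then dird (?v c) (dird (?v d) f) x else 0)"
      by (rule sum.cong) auto
    then show "(\<Sum>d\<in>UNIV. (if c = d then 1 else 0) * dird (?v c) (dird (?v d) f) x)
        = dird (?v c) (dird (?v c) f) x" by simp
  qed
  finally show ?thesis .
qed

section \<open>Invariant biharmonic kernels vanishing on the diagonal\<close>

abbreviation (input) "inl \<equiv> (\<lambda>v::real^'n. (v, 0::real^'n))"
abbreviation (input) "inr \<equiv> (\<lambda>v::real^'n. (0::real^'n, v))"
abbreviation (input) "swap2 \<equiv> (\<lambda>x::(real^'n) \<times> (real^'n). (snd x, fst x))"
abbreviation (input) "proj1 \<equiv> (\<lambda>x::(real^'n) \<times> (real^'n). (fst x, 0::real^'n))"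
abbreviation (input) "proj2 \<equiv> (\<lambda>x::(real^'n) \<times> (real^'n). (0::real^'n, snd x))"
abbreviation (input) "both T \<equiv> (\<lambda>x::(real^'n) \<times> (real^'n). (T (fst x) :: real^'n, T (snd x) :: real^'n))"
abbreviation (input) "lunit \<equiv> (\<lambda>a. (axis a 1, 0) :: (real^'n) \<times> (real^'n))"
abbreviation (input) "runit \<equiv> (\<lambda>a. (0, axis a 1) :: (real^'n) \<times> (real^'n))"
abbreviation (input) "lcoord \<equiv> (\<lambda>a (x::(real^'n) \<times> (real^'n)). fst x $ a)"
abbreviation (input) "rcoord \<equiv> (\<lambda>a (x::(real^'n) \<times> (real^'n)). snd x $ a)"

lemma linear_pair_maps:
  "linear inl" "linear inr" "linear swap2" "linear proj1" "linear proj2"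
  "linear T \<Longrightarrow> linear (both T)"
  by (auto simp: linear_iff)

lemma bounded_linear_both: "linear T \<Longrightarrow> bounded_linear (both T)"
  using linear_conv_bounded_linear linear_pair_maps(6) by blast

lemma bounded_linear_lcoord: "bounded_linear (lcoord a)"
  by (rule bounded_linear_compose[OF bounded_linear_vec_nth bounded_linear_fst])

lemma bounded_linear_rcoord: "bounded_linear (rcoord a)"
  by (rule bounded_linear_compose[OF bounded_linear_vec_nth bounded_linear_snd])

text \<open>Invariance under the stabiliser of the pole e_p, acting simultaneously on both
  variables.\<close>

definition biinv :: "'n \<Rightarrow> ((real^'n) \<times> (real^'n) \<Rightarrow> real) \<Rightarrow> bool" where
  "biinv p G \<longleftrightarrow> (\<forall>T. rotation T \<longrightarrow> T (axis p 1) = axis p 1 \<longrightarrow> (\<forall>x. G (both T x) = G x))"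

lemma angular_same: "angular \<xi> v c c f = (\<lambda>_. 0)"
  by (simp add: angular_def)

lemma dird_pair_split:
  assumes "poly_fun G"
  shows "dird (v, w) G = (\<lambda>x. dird (v, 0) G x + dird (0, w) G x)"
  using dird_add_dir[OF assms, of "(v, 0)" "(0, w)"] by simp

lemma dird_lin2:
  assumes "poly_fun G"
  shows "dird (r *\<^sub>R a - s *\<^sub>R b) G x = r * dird a G x - s * dird b G x"
proof -
  have "r *\<^sub>R a - s *\<^sub>R b = r *\<^sub>R a + (- s) *\<^sub>R b" by simp
  then show ?thesis
    by (simp only: dird_add_dir[OF assms] dird_scale_dir[OF assms])
qed

text \<open>Differentiating invariance under \<open>plane_rot\<close> at angle 0 shows that the
  generators in the two variables add up to 0; the plane must avoid e_p for the rotation to lie in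
  the stabiliser.\<close>

lemma biinv_angular:
  assumes G: "poly_fun G" and inv: "biinv p G" and cd: "c \<noteq> p" "d \<noteq> p"
  shows "angular lcoord lunit c d G = (\<lambda>x. - angular rcoord runit c d G x)"
proof (cases "c = d")
  case True
  then show ?thesis by (simp add: angular_same)
next
  case False
  show ?thesis
  proof
    fix x
    let ?g = "\<lambda>t. both (plane_rot c d t) x"
    let ?v = "fst x $ c *\<^sub>R axis d 1 - fst x $ d *\<^sub>R axis c 1"
    let ?w = "snd x $ c *\<^sub>R axis d 1 - snd x $ d *\<^sub>R axis c 1"
    have "(?g has_vector_derivative (?v, ?w)) (at 0)"
      by (rule has_vector_derivative_Pair[OF plane_rot_deriv plane_rot_deriv])
    then have "((\<lambda>t. G (?g t)) has_real_derivative dird (?v, ?w) G (?g 0)) (at 0)"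
      by (rule poly_chain[OF G])
    moreover have "G (?g t) = G x" for t
      using inv rotation_plane_rot[OF False] plane_rot_fix[OF cd(1)[symmetric] cd(2)[symmetric]]
      unfolding biinv_def by blast
    ultimately have "((\<lambda>t. G x) has_real_derivative dird (?v, ?w) G (?g 0)) (at 0)" by simp
    then have "dird (?v, ?w) G x = 0"
      using DERIV_unique[OF _ DERIV_const] by (force simp: plane_rot_0)
    then have "dird (?v, 0) G x + dird (0, ?w) G x = 0"
      unfolding dird_pair_split[OF G, of ?v ?w] .
    moreover have "(?v, 0) = fst x $ c *\<^sub>R lunit d - fst x $ d *\<^sub>R lunit c"
      "(0, ?w) = snd x $ c *\<^sub>R runit d - snd x $ d *\<^sub>R runit c" by simp_all
    ultimately show "angular lcoord lunit c d G x = - angular rcoord runit c d G x"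
      unfolding angular_def by (simp only: dird_lin2[OF G])
  qed
qed

lemma poly_slice:
  assumes "poly_fun G"
  shows "poly_fun (\<lambda>z. G (y, z))"
proof -
  have "polynomial_function (\<lambda>z. (y, 0) + (0, z))"
    by (intro polynomial_function_add polynomial_function_const polynomial_function_bounded_linear
        bounded_linear_Pair bounded_linear_zero bounded_linear_ident)
  then have "polynomial_function (\<lambda>z. (y, z))" by simp
  from real_polynomial_function_compose[OF this assms] show ?thesis by (simp add: o_def)
qed

lemma dird_slice: "dird v (\<lambda>z. G (y, z)) z = dird (0, v) G (y, z)"
  by (simp add: dird_def)

lemma dird_sym:
  assumes "\<And>x. G (swap2 x) = G x"
  shows "dird (v, w) G x = dird (w, v) G (swap2 x)"
proof -
  have "dird (v, w) (\<lambda>x. G (swap2 x)) = (\<lambda>x. dird (swap2 (v, w)) G (swap2 x))"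
    by (rule dird_compose_linear[OF linear_pair_maps(3)])
  then show ?thesis by (simp add: assms)
qed

text \<open>With its first variable frozen at e_b the kernel becomes a function of one vector that
  satisfies the hypotheses of \<open>zonal_vanish\<close>.\<close>

lemma diagonal_slice:
  fixes g :: "(real^'n) \<times> (real^'n) \<Rightarrow> real"
  assumes g: "poly_fun g" and sym: "\<And>x. g (swap2 x) = g x"
    and h: "homog proj1 k g"
    and lap: "\<And>x. laplace lunit g x = 0"
    and diag: "\<And>y. g (y, y) = 0" and shift: "dird (lunit p) g = (\<lambda>_. 0)"
    and inv: "biinv p g"
  shows "g (axis b 1, z) = 0"
proof -
  define f where "f z = g (axis b 1, z)" for z
  have f: "poly_fun f"
    unfolding f_def[abs_def] by (rule poly_slice[OF g])
  have sr: "dird (0, v) g x = dird (v, 0) g (swap2 x)" for v x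
    by (rule dird_sym) (rule sym)
  have df: "dird v f z = dird (0, v) g (axis b 1, z)" for v z
    unfolding f_def[abs_def] by (rule dird_slice)
  have df': "dird v f = (\<lambda>z. dird (0, v) g (axis b 1, z))" for v
    by (rule ext, rule df)
  have hf: "homog (\<lambda>x. x) k f"
    unfolding homog_id_iff
  proof (intro allI)
    fix t x
    have "f (t *\<^sub>R x) = g (t *\<^sub>R x, axis b 1)"
      using sym[of "(axis b 1, t *\<^sub>R x)"] by (simp add: f_def)
    also have "\<dots> = t ^ k * g (x, axis b 1)"
      using h[unfolded homog_def, rule_format, of "(x, axis b 1)" t] by (simp add: algebra_simps)
    also have "g (x, axis b 1) = f x"
      using sym[of "(axis b 1, x)"] by (simp add: f_def)
    finally show "f (t *\<^sub>R x) = t ^ k * f x" .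
  qed
  have lf: "laplace unitv f z = 0" for z
  proof -
    have "dird (axis a 1) (dird (axis a 1) f) z = dird (lunit a) (dird (lunit a) g) (z, axis b 1)" for a
    proof -
      have "dird (axis a 1) (dird (axis a 1) f) z = dird (runit a) (dird (runit a) g) (axis b 1, z)"
        unfolding df' by (rule dird_slice)
      also have "dird (runit a) g = (\<lambda>x. dird (lunit a) g (swap2 x))"
        by (rule ext, rule sr)
      also have "dird (runit a) (\<lambda>x. dird (lunit a) g (swap2 x)) (axis b 1, z)
          = dird (lunit a) (dird (lunit a) g) (z, axis b 1)"
        using dird_compose_linear[OF linear_pair_maps(3), of "runit a" "dird (lunit a) g"] by simp
      finally show ?thesis .
    qed
    then show ?thesis using lap[of "(z, axis b 1)"] by simp
  qed
  \<comment> \<open>Along the diagonal the derivatives in the two variables cancel, and by symmetry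
    they are equal at a diagonal point; hence both are 0.\<close>
  have gr: "dird (axis c 1) f (axis b 1) = 0" for c
  proof -
    have "dird (axis c 1) (\<lambda>y. g (y, y)) = (\<lambda>y. dird (axis c 1, axis c 1) g (y, y))"
      by (rule dird_compose_linear) (auto simp: linear_iff)
    then have "dird (axis c 1, axis c 1) g (axis b 1, axis b 1) = 0"
      by (simp add: diag) metis
    then have "dird (lunit c) g (axis b 1, axis b 1) + dird (runit c) g (axis b 1, axis b 1) = 0"
      by (simp add: dird_pair_split[OF g, of "axis c 1" "axis c 1"])
    then show ?thesis
      using sr[of "axis c 1" "(axis b 1, axis b 1)"] by (simp add: df)
  qed
  have "f = (\<lambda>_. 0)"
  proof (rule zonal_vanish[OF f hf, where b = b and A = "UNIV - {p, b}"])
    show "f (axis b 1) = 0" by (simp add: f_def diag)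
    show "dird (axis c 1) f = (\<lambda>_. 0)" if "c \<notin> insert b (UNIV - {p, b})" for c
    proof -
      from that have "c = p" by auto
      then show ?thesis unfolding df' sr using shift by simp
    qed
    show "angular coord unitv c d f = (\<lambda>_. 0)" if "c \<in> UNIV - {p, b}" "d \<in> UNIV - {p, b}" for c d
    proof
      fix z
      have "angular coord unitv c d f z = angular rcoord runit c d g (axis b 1, z)"
        by (simp add: angular_def df)
      also have "\<dots> = - angular lcoord lunit c d g (axis b 1, z)"
        using fun_cong[OF biinv_angular[OF g inv, of c d], of "(axis b 1, z)"] that by simp
      also have "\<dots> = 0" using that by (simp add: angular_def axis_def)
      finally show "angular coord unitv c d f z = 0" .
    qed
  qed (use lf gr in auto)
  then have "f z = 0" by simp
  then show ?thesis by (simp add: f_def)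
qed

text \<open>Independence of y_p and homogeneity reduce the first variable to unit vectors orthogonal
  to e_p; a reflection fixing e_p takes e_b to any of these and preserves all hypotheses, so
  \<open>diagonal_slice\<close> applies.\<close>

lemma diagonal_vanish:
  fixes g :: "(real^'n) \<times> (real^'n) \<Rightarrow> real"
  assumes g: "poly_fun g" and sym: "\<And>x. g (swap2 x) = g x"
    and h: "homog proj1 k g"
    and lap: "\<And>x. laplace lunit g x = 0"
    and diag: "\<And>y. g (y, y) = 0" and shift: "dird (lunit p) g = (\<lambda>_. 0)"
    and inv: "biinv p g" and bp: "b \<noteq> p"
  shows "g = (\<lambda>_. 0)"
proof
  fix x :: "(real^'n) \<times> (real^'n)"
  obtain y z where x: "x = (y, z)" by (cases x)
  define u where "u = erase_coord p y"
  have "g (y, z) = g ((u, z) + (y $ p) *\<^sub>R lunit p)"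
    using erase_coord_split[of y p] by (simp add: u_def)
  also have "\<dots> = g (u, z)"
    by (rule dird_along_zero_const[OF g]) (simp add: shift)
  also have "g (u, z) = 0"
  proof (cases "u = 0")
    case True
    have "g (0, z) = 0 ^ k * g (axis b 1, z)"
      using h[unfolded homog_def, rule_format, of "(axis b 1, z)" 0] by simp
    then show ?thesis
      using True diagonal_slice[where g = g, OF g sym h lap diag shift inv] by simp
  next
    case False
    define w where "w = u /\<^sub>R norm u"
    have w: "norm w = 1" "w $ p = 0" using False by (simp_all add: w_def u_def erase_coord_nth)
    obtain T :: "real^'n \<Rightarrow> real^'n" where T: "orthogonal_transformation T" "\<And>x. T (T x) = x"
      "T (axis b 1) = w" "T (axis p 1) = axis p 1"
      using reflection_exists[OF w bp] by blast
    have lT: "linear T" using T(1) by (rule orthogonal_transformation_linear)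
    define g' where "g' x = g (both T x)" for x
    have 1: "dird v g' = (\<lambda>x. dird (both T v) g (both T x))" for v
      unfolding g'_def[abs_def] by (rule dird_compose_linear[OF linear_pair_maps(6)[OF lT]])
    have T0: "T 0 = 0" by (rule linear_0[OF lT])
    have "g' (axis b 1, T z) = 0"
    proof (rule diagonal_slice)
      show "poly_fun g'"
        unfolding g'_def[abs_def] by (rule poly_compose_linear[OF g bounded_linear_both[OF lT]])
      show "g' (swap2 x) = g' x" for x
        using sym[of "both T x"] by (simp add: g'_def)
      show "homog proj1 k g'"
        unfolding g'_def[abs_def]
        by (rule homog_compose_linear[OF h linear_pair_maps(6)[OF lT]]) (simp add: T0)
      show "laplace lunit g' x = 0" for x
      proof -
        have 2: "dird v (dird v g') x = dird (both T v) (dird (both T v) g) (both T x)" for v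
          unfolding 1 by (rule fun_cong[OF dird_compose_linear[OF linear_pair_maps(6)[OF lT]]])
        have "laplace lunit g' x
           = (\<Sum>a\<in>UNIV. dird (inl (T (axis a 1))) (dird (inl (T (axis a 1))) g) (both T x))"
          unfolding 2 by (simp add: T0)
        also have "\<dots> = laplace lunit g (both T x)"
          by (rule lap_orthogonal[OF g linear_pair_maps(1) T(1)])
        also have "\<dots> = 0" by (rule lap)
        finally show ?thesis .
      qed
      show "g' (y, y) = 0" for y by (simp add: g'_def diag)
      show "dird (lunit p) g' = (\<lambda>_. 0)"
        unfolding 1 by (simp add: T(4) T0 shift)
      show "biinv p g'"
        unfolding biinv_def
      proof (intro allI impI)
        fix S :: "real^'n \<Rightarrow> real^'n" and x
        assume S: "rotation S" "S (axis p 1) = axis p 1"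
        \<comment> \<open>\<open>T\<close> may reverse orientation, but the conjugate of
          \<open>S\<close> by \<open>T\<close> is again a rotation fixing the pole.\<close>
        have r: "rotation (\<lambda>x. T (S (T x)))" by (rule rot_conj[OF T(1,2) S(1)])
        have f: "T (S (T (axis p 1))) = axis p 1" by (simp add: T(4) S(2))
        have "g (both (\<lambda>x. T (S (T x))) (both T x)) = g (both T x)"
          using inv[unfolded biinv_def, rule_format, OF r f] .
        then show "g' (both S x) = g' x" by (simp add: g'_def T(2))
      qed
    qed
    then have "g (w, z) = 0" by (simp add: g'_def T)
    moreover have "g (norm u *\<^sub>R w, z) = norm u ^ k * g (w, z)"
      using h[unfolded homog_def, rule_format, of "(w, z)" "norm u"] by (simp add: algebra_simps)
    ultimately show ?thesis using False by (simp add: w_def)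
  qed
  finally show "g x = 0" by (simp add: x)
qed

text \<open>Derivatives of y -> \<open>G (y, y)\<close> are derivatives of \<open>G\<close> along a
  sum of two directions, one in each variable; this splits them.\<close>

lemma dird_binomial:
  assumes G: "poly_fun G"
  shows "(dird (v + w) ^^ n) G x = (\<Sum>j\<le>n. real (n choose j) * (dird v ^^ j) ((dird w ^^ (n - j)) G) x)"
proof (induct n arbitrary: x)
  case (Suc n)
  let ?F = "\<lambda>j k. (dird v ^^ j) ((dird w ^^ k) G)"
  have p: "poly_fun (?F j k)" for j k
    by (intro poly_dird_funpow G)
  have pc: "poly_fun (\<lambda>x. real (n choose j) * ?F j (n - j) x)" for j
    by (intro poly_times poly_of_const p)
  have v: "dird v (?F j k) = ?F (Suc j) k" for j k by simp
  have w: "dird w (?F j k) = ?F j (Suc k)" for j k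
    by (simp add: dird_funpow_commute[OF poly_dird_funpow[OF G], of w])
  have fn: "(dird (v + w) ^^ n) G = (\<lambda>x. \<Sum>j\<le>n. real (n choose j) * ?F j (n - j) x)"
    using Suc by (rule ext)
  have "(dird (v + w) ^^ Suc n) G x = dird (v + w) (\<lambda>x. \<Sum>j\<le>n. real (n choose j) * ?F j (n - j) x) x"
    by (simp only: funpow.simps o_apply fn)
  also have "\<dots> = (\<Sum>j\<le>n. real (n choose j) * (?F (Suc j) (n - j) x + ?F j (Suc (n - j)) x))"
    by (simp only: dird_sum[OF pc] dird_cmult[OF p] dird_add_dir[OF p] v w)
  also have "\<dots> = (\<Sum>j\<le>n. real (n choose j) * ?F (Suc j) (n - j) x)
       + (\<Sum>j\<le>n. real (n choose j) * ?F j (Suc n - j) x)"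
    by (simp add: distrib_left sum.distrib Suc_diff_le del: funpow.simps)
  also have "(\<Sum>j\<le>n. real (n choose j) * ?F j (Suc n - j) x)
       = (\<Sum>j\<le>Suc n. real (n choose j) * ?F j (Suc n - j) x)"
    by (simp add: binomial_eq_0 del: funpow.simps)
  also have "\<dots> = ?F 0 (Suc n) x + (\<Sum>j\<le>n. real (n choose Suc j) * ?F (Suc j) (n - j) x)"
    by (subst sum.atMost_Suc_shift) (simp del: funpow.simps)
  also have "(\<Sum>j\<le>n. real (n choose j) * ?F (Suc j) (n - j) x) + \<dots>
       = ?F 0 (Suc n) x + (\<Sum>j\<le>n. real (Suc n choose Suc j) * ?F (Suc j) (Suc n - Suc j) x)"
    by (simp add: sum.distrib distrib_right del: funpow.simps)
  also have "\<dots> = (\<Sum>j\<le>Suc n. real (Suc n choose j) * ?F j (Suc n - j) x)"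
    by (subst sum.atMost_Suc_shift) (simp del: funpow.simps)
  finally show ?case .
qed simp

lemma angular_commute:
  assumes f: "poly_fun f"
  shows "angular lcoord lunit c d (angular rcoord runit c d f) = angular rcoord runit c d (angular lcoord lunit c d f)"
proof -
  have pl: "poly_fun (\<lambda>x. lcoord a x * g x)" if "poly_fun g" for a and g :: "(real^'n) \<times> (real^'n) \<Rightarrow> real"
    by (intro poly_times poly_of_linear bounded_linear_lcoord that)
  have pr: "poly_fun (\<lambda>x. rcoord a x * g x)" if "poly_fun g" for a and g :: "(real^'n) \<times> (real^'n) \<Rightarrow> real"
    by (intro poly_times poly_of_linear bounded_linear_rcoord that)
  have dl: "dird (runit b) (\<lambda>x. lcoord a x * g x) = (\<lambda>x. lcoord a x * dird (runit b) g x)"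
    if "poly_fun g" for a b and g :: "(real^'n) \<times> (real^'n) \<Rightarrow> real"
    using dird_coord_mult[OF bounded_linear_lcoord _ that, of "runit b" a 1] by simp
  have dr: "dird (lunit b) (\<lambda>x. rcoord a x * g x) = (\<lambda>x. rcoord a x * dird (lunit b) g x)"
    if "poly_fun g" for a b and g :: "(real^'n) \<times> (real^'n) \<Rightarrow> real"
    using dird_coord_mult[OF bounded_linear_rcoord _ that, of "lunit b" a 1] by simp
  have 1: "dird (lunit b) (angular rcoord runit c d f) =
      (\<lambda>x. rcoord c x * dird (lunit b) (dird (runit d) f) x - rcoord d x * dird (lunit b) (dird (runit c) f) x)" for b
    unfolding angular_def dird_diff[OF pr[OF poly_dird[OF f]] pr[OF poly_dird[OF f]]] dr[OF poly_dird[OF f]] ..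
  have 2: "dird (runit b) (angular lcoord lunit c d f) =
      (\<lambda>x. lcoord c x * dird (runit b) (dird (lunit d) f) x - lcoord d x * dird (runit b) (dird (lunit c) f) x)" for b
    unfolding angular_def dird_diff[OF pl[OF poly_dird[OF f]] pl[OF poly_dird[OF f]]] dl[OF poly_dird[OF f]] ..
  have 3: "dird (runit b) (dird (lunit a) f) = dird (lunit a) (dird (runit b) f)" for a b
    by (rule dird_commute[OF f])
  show ?thesis
    unfolding angular_def[of lcoord lunit c d "angular rcoord runit c d f"]
      angular_def[of rcoord runit c d "angular lcoord lunit c d f"] 1 2 3
    by (simp add: algebra_simps)
qed

lemma angular_uminus:
  assumes "poly_fun f"
  shows "angular \<xi> v a b (\<lambda>x. - f x) = (\<lambda>x. - angular \<xi> v a b f x)"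
  by (simp add: angular_def dird_uminus[OF assms])

text \<open>The generators in the two variables are opposite on \<open>S\<close> and commute with
  each other, so their squares agree on \<open>S\<close>, hence also the Casimir eigenvalues, which
  determine the degrees.\<close>

lemma slot_degrees_agree:
  fixes S :: "(real^'n) \<times> (real^'n) \<Rightarrow> real"
  assumes S: "poly_fun S" and inv: "biinv p S"
    and h1: "homog proj1 i S" and h2: "homog proj2 l S"
    and lap1: "\<And>x. laplace lunit S x = 0"
    and lap2: "\<And>x. laplace runit S x = 0"
    and s1: "dird (lunit p) S = (\<lambda>_. 0)" and s2: "dird (runit p) S = (\<lambda>_. 0)"
    and nz: "S \<noteq> (\<lambda>_. 0)" and N: "CARD('n) \<ge> 2"
  shows "i = l \<or> i + l = 1"
proof -
  define A where "A = UNIV - {p}"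
  have sumA: "(\<Sum>a\<in>UNIV. g a) = (\<Sum>a\<in>A. g a)" if "g p = 0" for g :: "'n \<Rightarrow> real"
    unfolding A_def using that by (intro sum.mono_neutral_right) auto
  have e1: "(\<Sum>a\<in>A. lcoord a x * dird (lunit a) S x) = i * S x" for x
  proof -
    have "proj1 x = (\<Sum>a\<in>UNIV. lcoord a x *\<^sub>R lunit a)"
      using axis_expansion[of "fst x"] by (simp add: prod_eq_iff fst_sum snd_sum)
    then have "(\<Sum>a\<in>UNIV. lcoord a x * dird (lunit a) S x) = i * S x"
      using homog_euler[OF S h1, of x] dird_sum_dir[OF S, of "\<lambda>a. lcoord a x" lunit UNIV x] by simp
    then show ?thesis using sumA[of "\<lambda>a. lcoord a x * dird (lunit a) S x"] s1 by simp
  qed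
  have e2: "(\<Sum>a\<in>A. rcoord a x * dird (runit a) S x) = l * S x" for x
  proof -
    have "proj2 x = (\<Sum>a\<in>UNIV. rcoord a x *\<^sub>R runit a)"
      using axis_expansion[of "snd x"] by (simp add: prod_eq_iff fst_sum snd_sum)
    then have "(\<Sum>a\<in>UNIV. rcoord a x * dird (runit a) S x) = l * S x"
      using homog_euler[OF S h2, of x] dird_sum_dir[OF S, of "\<lambda>a. rcoord a x" runit UNIV x] by simp
    then show ?thesis using sumA[of "\<lambda>a. rcoord a x * dird (runit a) S x"] s2 by simp
  qed
  have l1: "(\<Sum>a\<in>A. dird (lunit a) (dird (lunit a) S) x) = 0" for x
    using lap1[of x] sumA[of "\<lambda>a. dird (lunit a) (dird (lunit a) S) x"] s1 by simp
  have l2: "(\<Sum>a\<in>A. dird (runit a) (dird (runit a) S) x) = 0" for x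
    using lap2[of x] sumA[of "\<lambda>a. dird (runit a) (dird (runit a) S) x"] s2 by simp
  have C1: "(\<Sum>a\<in>A. \<Sum>b\<in>A. angular lcoord lunit a b (angular lcoord lunit a b S) x)
      = - 2 * real i * (real i + card A - 2) * S x" for x
    by (rule casimir[OF finite S bounded_linear_lcoord _ l1 e1]) (simp add: axis_def)
  have C2: "(\<Sum>a\<in>A. \<Sum>b\<in>A. angular rcoord runit a b (angular rcoord runit a b S) x)
      = - 2 * real l * (real l + card A - 2) * S x" for x
    by (rule casimir[OF finite S bounded_linear_rcoord _ l2 e2]) (simp add: axis_def)
  have eq: "angular lcoord lunit a b (angular lcoord lunit a b S) = angular rcoord runit a b (angular rcoord runit a b S)"
    if "a \<in> A" "b \<in> A" for a b
  proof -
    have ab: "a \<noteq> p" "b \<noteq> p" using that by (auto simp: A_def)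
    have R: "angular lcoord lunit a b S = (\<lambda>x. - angular rcoord runit a b S x)"
      by (rule biinv_angular[OF S inv ab])
    have pR: "poly_fun (angular rcoord runit a b S)"
      by (intro poly_angular S bounded_linear_rcoord)
    have "angular lcoord lunit a b (angular lcoord lunit a b S) = (\<lambda>x. - angular lcoord lunit a b (angular rcoord runit a b S) x)"
      unfolding R by (rule angular_uminus[OF pR])
    also have "\<dots> = (\<lambda>x. - angular rcoord runit a b (angular lcoord lunit a b S) x)"
      by (simp only: angular_commute[OF S])
    also have "\<dots> = angular rcoord runit a b (angular rcoord runit a b S)"
      unfolding R angular_uminus[OF pR] by simp
    finally show ?thesis .
  qed
  obtain x where x: "S x \<noteq> 0" using nz unfolding fun_eq_iff by blast
  have "- 2 * real i * (real i + card A - 2) * S x = - 2 * real l * (real l + card A - 2) * S x"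
    unfolding C1[symmetric] C2[symmetric] by (intro sum.cong refl) (simp add: eq)
  then have "real i * (real i + card A - 2) = real l * (real l + card A - 2)" using x by simp
  \<comment> \<open>Two degrees with the same eigenvalue coincide unless i + l +
    \<open>card A\<close> = 2; the exception i + l = 1 thus belongs to \<open>card A\<close> = 1,
    the case of the circle.\<close>
  then have "(real i - real l) * (real i + real l + card A - 2) = 0"
    by (simp add: algebra_simps)
  then have "i = l \<or> real i + real l + card A = 2" by auto
  moreover have "card A = CARD('n) - 1" unfolding A_def by (simp add: card_Diff_singleton)
  ultimately have "i = l \<or> i + l + (CARD('n) - 1) = 2"
    by (metis of_nat_add of_nat_eq_iff of_nat_numeral)
  then show ?thesis using N by auto
qed

text \<open>Let \<open>S j k\<close> be \<open>j! k!\<close> times the coefficient of \<open>y\<^sub>p\<^sup>j z\<^sub>p\<^sup>k\<close> in \<open>G(y, z)\<close>. Those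
  with \<open>j + k\<close> maximal are harmonic in \<open>y\<close> and in \<open>z\<close>. By
  invariance the Casimir operators in \<open>y\<close> and \<open>z\<close> agree on them, which forces \<open>j = k\<close> up to the low-degree
  exception of \<open>slot_degrees_agree\<close>. Hence on the diagonal there is no cancellation, and \<open>S j j\<close> vanishes there.\<close>

theorem invariant_kernel_vanish:
  fixes G :: "(real^'n) \<times> (real^'n) \<Rightarrow> real"
  assumes N: "CARD('n) \<ge> 2"
    and G: "poly_fun G" and sym: "\<And>x. G (swap2 x) = G x"
    and h: "homog proj1 m G"
    and lap: "\<And>x. laplace lunit G x = 0"
    and diag: "\<And>y. G (y, y) = 0" and inv: "biinv p G"
  shows "G = (\<lambda>_. 0)"
proof (rule ccontr)
  assume G0: "G \<noteq> (\<lambda>_. 0)"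
  obtain b where bp: "b \<noteq> p"
  proof -
    have "\<exists>b. b \<noteq> p"
    proof (rule ccontr)
      assume "\<not> ?thesis"
      then have "UNIV = {p}" by auto
      then have "CARD('n) = 1" by (metis card_1_singleton_iff One_nat_def)
      with N show False by simp
    qed
    then show ?thesis using that by blast
  qed
  define D1 where "D1 = dird (lunit p)"
  define D2 where "D2 = dird (runit p)"
  define K where "K = (both (erase_coord p) :: (real^'n) \<times> (real^'n) \<Rightarrow> _)"
  define P where "P j k = (D1 ^^ j) ((D2 ^^ k) G)" for j k
  define S where "S j k x = P j k (K x)" for j k x
  have lK: "linear K" unfolding K_def by (rule linear_pair_maps(6)[OF linear_erase_coord])
  have pP: "poly_fun (P j k)" for j k
    unfolding P_def D1_def D2_def by (intro poly_dird_funpow G)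
  have pS: "poly_fun (S j k)" for j k
    unfolding S_def[abs_def] K_def by (rule poly_compose_linear[OF pP bounded_linear_both[OF linear_erase_coord]])
  have pj: "linear proj1" "linear proj2" by (rule linear_pair_maps)+
  have h2: "homog proj2 m G"
    unfolding homog_def
  proof (intro allI)
    fix t :: real and x :: "(real^'n) \<times> (real^'n)"
    have "swap2 (x + (t - 1) *\<^sub>R proj2 x) = swap2 x + (t - 1) *\<^sub>R proj1 (swap2 x)" by simp
    then show "G (x + (t - 1) *\<^sub>R proj2 x) = t ^ m * G x"
      using sym[of "x + (t - 1) *\<^sub>R proj2 x"] sym[of x] h[unfolded homog_def, rule_format, of "swap2 x" t] by metis
  qed
  have Psym: "P j k (swap2 x) = P k j x" for j k x
  proof -
    have A: "(D2 ^^ j) (\<lambda>x. f (swap2 x)) = (\<lambda>x. (D1 ^^ j) f (swap2 x))" for f j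
      unfolding D1_def D2_def by (rule dird_funpow_compose_linear[OF linear_pair_maps(3)]) simp
    have B: "(D1 ^^ j) (\<lambda>x. f (swap2 x)) = (\<lambda>x. (D2 ^^ j) f (swap2 x))" for f j
      unfolding D1_def D2_def by (rule dird_funpow_compose_linear[OF linear_pair_maps(3)]) simp
    have "P k j = (D1 ^^ k) ((D2 ^^ j) (\<lambda>x. G (swap2 x)))"
      unfolding P_def by (simp add: sym)
    also have "\<dots> = (\<lambda>x. (D2 ^^ k) ((D1 ^^ j) G) (swap2 x))"
      unfolding A B ..
    also have "(D2 ^^ k) ((D1 ^^ j) G) = P j k"
      unfolding P_def D1_def D2_def by (rule dird_funpow_commute2[OF G])
    finally show ?thesis by simp
  qed
  have Ssym: "S j k (swap2 x) = S k j x" for j k x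
  proof -
    have "K (swap2 x) = swap2 (K x)" by (simp add: K_def)
    then show ?thesis unfolding S_def by (simp only: Psym)
  qed
  have hD2: "homog proj1 m ((D2 ^^ k) G)" for k
    unfolding D2_def by (rule homog_dird_funpow_other[OF G h pj(1)]) (simp add: zero_prod_def)
  have pD2: "poly_fun ((D2 ^^ k) G)" for k
    unfolding D2_def by (rule poly_dird_funpow[OF G])
  have D1nil: "(D1 ^^ j) ((D2 ^^ k) G) = (\<lambda>_. 0)" if "m < j" for j k
    unfolding D1_def by (rule homog_dird_nilpotent[OF pD2 hD2 pj(1) _ that]) simp
  have D2nil: "(D2 ^^ k) G = (\<lambda>_. 0)" if "m < k" for k
    unfolding D2_def by (rule homog_dird_nilpotent[OF G h2 pj(2) _ that]) simp
  have Sle: "j \<le> m \<and> k \<le> m" if "S j k \<noteq> (\<lambda>_. 0)" for j k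
  proof (rule ccontr)
    assume "\<not> ?thesis"
    then have "m < j \<or> m < k" by auto
    then have "P j k = (\<lambda>_. 0)"
      unfolding P_def using D1nil D2nil by (auto simp: D1_def dird_funpow_zero)
    then have "S j k x = 0" for x by (simp add: S_def)
    with that show False by (simp add: fun_eq_iff)
  qed
  have hS1: "homog proj1 (m - j) (S j k)" if "j \<le> m" for j k
    unfolding S_def[abs_def]
  proof (rule homog_compose_linear[OF _ lK])
    show "homog proj1 (m - j) (P j k)"
      unfolding P_def D1_def by (rule homog_dird_funpow[OF pD2 hD2 pj(1) _ that]) simp
    show "K (proj1 x) = proj1 (K x)" for x by (simp add: K_def linear_0[OF linear_erase_coord])
  qed
  have hS2: "homog proj2 (m - k) (S j k)" if "k \<le> m" for j k
    unfolding homog_def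
  proof (intro allI)
    fix t :: real and x :: "(real^'n) \<times> (real^'n)"
    have "swap2 (x + (t - 1) *\<^sub>R proj2 x) = swap2 x + (t - 1) *\<^sub>R proj1 (swap2 x)" by simp
    then have "S j k (x + (t - 1) *\<^sub>R proj2 x) = S k j (swap2 x + (t - 1) *\<^sub>R proj1 (swap2 x))"
      using Ssym[of k j "x + (t - 1) *\<^sub>R proj2 x"] by simp
    also have "\<dots> = t ^ (m - k) * S k j (swap2 x)"
      using hS1[OF that, of j] unfolding homog_def by blast
    finally show "S j k (x + (t - 1) *\<^sub>R proj2 x) = t ^ (m - k) * S j k x"
      by (simp only: Ssym)
  qed
  have dS: "dird (lunit a) (S j k) = (\<lambda>x. if a = p then 0 else dird (lunit a) (P j k) (K x))" for a j k
  proof -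
    have "dird (lunit a) (S j k) = (\<lambda>x. dird (K (lunit a)) (P j k) (K x))"
      unfolding S_def[abs_def] by (rule dird_compose_linear[OF lK])
    moreover have "K (lunit a) = (if a = p then 0 else lunit a)"
      by (auto simp: K_def erase_coord_axis linear_0[OF linear_erase_coord] prod_eq_iff)
    ultimately show ?thesis by (cases "a = p") simp_all
  qed
  have shift1: "dird (lunit p) (S j k) = (\<lambda>_. 0)" for j k
    by (simp add: dS)
  have ddS: "dird (lunit a) (dird (lunit a) (S j k)) x
      = (if a = p then 0 else dird (lunit a) (dird (lunit a) (P j k)) (K x))" for a j k x
  proof (cases "a = p")
    case False
    have "dird (lunit a) (\<lambda>x. dird (lunit a) (P j k) (K x)) = (\<lambda>x. dird (K (lunit a)) (dird (lunit a) (P j k)) (K x))"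
      by (rule dird_compose_linear[OF lK])
    moreover have "K (lunit a) = lunit a"
      using False by (simp add: K_def erase_coord_axis linear_0[OF linear_erase_coord])
    ultimately show ?thesis using False by (simp add: dS)
  qed (simp add: dS)
  have ddP: "dird (lunit a) (dird (lunit a) (P j k)) = (D1 ^^ j) ((D2 ^^ k) (dird (lunit a) (dird (lunit a) G)))" for a j k
    unfolding P_def D1_def D2_def
    by (simp add: dird_funpow_commute[of _ "lunit a"] G poly_dird poly_dird_funpow)
  have lapP: "laplace lunit (P j k) x = 0" for j k x
  proof -
    have q: "poly_fun (dird (lunit a) (dird (lunit a) G))" for a
      by (intro poly_dird G)
    have "laplace lunit (P j k) x
        = (D1 ^^ j) ((D2 ^^ k) (\<lambda>x. \<Sum>a\<in>UNIV. dird (lunit a) (dird (lunit a) G) x)) x"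
      unfolding ddP D1_def D2_def dird_funpow_sum[OF q] dird_funpow_sum[OF poly_dird_funpow[OF q]] ..
    then show ?thesis by (simp add: lap D1_def D2_def dird_funpow_zero)
  qed
  \<comment> \<open>\<open>G\<close> is harmonic in its first variable; the second derivative along
    e_p, which \<open>K\<close> suppresses, reappears as the coefficient with \<open>j\<close>
    raised by 2.\<close>
  have lapS: "laplace lunit (S j k) x = - S (Suc (Suc j)) k x" for j k x
  proof -
    have "dird (lunit p) (dird (lunit p) (P j k)) = P (Suc (Suc j)) k"
      by (simp add: P_def D1_def)
    then show ?thesis
      unfolding ddS sum_if_zero lapP by (simp add: S_def)
  qed
  have invS: "biinv p (S j k)" for j k
    unfolding biinv_def
  proof (intro allI impI)
    fix T :: "real^'n \<Rightarrow> real^'n" and x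
    assume T: "rotation T" "T (axis p 1) = axis p 1"
    have oT: "orthogonal_transformation T" using T by (simp add: rotation_def)
    have lT: "linear T" using oT by (rule orthogonal_transformation_linear)
    have "G = (\<lambda>x. G (both T x))" using inv T unfolding biinv_def by (intro ext) metis
    have A: "(D1 ^^ i) (\<lambda>x. f (both T x)) = (\<lambda>x. (D1 ^^ i) f (both T x))" for f i
      unfolding D1_def by (rule dird_funpow_compose_linear[OF linear_pair_maps(6)[OF lT]])
        (simp add: T linear_0[OF lT])
    have B: "(D2 ^^ i) (\<lambda>x. f (both T x)) = (\<lambda>x. (D2 ^^ i) f (both T x))" for f i
      unfolding D2_def by (rule dird_funpow_compose_linear[OF linear_pair_maps(6)[OF lT]])
        (simp add: T linear_0[OF lT])
    have "P j k = (D1 ^^ j) ((D2 ^^ k) (\<lambda>x. G (both T x)))"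
      unfolding P_def using \<open>G = _\<close> by simp
    also have "\<dots> = (\<lambda>x. P j k (both T x))" unfolding A B P_def ..
    finally have PT: "P j k (both T y) = P j k y" for y by metis
    \<comment> \<open>An orthogonal map fixing e_p preserves the p-th coordinate, so it commutes
      with erasing it.\<close>
    have "T y $ p = y $ p" for y
    proof -
      have "T y \<bullet> T (axis p 1) = y \<bullet> axis p 1"
        using oT by (simp add: orthogonal_transformation_def)
      then show ?thesis by (simp add: T(2) inner_axis)
    qed
    then have "erase_coord p (T y) = T (erase_coord p y)" for y
      by (simp add: erase_coord_def linear_diff[OF lT] linear_scale[OF lT] T(2))
    then have "K (both T x) = both T (K x)" by (simp add: K_def)
    then show "S j k (both T x) = S j k x"
      unfolding S_def by (simp only: PT)
  qed
  \<comment> \<open>Two finite Taylor expansions along e_p, one in each variable, recover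
    \<open>G\<close> from all its coefficients.\<close>
  have "\<exists>j k. S j k \<noteq> (\<lambda>_. 0)"
  proof (rule ccontr)
    assume "\<not> ?thesis"
    then have S0: "S j k x = 0" for j k x unfolding fun_eq_iff by blast
    have Z: "(D2 ^^ k) G (y, erase_coord p z) = 0" for k y z
    proof -
      have "(D2 ^^ k) G (K (y, z) + (y $ p) *\<^sub>R lunit p) = 0"
      proof (rule taylor_vanish[OF pD2])
        show "(dird (lunit p) ^^ Suc m) ((D2 ^^ k) G) = (\<lambda>_. 0)"
          using D1nil[of "Suc m" k] unfolding D1_def by blast
        show "(dird (lunit p) ^^ j) ((D2 ^^ k) G) (K (y, z)) = 0" for j
          using S0[of j k "(y, z)"] unfolding S_def P_def D1_def .
      qed
      moreover have "K (y, z) + (y $ p) *\<^sub>R lunit p = (y, erase_coord p z)"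
        using erase_coord_split[of y p] by (simp add: K_def)
      ultimately show ?thesis by simp
    qed
    have "G (y, z) = 0" for y z
    proof -
      have "G ((y, erase_coord p z) + (z $ p) *\<^sub>R runit p) = 0"
      proof (rule taylor_vanish[OF G])
        show "(dird (runit p) ^^ Suc m) G = (\<lambda>_. 0)"
          using D2nil[of "Suc m"] unfolding D2_def by blast
        show "(dird (runit p) ^^ j) G (y, erase_coord p z) = 0" for j
          using Z[of j y z] unfolding D2_def .
      qed
      moreover have "(y, erase_coord p z) + (z $ p) *\<^sub>R runit p = (y, z)"
        using erase_coord_split[of z p] by simp
      ultimately show ?thesis by simp
    qed
    with G0 show False by auto
  qed
  define Q where "Q n \<longleftrightarrow> (\<exists>j k. S j k \<noteq> (\<lambda>_. 0) \<and> j + k = n)" for n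
  have exQ: "\<exists>n. Q n" using \<open>\<exists>j k. S j k \<noteq> (\<lambda>_. 0)\<close> unfolding Q_def by blast
  have bQ: "n \<le> 2 * m" if "Q n" for n
    using that Sle unfolding Q_def by fastforce
  define n where "n = (GREATEST n. Q n)"
  have Qn: "Q n" unfolding n_def by (rule GreatestI_ex_nat[OF exQ bQ])
  have Smax: "S j k = (\<lambda>_. 0)" if "n < j + k" for j k
  proof (rule ccontr)
    assume "S j k \<noteq> (\<lambda>_. 0)"
    then have "Q (j + k)" unfolding Q_def by blast
    then have "j + k \<le> n" unfolding n_def by (intro Greatest_le_nat[where b = "2 * m"] bQ)
    with that show False by simp
  qed
  have harm1: "laplace lunit (S j k) x = 0" if "j + k = n" for j k x
    unfolding lapS using Smax[of "Suc (Suc j)" k] that by simp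
  have dSs: "dird (runit a) (S j k) x = dird (lunit a) (S k j) (swap2 x)" for a j k x
  proof -
    have "dird (runit a) (\<lambda>x. S k j (swap2 x)) = (\<lambda>x. dird (swap2 (runit a)) (S k j) (swap2 x))"
      by (rule dird_compose_linear[OF linear_pair_maps(3)])
    then show ?thesis by (simp add: Ssym)
  qed
  have ddSs: "dird (runit a) (dird (runit a) (S j k)) x = dird (lunit a) (dird (lunit a) (S k j)) (swap2 x)" for a j k x
  proof -
    have "dird (runit a) (S j k) = (\<lambda>x. dird (lunit a) (S k j) (swap2 x))"
      by (rule ext, rule dSs)
    moreover have "dird (runit a) (\<lambda>x. dird (lunit a) (S k j) (swap2 x))
        = (\<lambda>x. dird (swap2 (runit a)) (dird (lunit a) (S k j)) (swap2 x))"
      by (rule dird_compose_linear[OF linear_pair_maps(3)])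
    ultimately show ?thesis by simp
  qed
  \<comment> \<open>The slot degrees are m - j and m - k, and j + k = n turns the exceptional case
    (m - j) + (m - k) = 1 into 2 m = n + 1.\<close>
  have deg: "j = k \<or> 2 * m = Suc n" if "j + k = n" "S j k \<noteq> (\<lambda>_. 0)" for j k
  proof -
    have le: "j \<le> m" "k \<le> m" using Sle[OF that(2)] by auto
    have "m - j = m - k \<or> (m - j) + (m - k) = 1"
    proof (rule slot_degrees_agree[OF pS invS hS1[OF le(1)] hS2[OF le(2)] harm1[OF that(1)] _ shift1 _ that(2) N])
      show "laplace runit (S j k) x = 0" for x
        unfolding ddSs using harm1[of k j] that(1) by simp
      show "dird (runit p) (S j k) = (\<lambda>_. 0)"
        by (rule ext) (simp add: dSs shift1)
    qed
    then show ?thesis using le that(1) by auto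
  qed
  \<comment> \<open>The n-th derivative of y -> \<open>G (y, y)\<close> along e_p, expanded
    binomially at points whose p-th coordinate is 0.\<close>
  have diagS: "(\<Sum>j\<le>n. real (n choose j) * S j (n - j) (y, y)) = 0" for y
  proof -
    have "(dird (lunit p + runit p) ^^ n) G (y, y) = 0" for y
    proof -
      have "(dird (axis p 1) ^^ n) (\<lambda>y. G (y, y)) = (\<lambda>y. (dird (lunit p + runit p) ^^ n) G (y, y))"
        by (rule dird_funpow_compose_linear) (auto simp: linear_iff)
      then show ?thesis by (simp add: diag dird_funpow_zero fun_eq_iff)
    qed
    then have "(\<Sum>j\<le>n. real (n choose j) * P j (n - j) (y, y)) = 0" for y
      using dird_binomial[where v = "lunit p" and w = "runit p" and n = n and x = "(y, y)", OF G] unfolding P_def D1_def D2_def by simp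
    from this[of "erase_coord p y"] show ?thesis by (simp add: S_def K_def)
  qed
  show False
  proof (cases "2 * m = Suc n")
    case False
    obtain J K' where JK: "S J K' \<noteq> (\<lambda>_. 0)" "J + K' = n" using Qn unfolding Q_def by blast
    then have n: "K' = J" "n = J + J" using deg[OF JK(2,1)] False by auto
    \<comment> \<open>All terms of total order \<open>n\<close> off the middle vanish, so the
      relation on the diagonal isolates \<open>S J J\<close>.\<close>
    have only: "S j (n - j) = (\<lambda>_. 0)" if "j \<le> n" "j \<noteq> J" for j
    proof (rule ccontr)
      assume "S j (n - j) \<noteq> (\<lambda>_. 0)"
      then have "j = n - j" using deg[of j "n - j"] False that(1) by simp
      with that n(2) show False by linarith
    qed
    have SJd: "S J J (y, y) = 0" for y
    proof -
      have "(\<Sum>j\<le>n. real (n choose j) * S j (n - j) (y, y)) = (\<Sum>j\<in>{J}. real (n choose j) * S j (n - j) (y, y))"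
      proof (rule sum.mono_neutral_right)
        show "{J} \<subseteq> {..n}" using n(2) by simp
        show "\<forall>j\<in>{..n} - {J}. real (n choose j) * S j (n - j) (y, y) = 0"
          using only by simp
      qed simp
      then have "real (n choose J) * S J (n - J) (y, y) = 0" using diagS[of y] by simp
      moreover have "n - J = J" "n choose J > 0" using n(2) by (simp_all add: zero_less_binomial)
      ultimately show ?thesis by simp
    qed
    have Jm: "J \<le> m" using Sle[OF JK(1)] by simp
    have "S J J = (\<lambda>_. 0)"
      by (rule diagonal_vanish[OF pS Ssym hS1[OF Jm] harm1 SJd shift1 invS bp]) (simp add: n(2))
    then show False using JK(1) n(1) by simp
  next
    case True
    have m0: "m > 0" using True by simp
    have n: "n = m + (m - 1)" using True by simp
    \<comment> \<open>Both indices are at most m and they add up to 2 m - 1, which leaves only (m, m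
      - 1) and (m - 1, m).\<close>
    have only: "S j (n - j) = (\<lambda>_. 0)" if "j \<le> n" "j \<noteq> m" "j \<noteq> m - 1" for j
    proof (rule ccontr)
      assume "S j (n - j) \<noteq> (\<lambda>_. 0)"
      from Sle[OF this] have "j \<le> m" "n - j \<le> m" by auto
      with that n show False by auto
    qed
    have Sd: "S m (m - 1) (y, y) = 0" for y
    proof -
      have "(\<Sum>j\<le>n. real (n choose j) * S j (n - j) (y, y)) = (\<Sum>j\<in>{m, m - 1}. real (n choose j) * S j (n - j) (y, y))"
      proof (rule sum.mono_neutral_right)
        show "{m, m - 1} \<subseteq> {..n}" using n by simp
        show "\<forall>j\<in>{..n} - {m, m - 1}. real (n choose j) * S j (n - j) (y, y) = 0"
          using only by simp
      qed simp
      also have "\<dots> = real (n choose m) * S m (m - 1) (y, y) + real (n choose (m - 1)) * S (m - 1) m (y, y)"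
      proof -
        have "n - m = m - 1" "n - (m - 1) = m" "m \<noteq> m - 1" using n m0 by auto
        then show ?thesis by simp
      qed
      \<comment> \<open>By symmetry the two remaining terms are equal on the diagonal; with
        nonnegative weights, one of them positive, they cannot cancel.\<close>
      also have "S (m - 1) m (y, y) = S m (m - 1) (y, y)"
        using Ssym[of m "m - 1" "(y, y)"] by simp
      finally have "(real (n choose m) + real (n choose (m - 1))) * S m (m - 1) (y, y) = 0"
        using diagS[of y] by (simp add: distrib_right)
      moreover have "n choose m > 0" using n by (simp add: zero_less_binomial)
      ultimately show ?thesis by (simp add: add_pos_nonneg)
    qed
    \<comment> \<open>The degree in the first variable is m - m = 0, so the kernel depends on
      \<open>z\<close> alone and is determined by the diagonal.\<close>
    have S1: "S m (m - 1) (y, z) = 0" for y z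
    proof -
      have "homog proj1 0 (S m (m - 1))" using hS1[OF order_refl, of "m - 1"] by simp
      from homog_0_eq[OF this pj(1), of "(z - y, 0)" "(y, z)" 1] show ?thesis
        using Sd[of z] by simp
    qed
    then have S1': "S m (m - 1) = (\<lambda>_. 0)" by auto
    have S2: "S (m - 1) m = (\<lambda>_. 0)"
    proof
      fix x
      show "S (m - 1) m x = 0" using Ssym[of m "m - 1" x] S1' by simp
    qed
    obtain J K' where JK: "S J K' \<noteq> (\<lambda>_. 0)" "J + K' = n" using Qn unfolding Q_def by blast
    then have "J \<le> m" "K' \<le> m" using Sle[OF JK(1)] by auto
    then have "J = m \<and> K' = m - 1 \<or> J = m - 1 \<and> K' = m" using JK(2) n by auto
    then show False using JK(1) S1' S2 by auto
  qed
qed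

section \<open>Homogeneous harmonic polynomials as polynomial functions\<close>

abbreviation (input) "multi k \<equiv> {\<alpha>::'n::finite \<Rightarrow> nat. (\<Sum>i\<in>UNIV. \<alpha> i) = k}"

lemma hom_poly_add:
  assumes "homogeneous_polynomial k f" "homogeneous_polynomial k g"
  shows "homogeneous_polynomial k (\<lambda>x. f x + g x)"
proof -
  obtain c d where
    "\<And>x. f x = (\<Sum>\<alpha>\<in>multi k. c \<alpha> * (\<Prod>i\<in>UNIV. (x $ i) ^ \<alpha> i))"
    "\<And>x. g x = (\<Sum>\<alpha>\<in>multi k. d \<alpha> * (\<Prod>i\<in>UNIV. (x $ i) ^ \<alpha> i))"
    using assms unfolding homogeneous_polynomial_def by blast
  then show ?thesis
    unfolding homogeneous_polynomial_def
    by (intro exI[of _ "\<lambda>\<alpha>. c \<alpha> + d \<alpha>"]) (simp add: distrib_right sum.distrib)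
qed

lemma hom_poly_cmult:
  assumes "homogeneous_polynomial k f"
  shows "homogeneous_polynomial k (\<lambda>x. r * f x)"
proof -
  obtain c where "\<And>x. f x = (\<Sum>\<alpha>\<in>multi k. c \<alpha> * (\<Prod>i\<in>UNIV. (x $ i) ^ \<alpha> i))"
    using assms unfolding homogeneous_polynomial_def by blast
  then show ?thesis
    unfolding homogeneous_polynomial_def
    by (intro exI[of _ "\<lambda>\<alpha>. r * c \<alpha>"]) (simp add: sum_distrib_left mult.assoc)
qed

lemma hom_poly_zero: "homogeneous_polynomial k (\<lambda>_. 0)"
  unfolding homogeneous_polynomial_def by (intro exI[of _ "\<lambda>_. 0"]) simp

lemma hom_poly_sum:
  assumes "finite I" "\<And>i. i \<in> I \<Longrightarrow> homogeneous_polynomial k (f i)"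
  shows "homogeneous_polynomial k (\<lambda>x. \<Sum>i\<in>I. f i x)"
  using assms by (induct I rule: finite_induct) (simp_all add: hom_poly_zero hom_poly_add)

text \<open>Raising the i-th exponent is a bijection from the multi-indices of order k to those of
  order k + 1 with nonzero i-th entry; the other new coefficients are 0.\<close>

lemma hom_poly_coord_mult:
  fixes f :: "real^'n \<Rightarrow> real"
  assumes "homogeneous_polynomial k f"
  shows "homogeneous_polynomial (Suc k) (\<lambda>x. x $ i * f x)"
proof -
  obtain c where c: "\<And>x. f x = (\<Sum>\<alpha>\<in>multi k. c \<alpha> * (\<Prod>i\<in>UNIV. (x $ i) ^ \<alpha> i))"
    using assms unfolding homogeneous_polynomial_def by blast
  define up where "up \<alpha> = \<alpha>(i := Suc (\<alpha> i))" for \<alpha> :: "'n \<Rightarrow> nat"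
  define down where "down \<alpha> = \<alpha>(i := \<alpha> i - 1)" for \<alpha> :: "'n \<Rightarrow> nat"
  have du: "down (up \<alpha>) = \<alpha>" for \<alpha> by (auto simp: up_def down_def)
  have inj: "inj_on up (multi k)" by (metis du inj_onI)
  have sum_up: "(\<Sum>j\<in>UNIV. up \<alpha> j) = Suc (\<Sum>j\<in>UNIV. \<alpha> j)" for \<alpha>
    by (simp add: up_def sum.remove[of UNIV i])
  have ud: "up (down \<beta>) = \<beta>" if "\<beta> i \<noteq> 0" for \<beta> using that by (auto simp: up_def down_def)
  have img: "up ` multi k = {\<beta> \<in> multi (Suc k). \<beta> i \<noteq> 0}"
  proof (intro equalityI subsetI)
    fix \<beta> assume "\<beta> \<in> up ` multi k"
    then show "\<beta> \<in> {\<beta> \<in> multi (Suc k). \<beta> i \<noteq> 0}" using sum_up by (auto simp: up_def)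
  next
    fix \<beta> assume \<beta>: "\<beta> \<in> {\<beta> \<in> multi (Suc k). \<beta> i \<noteq> 0}"
    then have "(\<Sum>j\<in>UNIV. down \<beta> j) = k" using sum_up[of "down \<beta>"] ud[of \<beta>] by simp
    then show "\<beta> \<in> up ` multi k" using ud[of \<beta>] \<beta> by (metis (mono_tags, lifting) image_eqI mem_Collect_eq)
  qed
  have prod_up: "(\<Prod>j\<in>UNIV. (x $ j) ^ up \<alpha> j) = x $ i * (\<Prod>j\<in>UNIV. (x $ j) ^ \<alpha> j)" for \<alpha> and x :: "real^'n"
    by (simp add: up_def prod.remove[of UNIV i])
  define c' where "c' \<beta> = (if \<beta> i \<noteq> 0 then c (down \<beta>) else 0)" for \<beta>
  have "x $ i * f x = (\<Sum>\<beta>\<in>multi (Suc k). c' \<beta> * (\<Prod>j\<in>UNIV. (x $ j) ^ \<beta> j))" for x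
  proof -
    have "(\<Sum>\<beta>\<in>multi (Suc k). c' \<beta> * (\<Prod>j\<in>UNIV. (x $ j) ^ \<beta> j))
        = (\<Sum>\<beta>\<in>up ` multi k. c' \<beta> * (\<Prod>j\<in>UNIV. (x $ j) ^ \<beta> j))"
      unfolding img by (intro sum.mono_neutral_right finite_multi_indices) (auto simp: c'_def)
    also have "\<dots> = (\<Sum>\<alpha>\<in>multi k. c' (up \<alpha>) * (\<Prod>j\<in>UNIV. (x $ j) ^ up \<alpha> j))"
      by (simp add: sum.reindex[OF inj])
    also have "\<dots> = (\<Sum>\<alpha>\<in>multi k. c \<alpha> * (x $ i * (\<Prod>j\<in>UNIV. (x $ j) ^ \<alpha> j)))"
      unfolding prod_up c'_def du by (simp add: up_def)
    finally show ?thesis by (simp add: c sum_distrib_left mult_ac)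
  qed
  then show ?thesis unfolding homogeneous_polynomial_def by blast
qed

text \<open>Euler's relation writes \<open>f\<close> as the sum of x_i times its partial
  derivatives, divided by the degree, and the derivatives have lower degree. This produces monomial
  coefficients by induction.\<close>

lemma poly_homog_imp_hom_poly:
  fixes f :: "real^'n \<Rightarrow> real"
  assumes "poly_fun f" "homog (\<lambda>x. x) k f"
  shows "homogeneous_polynomial k f"
  using assms
proof (induct k arbitrary: f)
  case 0
  have "(multi 0 :: ('n \<Rightarrow> nat) set) = {\<lambda>_. 0}" by auto
  moreover have "f x = f 0" for x by (rule homog_id_0_const[OF 0(2)])
  ultimately show ?case
    unfolding homogeneous_polynomial_def by (intro exI[of _ "\<lambda>_. f 0"]) simp
next
  case (Suc k)
  have "homogeneous_polynomial k (dird (axis i 1) f)" for i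
    by (rule Suc.hyps[OF poly_dird[OF Suc.prems(1)] homog_dird[OF Suc.prems linear_self refl]])
  then have "homogeneous_polynomial (Suc k) (\<lambda>x. (1 / real (Suc k)) * (\<Sum>i\<in>UNIV. x $ i * dird (axis i 1) f x))"
    by (intro hom_poly_cmult hom_poly_sum hom_poly_coord_mult) auto
  then show ?case
    unfolding homog_euler_coord[OF Suc.prems] by simp
qed

lemma hom_poly_imp_poly:
  fixes f :: "real^'n \<Rightarrow> real"
  assumes "homogeneous_polynomial k f"
  shows "poly_fun f"
proof -
  obtain c where c: "f = (\<lambda>x. \<Sum>\<alpha>\<in>multi k. c \<alpha> * (\<Prod>i\<in>UNIV. (x $ i) ^ \<alpha> i))"
    using assms unfolding homogeneous_polynomial_def by blast
  have "poly_fun (\<lambda>x. \<Prod>i\<in>UNIV. (x $ i) ^ \<alpha> i)" for \<alpha> :: "'n \<Rightarrow> nat"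
    by (intro real_polynomial_function_prod real_polynomial_function_power finite
        poly_of_linear bounded_linear_vec_nth)
  then show ?thesis
    unfolding c
    by (intro real_polynomial_function_sum finite_multi_indices poly_times
        poly_of_const)
qed

lemma hom_poly_imp_homog:
  fixes f :: "real^'n \<Rightarrow> real"
  assumes "homogeneous_polynomial k f"
  shows "homog (\<lambda>x. x) k f"
proof -
  obtain c where c: "\<And>x. f x = (\<Sum>\<alpha>\<in>multi k. c \<alpha> * (\<Prod>i\<in>UNIV. (x $ i) ^ \<alpha> i))"
    using assms unfolding homogeneous_polynomial_def by blast
  have "(\<Prod>i\<in>UNIV. ((t *\<^sub>R x) $ i) ^ \<alpha> i) = t ^ k * (\<Prod>i\<in>UNIV. (x $ i) ^ \<alpha> i)"
    if "\<alpha> \<in> multi k" for t \<alpha> and x :: "real^'n"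
    using that by (auto simp: power_mult_distrib prod.distrib power_sum)
  then show ?thesis
    unfolding homog_id_iff c by (auto simp: sum_distrib_left mult_ac intro!: sum.cong)
qed

lemma laplacian_eq: "laplacian f x = laplace unitv f x"
  for f :: "real^'n \<Rightarrow> real"
  by (simp add: laplacian_def partial_eq_dird)

text \<open>Trades monomial coefficients for conditions that are stable under linear substitutions
  and convenient for differentiation.\<close>

lemma harmonic_iff:
  "h \<in> \<H> p \<longleftrightarrow> poly_fun h \<and> homog (\<lambda>x. x) p h \<and>
     (\<forall>x. laplace unitv h x = 0)"
  unfolding harmonic_polynomials_def mem_Collect_eq laplacian_eq
  using hom_poly_imp_poly hom_poly_imp_homog poly_homog_imp_hom_poly by blast

lemma harmonic_poly: "h \<in> \<H> p \<Longrightarrow> poly_fun h"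
  and harmonic_homog: "h \<in> \<H> p \<Longrightarrow> h (t *\<^sub>R x) = t ^ p * h x"
  and harmonic_lap: "h \<in> \<H> p \<Longrightarrow> laplace unitv h x = 0"
  by (auto simp: harmonic_iff homog_id_iff)

lemma plus_fun_eq: "f + g = (\<lambda>x. f x + g x)"
  by (simp add: fun_eq_iff)

lemma sum_fun_apply: "(\<Sum>i\<in>I. f i) x = (\<Sum>i\<in>I. f i x)"
  by (induct I rule: infinite_finite_induct) auto

lemma subspace_harmonic: "subspace (\<H> p :: (real^'n \<Rightarrow> real) set)"
proof (rule subspaceI)
  show "0 \<in> \<H> p"
    by (auto simp: harmonic_iff zero_fun_def homog_id_iff intro: poly_of_const)
next
  fix f g :: "real^'n \<Rightarrow> real" assume f: "f \<in> \<H> p" and g: "g \<in> \<H> p"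
  note pf = harmonic_poly[OF f] and pg = harmonic_poly[OF g]
  show "f + g \<in> \<H> p"
    unfolding harmonic_iff plus_fun_eq
    using f g
    by (auto simp: dird_add[OF pf pg] dird_add[OF poly_dird[OF pf] poly_dird[OF pg]] sum.distrib
        harmonic_lap homog_id_iff harmonic_homog distrib_left
        intro!: poly_plus pf pg)
next
  fix f :: "real^'n \<Rightarrow> real" and c assume f: "f \<in> \<H> p"
  note pf = harmonic_poly[OF f]
  show "c *\<^sub>R f \<in> \<H> p"
    unfolding harmonic_iff scaleR_fun_def real_scaleR_def
    using f
    by (auto simp: dird_cmult[OF pf] dird_cmult[OF poly_dird[OF pf]] sum_distrib_left[symmetric]
        harmonic_lap homog_id_iff harmonic_homog
        intro!: poly_times poly_of_const pf)
qed

lemma harmonic_finite_dim: "\<exists>S. finite S \<and> (\<H> p :: (real^'n \<Rightarrow> real) set) \<subseteq> span S"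
proof (intro exI conjI subsetI)
  let ?m = "\<lambda>(\<alpha>::'n \<Rightarrow> nat) (x::real^'n). \<Prod>i\<in>UNIV. (x $ i) ^ \<alpha> i"
  show "finite (?m ` multi p)" by (intro finite_imageI finite_multi_indices)
  fix h :: "real^'n \<Rightarrow> real" assume "h \<in> \<H> p"
  then obtain c where c: "\<And>x. h x = (\<Sum>\<alpha>\<in>multi p. c \<alpha> * ?m \<alpha> x)"
    unfolding harmonic_polynomials_def homogeneous_polynomial_def by blast
  have "h = (\<Sum>\<alpha>\<in>multi p. c \<alpha> *\<^sub>R ?m \<alpha>)"
    by (rule ext) (simp add: c sum_fun_apply scaleR_fun_def)
  also have "\<dots> \<in> span (?m ` multi p)"
    by (intro span_sum span_scale span_base imageI)
  finally show "h \<in> span (?m ` multi p)" .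
qed

lemma harmonic_orthogonal:
  fixes T :: "real^'n \<Rightarrow> real^'n"
  assumes h: "h \<in> \<H> p" and T: "orthogonal_transformation T"
  shows "(\<lambda>x. h (T x)) \<in> \<H> p"
proof -
  have lT: "linear T" by (rule orthogonal_transformation_linear[OF T])
  have ph: "poly_fun h" by (rule harmonic_poly[OF h])
  have 1: "dird v (\<lambda>x. h (T x)) = (\<lambda>x. dird (T v) h (T x))" for v
    by (rule dird_compose_linear[OF lT])
  have 2: "dird v (dird v (\<lambda>x. h (T x))) x = dird (T v) (dird (T v) h) (T x)" for v x
    unfolding 1 by (rule fun_cong[OF dird_compose_linear[OF lT]])
  show ?thesis
    unfolding harmonic_iff
  proof (intro conjI allI)
    show "poly_fun (\<lambda>x. h (T x))"
      by (rule poly_compose_linear[OF ph linear_conv_bounded_linear[THEN iffD1, OF lT]])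
    show "homog (\<lambda>x. x) p (\<lambda>x. h (T x))"
      by (simp add: homog_id_iff linear_scale[OF lT] harmonic_homog[OF h])
    show "laplace unitv (\<lambda>x. h (T x)) x = 0" for x
      unfolding 2 using lap_orthogonal[where L = "\<lambda>x. x" and x = "T x", OF ph linear_self T] harmonic_lap[OF h] by simp
  qed
qed

lemma homog_of_slices:
  fixes G :: "(real^'n) \<times> (real^'n) \<Rightarrow> real"
  assumes "\<And>z. (\<lambda>y. G (y, z)) \<in> \<H> p"
  shows "homog proj1 p G"
  unfolding homog_def
proof (intro allI)
  fix t and x :: "(real^'n) \<times> (real^'n)"
  have "x + (t - 1) *\<^sub>R proj1 x = (t *\<^sub>R fst x, snd x)"
    by (simp add: prod_eq_iff algebra_simps)
  then show "G (x + (t - 1) *\<^sub>R proj1 x) = t ^ p * G x"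
    using harmonic_homog[OF assms[of "snd x"], of t "fst x"] by simp
qed

lemma lap_of_slices:
  fixes G :: "(real^'n) \<times> (real^'n) \<Rightarrow> real"
  assumes "\<And>z. (\<lambda>y. G (y, z)) \<in> \<H> p"
  shows "laplace lunit G x = 0"
proof -
  have s: "dird v (\<lambda>y. F (y, z)) y = dird (v, 0) F (y, z)" for v y z and F :: "(real^'n) \<times> (real^'n) \<Rightarrow> real"
    by (simp add: dird_def)
  show ?thesis
    using harmonic_lap[OF assms[of "snd x"], of "fst x"] unfolding s s[abs_def] by simp
qed

section \<open>Orthonormal bases for abstract inner products\<close>

text \<open>The inner products live on subspaces of function spaces, so they are axiomatised on a
  carrier set. Two instances are used: H_p with the scalar product on the sphere, and the kernels
  vanishing on the diagonal with an integral over a ball.\<close>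

locale fin_ip =
  fixes V :: "'a::real_vector set" and ip :: "'a \<Rightarrow> 'a \<Rightarrow> real"
  assumes V: "subspace V" and fd: "\<exists>S. finite S \<and> V \<subseteq> span S"
    and ip_sym: "\<And>f g. f \<in> V \<Longrightarrow> g \<in> V \<Longrightarrow> ip f g = ip g f"
    and ip_add: "\<And>f g h. f \<in> V \<Longrightarrow> g \<in> V \<Longrightarrow> h \<in> V \<Longrightarrow> ip (f + g) h = ip f h + ip g h"
    and ip_scale: "\<And>c f h. f \<in> V \<Longrightarrow> h \<in> V \<Longrightarrow> ip (c *\<^sub>R f) h = c * ip f h"
    and ip_pos: "\<And>f. f \<in> V \<Longrightarrow> f \<noteq> 0 \<Longrightarrow> ip f f > 0"
begin

definition onset :: "'a set \<Rightarrow> bool" where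
  "onset H \<longleftrightarrow> finite H \<and> H \<subseteq> V \<and> (\<forall>f\<in>H. \<forall>g\<in>H. ip f g = (if f = g then 1 else 0))"

definition onbasis :: "'a set \<Rightarrow> bool" where
  "onbasis H \<longleftrightarrow> onset H \<and> (\<forall>f\<in>V. f = (\<Sum>h\<in>H. ip f h *\<^sub>R h))"

lemma ip_zero: "h \<in> V \<Longrightarrow> ip 0 h = 0"
  using ip_scale[of h h 0] by simp

lemma ip_sum:
  assumes "\<And>i. i \<in> I \<Longrightarrow> f i \<in> V" "h \<in> V"
  shows "ip (\<Sum>i\<in>I. c i *\<^sub>R f i) h = (\<Sum>i\<in>I. c i * ip (f i) h)"
  using assms(1)
proof (induct I rule: infinite_finite_induct)
  case (insert i I)
  then show ?case
    using assms(2) V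
    by (simp add: ip_add ip_scale subspace_scale subspace_sum)
qed (simp_all add: ip_zero assms(2))

lemma ip_diff:
  assumes "f \<in> V" "g \<in> V" "h \<in> V"
  shows "ip (f - g) h = ip f h - ip g h"
proof -
  have "f - g = f + (-1) *\<^sub>R g" by simp
  then have "ip (f - g) h = ip f h + ip ((-1) *\<^sub>R g) h"
    using ip_add[OF assms(1) subspace_scale[OF V assms(2)] assms(3)] by metis
  then show ?thesis
    by (simp only: ip_scale[OF assms(2,3)])
qed

lemma ip_eqI:
  assumes "f \<in> V" "g \<in> V" "\<And>h. h \<in> V \<Longrightarrow> ip f h = ip g h"
  shows "f = g"
proof (rule ccontr)
  assume "f \<noteq> g"
  moreover have "f - g \<in> V" using assms V by (simp add: subspace_diff)
  ultimately have "ip (f - g) (f - g) > 0" by (intro ip_pos) auto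
  then show False using assms \<open>f - g \<in> V\<close> by (simp add: ip_diff)
qed

lemma ip_onset_sum:
  assumes "onset H" "h \<in> H"
  shows "ip (\<Sum>g\<in>H. c g *\<^sub>R g) h = c h"
proof -
  have "ip (\<Sum>g\<in>H. c g *\<^sub>R g) h = (\<Sum>g\<in>H. c g * ip g h)"
    by (rule ip_sum) (use assms in \<open>auto simp: onset_def\<close>)
  also have "\<dots> = (\<Sum>g\<in>H. if g = h then c g else 0)"
    using assms by (intro sum.cong) (auto simp: onset_def)
  also have "\<dots> = c h" using assms by (simp add: onset_def)
  finally show ?thesis .
qed

lemma onset_independent:
  assumes "onset H"
  shows "independent H"
proof (rule ccontr)
  assume "\<not> independent H"
  moreover have "finite H" using assms by (simp add: onset_def)
  ultimately obtain u v where "v \<in> H" "u v \<noteq> 0" "(\<Sum>v\<in>H. u v *\<^sub>R v) = 0"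
    using dependent_finite by blast
  then show False
    using ip_onset_sum[OF assms, of v u] ip_zero assms by (auto simp: onset_def)
qed

text \<open>An orthonormal set of maximal size is a basis, because a vector not recovered by its
  expansion would, after subtracting the expansion and normalising, enlarge the set. Sizes are
  bounded since orthonormal sets are independent.\<close>

lemma ex_onbasis: "\<exists>H. onbasis H"
proof -
  obtain S where S: "finite S" "V \<subseteq> span S" using fd by blast
  have b: "card H \<le> card S" if "onset H" for H
    using independent_span_bound[OF S(1) onset_independent[OF that]] that S(2)
    by (auto simp: onset_def)
  define Q where "Q n \<longleftrightarrow> (\<exists>H. onset H \<and> card H = n)" for n
  have Q0: "\<exists>n. Q n" unfolding Q_def by (rule exI[of _ 0], rule exI[of _ "{}"]) (simp add: onset_def)
  have Qb: "n \<le> card S" if "Q n" for n using that b unfolding Q_def by blast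
  obtain H where H: "onset H" "card H = (GREATEST n. Q n)"
    using GreatestI_ex_nat[OF Q0 Qb] unfolding Q_def by blast
  have max: "card H' \<le> card H" if "onset H'" for H'
    unfolding H(2) by (rule Greatest_le_nat[where b = "card S"]) (use that Qb in \<open>auto simp: Q_def\<close>)
  have HV: "H \<subseteq> V" "finite H" using H by (auto simp: onset_def)
  have "f = (\<Sum>h\<in>H. ip f h *\<^sub>R h)" if f: "f \<in> V" for f
  proof (rule ccontr)
    define s where "s = (\<Sum>h\<in>H. ip f h *\<^sub>R h)"
    assume "f \<noteq> (\<Sum>h\<in>H. ip f h *\<^sub>R h)"
    then have ne: "f - s \<noteq> 0" by (simp add: s_def)
    have sV: "s \<in> V" unfolding s_def using HV V by (intro subspace_sum subspace_scale) auto
    have gV: "f - s \<in> V" using f sV V by (simp add: subspace_diff)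
    have pos: "ip (f - s) (f - s) > 0" by (rule ip_pos[OF gV ne])
    define r where "r = 1 / sqrt (ip (f - s) (f - s))"
    define g where "g = r *\<^sub>R (f - s)"
    have gV': "g \<in> V" unfolding g_def using gV V by (rule subspace_scale[rotated])
    have gh: "ip g h = 0" if "h \<in> H" for h
      using that HV f sV gV ip_onset_sum[OF H(1) that, of "ip f"]
      by (simp add: g_def ip_scale ip_diff s_def subset_iff)
    have gg: "ip g g = 1"
    proof -
      have "ip g g = r * (r * ip (f - s) (f - s))"
        unfolding g_def using gV gV' ip_sym[OF gV gV'[unfolded g_def]] by (simp add: ip_scale g_def)
      also have "\<dots> = 1" using pos by (simp add: r_def)
      finally show ?thesis .
    qed
    have "g \<notin> H" using gh gg by force
    have "onset (insert g H)"
      unfolding onset_def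
    proof (intro conjI ballI)
      show "finite (insert g H)" "insert g H \<subseteq> V" using HV gV' by auto
      fix a b assume "a \<in> insert g H" "b \<in> insert g H"
      then consider "a = g" "b = g" | "a = g" "b \<in> H" | "a \<in> H" "b = g" | "a \<in> H" "b \<in> H" by blast
      then show "ip a b = (if a = b then 1 else 0)"
      proof cases
        case 3
        then have "ip a b = ip b a" using HV gV' by (intro ip_sym) auto
        then show ?thesis using 3 gh \<open>g \<notin> H\<close> by auto
      next
        case 4
        then show ?thesis using H(1) by (simp add: onset_def)
      qed (use gg gh \<open>g \<notin> H\<close> in auto)
    qed
    from max[OF this] show False using \<open>g \<notin> H\<close> HV by simp
  qed
  then show ?thesis using H(1) unfolding onbasis_def by blast
qed

lemma onbasis_card:
  assumes "onbasis H"
  shows "card H = dim V"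
proof (rule dim_unique[symmetric, OF _ _ _ refl])
  show "H \<subseteq> V" using assms by (simp add: onbasis_def onset_def)
  show "independent H" using assms onset_independent by (simp add: onbasis_def)
  show "V \<subseteq> span H"
  proof
    fix f assume "f \<in> V"
    then have "f = (\<Sum>h\<in>H. ip f h *\<^sub>R h)" using assms by (simp add: onbasis_def)
    also have "\<dots> \<in> span H" by (intro span_sum span_scale span_base)
    finally show "f \<in> span H" .
  qed
qed

end

section \<open>Rotation invariance of Lebesgue measure\<close>

lemma nn_integral_lborel_shift:
  fixes f :: "'a::euclidean_space \<Rightarrow> ennreal"
  assumes [measurable]: "f \<in> borel_measurable borel"
  shows "(\<integral>\<^sup>+x. f (c + x) \<partial>lborel) = (\<integral>\<^sup>+x. f x \<partial>lborel)"
proof -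
  have "(\<integral>\<^sup>+x. f x \<partial>lborel) = (\<integral>\<^sup>+x. f x \<partial>distr lborel borel ((+) c))"
    by (simp add: lborel_distr_plus)
  also have "\<dots> = (\<integral>\<^sup>+x. f (c + x) \<partial>lborel)"
    by (subst nn_integral_distr) auto
  finally show ?thesis ..
qed

lemma orthogonal_continuous:
  fixes T :: "'a::euclidean_space \<Rightarrow> 'a"
  assumes "orthogonal_transformation T"
  shows "continuous_on S T"
  using orthogonal_transformation_linear[OF assms] linear_continuous_on linear_conv_bounded_linear by blast

lemma orthogonal_right_inverse:
  fixes T :: "'a::euclidean_space \<Rightarrow> 'a"
  assumes "orthogonal_transformation T"
  shows "T (inv T y) = y"
  using orthogonal_transformation_surj[OF assms] by (simp add: surj_f_inv_f)

text \<open>Computing the integral of \<open>1\<^sub>A(T x + y) 1\<^sub>B(y)\<close> over \<open>(x, y)\<close> in both orders, with \<open>B\<close> the unit ball,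
  compares the measures of \<open>A\<close> and of its preimage.\<close>

lemma lborel_distr_orthogonal:
  fixes T :: "'a::euclidean_space \<Rightarrow> 'a"
  assumes T: "orthogonal_transformation T"
  shows "distr lborel borel T = lborel"
proof (rule measure_eqI)
  have lT: "linear T" by (rule orthogonal_transformation_linear[OF T])
  have Tm [measurable]: "T \<in> borel_measurable borel"
    using orthogonal_continuous[OF T] by (rule borel_measurable_continuous_onI)
  fix A :: "'a set" assume "A \<in> sets (distr lborel borel T)"
  then have A [measurable]: "A \<in> sets borel" by simp
  let ?B = "ball 0 1 :: 'a set"
  have B [measurable]: "?B \<in> sets borel" by simp
  let ?\<mu> = "\<integral>\<^sup>+x. indicator A (T x) \<partial>lborel"
  have "?\<mu> * emeasure lborel ?B = (\<integral>\<^sup>+y. ?\<mu> * indicator ?B y \<partial>lborel)"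
    by (subst nn_integral_cmult) auto
  also have "\<dots> = (\<integral>\<^sup>+y. (\<integral>\<^sup>+x. indicator A (T x + y) * indicator ?B y \<partial>lborel) \<partial>lborel)"
  proof (rule nn_integral_cong)
    fix y
    have "?\<mu> = (\<integral>\<^sup>+x. indicator A (T (inv T y + x)) \<partial>lborel)"
      by (rule nn_integral_lborel_shift[symmetric]) measurable
    also have "\<dots> = (\<integral>\<^sup>+x. indicator A (T x + y) \<partial>lborel)"
      by (simp add: linear_add[OF lT] orthogonal_right_inverse[OF T] add.commute)
    finally show "?\<mu> * indicator ?B y = (\<integral>\<^sup>+x. indicator A (T x + y) * indicator ?B y \<partial>lborel)"
      by (subst nn_integral_multc) auto
  qed
  also have "\<dots> = (\<integral>\<^sup>+x. (\<integral>\<^sup>+y. indicator A (T x + y) * indicator ?B y \<partial>lborel) \<partial>lborel)"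
    by (rule lborel_pair.Fubini') measurable
  \<comment> \<open>Translation in \<open>y\<close> by the fixed vector \<open>T x\<close> moves the
    dependence on \<open>x\<close> from \<open>A\<close> into the ball.\<close>
  also have "\<dots> = (\<integral>\<^sup>+x. (\<integral>\<^sup>+y. indicator A y * indicator ?B (y - T x) \<partial>lborel) \<partial>lborel)"
  proof (rule nn_integral_cong)
    fix x
    have "(\<integral>\<^sup>+y. indicator A y * indicator ?B (y - T x) \<partial>lborel)
       = (\<integral>\<^sup>+y. indicator A (T x + y) * indicator ?B ((T x + y) - T x) \<partial>lborel)"
      by (rule nn_integral_lborel_shift[symmetric]) measurable
    then show "(\<integral>\<^sup>+y. indicator A (T x + y) * indicator ?B y \<partial>lborel)
       = (\<integral>\<^sup>+y. indicator A y * indicator ?B (y - T x) \<partial>lborel)" by simp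
  qed
  also have "\<dots> = (\<integral>\<^sup>+y. (\<integral>\<^sup>+x. indicator A y * indicator ?B (y - T x) \<partial>lborel) \<partial>lborel)"
    by (rule lborel_pair.Fubini'[symmetric]) measurable
  also have "\<dots> = (\<integral>\<^sup>+y. indicator A y * emeasure lborel ?B \<partial>lborel)"
  proof (rule nn_integral_cong)
    fix y
    \<comment> \<open>Because \<open>T\<close> is an isometry, the condition on \<open>x\<close>
      describes a unit ball about the preimage of \<open>y\<close>, whose measure does not depend on
      \<open>y\<close>.\<close>
    have n: "norm (y - T x) = norm (x - inv T y)" for x
    proof -
      have "y - T x = T (inv T y - x)"
        by (simp add: linear_diff[OF lT] orthogonal_right_inverse[OF T])
      then show ?thesis
        using orthogonal_transformation_norm[OF T] by (simp add: norm_minus_commute)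
    qed
    have "indicator ?B (y - T x) = (indicator ?B (- inv T y + x) :: ennreal)" for x
      using n[of x] by (auto simp: indicator_def algebra_simps)
    then have "(\<integral>\<^sup>+x. indicator ?B (y - T x) \<partial>lborel) = (\<integral>\<^sup>+x. indicator ?B (- inv T y + x) \<partial>lborel)"
      by simp
    also have "\<dots> = (\<integral>\<^sup>+x. indicator ?B x \<partial>lborel)"
      by (rule nn_integral_lborel_shift) measurable
    also have "\<dots> = emeasure lborel ?B" by simp
    finally show "(\<integral>\<^sup>+x. indicator A y * indicator ?B (y - T x) \<partial>lborel) = indicator A y * emeasure lborel ?B"
      by (subst nn_integral_cmult) auto
  qed
  also have "\<dots> = emeasure lborel A * emeasure lborel ?B"
    by (subst nn_integral_multc) auto
  finally have eq: "?\<mu> * emeasure lborel ?B = emeasure lborel A * emeasure lborel ?B" .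
  have "emeasure lborel ?B \<noteq> \<infinity>" using emeasure_lborel_ball_finite[of "0::'a" 1] by simp
  moreover have "emeasure lborel ?B \<noteq> 0"
    using less_imp_neq[OF unit_ball_vol_pos[of "real DIM('a)"]] by (simp add: emeasure_ball)
  moreover have "a = c" if "a * b = c * b" "b \<noteq> 0" "b \<noteq> \<infinity>" for a b c :: ennreal
  proof -
    have "b \<noteq> top" using that(3) by simp
    then show ?thesis
      using ennreal_mult_divide_eq[OF that(2), of a] ennreal_mult_divide_eq[OF that(2), of c]
      unfolding that(1) by metis
  qed
  ultimately have "?\<mu> = emeasure lborel A"
    using eq by blast
  moreover have "?\<mu> = emeasure (distr lborel borel T) A"
  proof -
    have "?\<mu> = (\<integral>\<^sup>+x. indicator A x \<partial>distr lborel borel T)"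
      by (rule nn_integral_distr[symmetric]) auto
    also have "\<dots> = emeasure (distr lborel borel T) A"
      by (rule nn_integral_indicator) simp
    finally show ?thesis .
  qed
  ultimately show "emeasure (distr lborel borel T) A = emeasure lborel A" by metis
qed simp

lemma integral_lborel_orthogonal:
  fixes T :: "'a::euclidean_space \<Rightarrow> 'a" and f :: "'a \<Rightarrow> real"
  assumes T: "orthogonal_transformation T" and [measurable]: "f \<in> borel_measurable borel"
  shows "(LINT x|lborel. f (T x)) = (LINT x|lborel. f x)"
proof -
  have Tm [measurable]: "T \<in> borel_measurable borel"
    using orthogonal_continuous[OF T] by (rule borel_measurable_continuous_onI)
  have "(LINT x|lborel. f x) = (LINT x|distr lborel borel T. f x)"
    by (simp add: lborel_distr_orthogonal[OF T])
  also have "\<dots> = (LINT x|lborel. f (T x))"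
    by (rule integral_distr) auto
  finally show ?thesis ..
qed

lemma integrable_bounded_region:
  fixes f :: "'a::euclidean_space \<Rightarrow> real"
  assumes "f \<in> borel_measurable borel" "U \<in> sets borel" "U \<subseteq> ball 0 1" "\<And>x. x \<in> U \<Longrightarrow> \<bar>f x\<bar> \<le> C"
  shows "integrable lborel (\<lambda>x. indicator U x *\<^sub>R f x)"
proof (rule integrableI_bounded_set_indicator[where B = C])
  have "emeasure lborel U \<le> emeasure lborel (ball 0 1 :: 'a set)"
    by (rule emeasure_mono[OF assms(3)]) simp
  then show "emeasure lborel U < \<infinity>"
    using emeasure_lborel_ball_finite[of "0::'a" 1] by (simp add: less_le_trans le_less_trans)
qed (use assms in auto)

text \<open>The set where the function is positive is open and, as the integral vanishes, contained
  in a null set; a nonempty open set is not negligible.\<close>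

lemma integral_open_eq_0_imp:
  fixes f :: "'a::euclidean_space \<Rightarrow> real"
  assumes int: "integrable lborel (\<lambda>x. indicator U x *\<^sub>R f x)" and U: "open U"
    and cont: "continuous_on U f" and nn: "\<And>x. x \<in> U \<Longrightarrow> f x \<ge> 0"
    and 0: "(LINT x|lborel. indicator U x *\<^sub>R f x) = 0" and x: "x \<in> U"
  shows "f x = 0"
proof (rule ccontr)
  assume "f x \<noteq> 0"
  define W where "W = {x \<in> U. f x > 0}"
  have "AE x in lborel. indicator U x *\<^sub>R f x = 0"
    using 0 nn by (subst (asm) integral_nonneg_eq_0_iff_AE[OF int]) (auto simp: indicator_def)
  then obtain N where N: "N \<in> null_sets lborel" "{x. indicator U x *\<^sub>R f x \<noteq> 0} \<subseteq> N"
    by (auto elim!: AE_E simp: null_sets_def)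
  have "open W"
  proof -
    have "W = U \<inter> f -` {0<..}" by (auto simp: W_def)
    then show ?thesis using continuous_open_preimage[OF cont U open_greaterThan] by simp
  qed
  moreover have "x \<in> W" using x nn[OF x] \<open>f x \<noteq> 0\<close> by (simp add: W_def)
  ultimately have "\<not> negligible W" using open_not_negligible by blast
  moreover have "W \<subseteq> N" using N(2) by (auto simp: W_def)
  moreover have "negligible N"
    using N(1) by (simp add: negligible_iff_null_sets null_sets_completionI)
  ultimately show False using negligible_subset by blast
qed

section \<open>Integration over the sphere\<close>

abbreviation (input) "punctured \<equiv> ball 0 1 - {0 :: real^'n}"

lemma radial_measurable: "(\<lambda>x::real^'n. x /\<^sub>R norm x) \<in> borel_measurable borel"
  by measurable

lemma radial_measurable_sphere:
  "(\<lambda>x::real^'n. x /\<^sub>R norm x) \<in> restrict_space lborel punctured \<rightarrow>\<^sub>M restrict_space borel (sphere 0 1)"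
proof (rule measurable_restrict_space2)
  show "(\<lambda>x::real^'n. x /\<^sub>R norm x) \<in> restrict_space lborel punctured \<rightarrow>\<^sub>M borel"
    by (rule measurable_restrict_space1) (simp add: radial_measurable)
qed (auto simp: space_restrict_space)

lemma measure_scale_eq_density:
  "scale_measure (of_nat N) M = density M (\<lambda>_. of_nat N)"
  by (rule measure_eqI) (auto simp: emeasure_density nn_integral_cmult)

text \<open>Reduces integration over the sphere to Lebesgue integration of the radially constant
  extension over the punctured ball.\<close>

lemma LINT_sphere:
  fixes f :: "real^'n \<Rightarrow> real"
  assumes f: "f \<in> borel_measurable borel"
  shows "(LINT x|sphere_measure. f x) = CARD('n) * (LINT x|lborel. indicator punctured x *\<^sub>R f (x /\<^sub>R norm x))"
proof -
  let ?R = "restrict_space lborel (punctured :: (real^'n) set)"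
  let ?S = "restrict_space borel (sphere 0 1 :: (real^'n) set)"
  let ?D = "distr ?R ?S (\<lambda>x. x /\<^sub>R norm x)"
  have fS: "f \<in> borel_measurable ?S" by (rule measurable_restrict_space1[OF f])
  have "sphere_measure = density ?D (\<lambda>_. ennreal (real CARD('n)))"
    unfolding sphere_measure_def measure_scale_eq_density by (simp add: ennreal_of_nat_eq_real_of_nat)
  then have "(LINT x|sphere_measure. f x) = (LINT x|density ?D (\<lambda>_. ennreal (real CARD('n))). f x)"
    by (rule arg_cong)
  also have "\<dots> = (LINT x|?D. real CARD('n) *\<^sub>R f x)"
    using fS by (intro integral_density) auto
  also have "\<dots> = real CARD('n) * (LINT x|?D. f x)" by simp
  also have "(LINT x|?D. f x) = (LINT x|?R. f (x /\<^sub>R norm x))"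
    by (rule integral_distr[OF radial_measurable_sphere fS])
  also have "\<dots> = (LINT x|lborel. indicator punctured x *\<^sub>R f (x /\<^sub>R norm x))"
    by (rule integral_restrict_space) simp
  finally show ?thesis .
qed

lemma continuous_sphere_integrable:
  fixes f :: "real^'n \<Rightarrow> real"
  assumes "continuous_on UNIV f"
  shows "integrable lborel (\<lambda>x. indicator punctured x *\<^sub>R f (x /\<^sub>R norm x))"
proof -
  have "compact (f ` sphere 0 1)"
    by (rule compact_continuous_image[OF continuous_on_subset[OF assms]]) auto
  then have "bounded (f ` sphere 0 1)" by (rule compact_imp_bounded)
  then obtain C where "\<forall>y\<in>f ` sphere 0 1. norm y \<le> C"
    unfolding bounded_iff by blast
  then have C: "\<bar>f x\<bar> \<le> C" if "x \<in> sphere 0 1" for x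
    using that by simp
  show ?thesis
  proof (rule integrable_bounded_region)
    show "(\<lambda>x. f (x /\<^sub>R norm x)) \<in> borel_measurable borel"
      using measurable_compose[OF radial_measurable borel_measurable_continuous_onI[OF assms]] .
    show "\<bar>f (x /\<^sub>R norm x)\<bar> \<le> C" if "x \<in> punctured" for x
      using that by (intro C) simp
  qed auto
qed

lemma LINT_sphere_add:
  fixes f g :: "real^'n \<Rightarrow> real"
  assumes "continuous_on UNIV f" "continuous_on UNIV g"
  shows "(LINT x|sphere_measure. f x + g x) = (LINT x|sphere_measure. f x) + (LINT x|sphere_measure. g x)"
proof -
  have fg: "continuous_on UNIV (\<lambda>x. f x + g x)" by (intro continuous_intros assms)
  show ?thesis
    using continuous_sphere_integrable[OF assms(1)] continuous_sphere_integrable[OF assms(2)]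
    by (simp add: LINT_sphere borel_measurable_continuous_onI[OF assms(1)]
      borel_measurable_continuous_onI[OF assms(2)] borel_measurable_continuous_onI[OF fg]
      distrib_left)
qed

text \<open>\<open>T\<close> preserves the punctured ball and commutes with radial projection, so
  invariance of Lebesgue measure carries over.\<close>

lemma LINT_sphere_orthogonal:
  fixes f :: "real^'n \<Rightarrow> real" and T :: "real^'n \<Rightarrow> real^'n"
  assumes f: "continuous_on UNIV f" and T: "orthogonal_transformation T"
  shows "(LINT x|sphere_measure. f (T x)) = (LINT x|sphere_measure. f x)"
proof -
  have fT: "continuous_on UNIV (\<lambda>x. f (T x))"
    by (rule continuous_on_compose2[OF f orthogonal_continuous[OF T]]) simp
  have lT: "linear T" by (rule orthogonal_transformation_linear[OF T])
  have nT: "norm (T x) = norm x" for x by (rule orthogonal_transformation_norm[OF T])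
  let ?g = "\<lambda>x::real^'n. indicator punctured x *\<^sub>R f (x /\<^sub>R norm x)"
  have i: "indicator punctured x = (indicator punctured (T x) :: real)" for x
  proof -
    have "T x = 0 \<longleftrightarrow> x = 0" using nT[of x] norm_eq_zero by metis
    then show ?thesis by (simp add: indicator_def nT)
  qed
  have "?g \<in> borel_measurable borel"
    using measurable_compose[OF radial_measurable borel_measurable_continuous_onI[OF f]]
    by (intro borel_measurable_scaleR borel_measurable_indicator) auto
  then have "(LINT x|lborel. ?g (T x)) = (LINT x|lborel. ?g x)"
    by (rule integral_lborel_orthogonal[OF T])
  moreover have "?g (T x) = indicator punctured x *\<^sub>R f (T (x /\<^sub>R norm x))" for x
    unfolding i[of x] by (simp add: linear_scale[OF lT] nT)
  ultimately show ?thesis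
    by (simp add: LINT_sphere borel_measurable_continuous_onI[OF f] borel_measurable_continuous_onI[OF fT])
qed

lemma LINT_sphere_pos:
  fixes f :: "real^'n \<Rightarrow> real"
  assumes f: "continuous_on UNIV f" and nn: "\<And>x. f x \<ge> 0" and x: "norm x = 1" "f x \<noteq> 0"
  shows "(LINT x|sphere_measure. f x) > 0"
proof -
  let ?g = "\<lambda>x. f (x /\<^sub>R norm x)"
  have nneg: "(LINT x|lborel. indicator punctured x *\<^sub>R ?g x) \<ge> 0"
    using nn by (intro integral_nonneg_AE) (auto simp: indicator_def)
  moreover have "(LINT x|lborel. indicator punctured x *\<^sub>R ?g x) \<noteq> 0"
  proof
    assume 0: "(LINT x|lborel. indicator punctured x *\<^sub>R ?g x) = 0"
    \<comment> \<open>The point \<open>x\<close> lies on the boundary of the open ball; half of it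
      lies inside and the radial extension has the same value there.\<close>
    have "?g (x /\<^sub>R 2) = 0"
    proof (rule integral_open_eq_0_imp[OF continuous_sphere_integrable[OF f] _ _ _ 0])
      show "open (punctured :: (real^'n) set)" by (intro open_Diff) auto
      have "continuous_on punctured (\<lambda>x::real^'n. x /\<^sub>R norm x)"
        by (intro continuous_intros) simp
      then show "continuous_on punctured ?g"
        by (rule continuous_on_compose2[OF f]) simp
      have "x \<noteq> 0" using x(1) by auto
      then show "x /\<^sub>R 2 \<in> punctured" using x(1) by simp
    qed (use nn in auto)
    then show False using x by simp
  qed
  ultimately show ?thesis
    by (simp add: LINT_sphere borel_measurable_continuous_onI[OF f] less_le)
qed

lemma measure_sphere_pos: "measure (sphere_measure :: (real^'n) measure) (sphere 0 1) > 0"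
  and LINT_sphere_const: "(LINT x|(sphere_measure :: (real^'n) measure). c) = c * measure (sphere_measure :: (real^'n) measure) (sphere 0 1)"
proof -
  have sp: "space (sphere_measure :: (real^'n) measure) = sphere 0 1"
    by (simp add: sphere_measure_def space_scale_measure space_restrict_space)
  have m: "(LINT x|(sphere_measure :: (real^'n) measure). c) = c * measure (sphere_measure :: (real^'n) measure) (sphere 0 1)" for c
    by (subst lebesgue_integral_const) (simp add: sp)
  obtain x :: "real^'n" where "norm x = 1" using vector_choose_size[of 1] by auto
  then have "(LINT x|(sphere_measure :: (real^'n) measure). (1::real)) > 0"
    by (intro LINT_sphere_pos[where x = x]) auto
  then show "measure (sphere_measure :: (real^'n) measure) (sphere 0 1) > 0"
    using m[of 1] by simp
  show "(LINT x|(sphere_measure :: (real^'n) measure). c) = c * measure (sphere_measure :: (real^'n) measure) (sphere 0 1)"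
    by (rule m)
qed

section \<open>Parseval's identity and Riesz representation in finite dimension\<close>

context fin_ip
begin

lemma ip_sum_right:
  assumes "\<And>i. i \<in> I \<Longrightarrow> f i \<in> V" "h \<in> V"
  shows "ip h (\<Sum>i\<in>I. c i *\<^sub>R f i) = (\<Sum>i\<in>I. c i * ip h (f i))"
proof -
  have "(\<Sum>i\<in>I. c i *\<^sub>R f i) \<in> V"
    using assms V by (intro subspace_sum subspace_scale) auto
  then have "ip h (\<Sum>i\<in>I. c i *\<^sub>R f i) = ip (\<Sum>i\<in>I. c i *\<^sub>R f i) h"
    using assms(2) by (intro ip_sym)
  also have "\<dots> = (\<Sum>i\<in>I. c i * ip (f i) h)" by (rule ip_sum[OF assms])
  also have "\<dots> = (\<Sum>i\<in>I. c i * ip h (f i))"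
    using assms by (intro sum.cong refl) (simp add: ip_sym)
  finally show ?thesis .
qed

lemma onbasis_mem: "onbasis H \<Longrightarrow> h \<in> H \<Longrightarrow> h \<in> V"
  by (auto simp: onbasis_def onset_def)

lemma onbasis_finite: "onbasis H \<Longrightarrow> finite H"
  by (auto simp: onbasis_def onset_def)

lemma onbasis_expand: "onbasis H \<Longrightarrow> f \<in> V \<Longrightarrow> (\<Sum>h\<in>H. ip f h *\<^sub>R h) = f"
  by (simp add: onbasis_def)

lemma onbasis_norm: "onbasis H \<Longrightarrow> h \<in> H \<Longrightarrow> ip h h = 1"
  by (auto simp: onbasis_def onset_def)

lemma parseval:
  assumes "onbasis H" "f \<in> V" "g \<in> V"
  shows "(\<Sum>h\<in>H. ip f h * ip h g) = ip f g"
proof -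
  have "ip f g = ip (\<Sum>h\<in>H. ip f h *\<^sub>R h) g"
    by (simp add: onbasis_expand assms)
  also have "\<dots> = (\<Sum>h\<in>H. ip f h * ip h g)"
    by (rule ip_sum) (use assms onbasis_mem in auto)
  finally show ?thesis ..
qed

text \<open>Linearity is required on \<open>V\<close> only, since operators in
  \<open>harmonic_Hom\<close> are arbitrary outside the harmonic polynomials.\<close>

definition functional :: "('a \<Rightarrow> real) \<Rightarrow> bool" where
  "functional l \<longleftrightarrow> (\<forall>f\<in>V. \<forall>g\<in>V. l (f + g) = l f + l g) \<and> (\<forall>c. \<forall>f\<in>V. l (c *\<^sub>R f) = c * l f)"

lemma functional_sum:
  assumes "functional l" "\<And>i. i \<in> I \<Longrightarrow> f i \<in> V"
  shows "l (\<Sum>i\<in>I. c i *\<^sub>R f i) = (\<Sum>i\<in>I. c i * l (f i))"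
proof -
  have "l (0 *\<^sub>R (0::'a)) = 0 * l 0"
    using assms(1) subspace_0[OF V] unfolding functional_def by blast
  then have l0: "l 0 = 0" by simp
  show ?thesis
    using assms(2)
  proof (induct I rule: infinite_finite_induct)
    case (insert i I)
    then have "(\<Sum>i\<in>I. c i *\<^sub>R f i) \<in> V" "c i *\<^sub>R f i \<in> V" "f i \<in> V"
      using V by (auto intro!: subspace_sum subspace_scale)
    then show ?case
      using insert assms(1) by (simp add: functional_def)
  qed (simp_all add: l0)
qed

lemma riesz:
  assumes "functional l"
  shows "\<exists>r\<in>V. \<forall>f\<in>V. ip f r = l f"
proof -
  obtain H where H: "onbasis H" using ex_onbasis by blast
  define r where "r = (\<Sum>h\<in>H. l h *\<^sub>R h)"
  have "r \<in> V" unfolding r_def using V onbasis_mem[OF H] by (intro subspace_sum subspace_scale) auto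
  moreover have "ip f r = l f" if f: "f \<in> V" for f
  proof -
    have "ip f r = (\<Sum>h\<in>H. l h * ip f h)"
      unfolding r_def using onbasis_mem[OF H] f by (intro ip_sum_right) auto
    also have "\<dots> = l (\<Sum>h\<in>H. ip f h *\<^sub>R h)"
      using functional_sum[OF assms, of H "\<lambda>h. h" "ip f"] onbasis_mem[OF H] by (simp add: mult.commute)
    finally show ?thesis by (simp add: onbasis_expand[OF H f])
  qed
  ultimately show ?thesis by blast
qed

lemma ip_eqI_right:
  assumes "f \<in> V" "g \<in> V" "\<And>h. h \<in> V \<Longrightarrow> ip h f = ip h g"
  shows "f = g"
  by (rule ip_eqI[OF assms(1,2)]) (use assms ip_sym in metis)

end

section \<open>The reproducing kernel of the harmonic polynomials\<close>

lemma unit_factor: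
  fixes y :: "real^'n"
  obtains u where "norm u = 1" "y = norm y *\<^sub>R u"
proof -
  obtain e :: "real^'n" where "norm e = 1" using vector_choose_size[of 1] by auto
  then show ?thesis
    by (intro that[of "if y = 0 then e else y /\<^sub>R norm y"]) simp_all
qed

lemma harmonic_nonzero_unit:
  fixes h :: "real^'n \<Rightarrow> real"
  assumes "h \<in> \<H> p" "h \<noteq> (\<lambda>_. 0)"
  obtains u where "norm u = 1" "h u \<noteq> 0"
proof -
  obtain x where x: "h x \<noteq> 0" using assms(2) by auto
  obtain u where u: "norm u = 1" "x = norm x *\<^sub>R u" by (rule unit_factor)
  have "h (norm x *\<^sub>R u) = norm x ^ p * h u" by (rule harmonic_homog[OF assms(1)])
  then show ?thesis using x u that[of u] by auto
qed

lemma harmonic_continuous: "h \<in> \<H> p \<Longrightarrow> continuous_on S h"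
  by (rule poly_continuous[OF harmonic_poly])

lemma dim_harmonic_pos:
  fixes h :: "real^'n \<Rightarrow> real"
  assumes "h \<in> \<H> p" "h \<noteq> 0"
  shows "dim (\<H> p :: (real^'n \<Rightarrow> real) set) > 0"
proof -
  obtain S where S: "finite S" "(\<H> p :: (real^'n \<Rightarrow> real) set) \<subseteq> span S" using harmonic_finite_dim by blast
  obtain B where B: "B \<subseteq> (\<H> p :: (real^'n \<Rightarrow> real) set)" "independent B" "\<H> p \<subseteq> span B"
    "card B = dim (\<H> p :: (real^'n \<Rightarrow> real) set)"
    using basis_exists[of "\<H> p :: (real^'n \<Rightarrow> real) set"] by blast
  have "finite B" using independent_span_bound[OF S(1) B(2)] B(1) S(2) by blast
  moreover have "B \<noteq> {}" using B(3) assms by auto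
  ultimately show ?thesis using B(4) by (metis card_gt_0_iff)
qed

text \<open>Positive definiteness rests on homogeneity, which moves a nonzero value to the sphere,
  and on the factor dim/vol being positive as soon as a nonzero harmonic polynomial exists.\<close>

interpretation harm: fin_ip "\<H> p :: (real^'n \<Rightarrow> real) set" "harmonic_inner p" for p
proof
  let ?k = "real (dim (\<H> p :: (real^'n \<Rightarrow> real) set)) / measure (sphere_measure :: (real^'n) measure) (sphere 0 1)"
  note c = continuous_on_mult[OF harmonic_continuous harmonic_continuous]
  show "subspace (\<H> p :: (real^'n \<Rightarrow> real) set)" by (rule subspace_harmonic)
  show "\<exists>S. finite S \<and> (\<H> p :: (real^'n \<Rightarrow> real) set) \<subseteq> span S" by (rule harmonic_finite_dim)
  fix f g h :: "real^'n \<Rightarrow> real"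
  show "harmonic_inner p f g = harmonic_inner p g f"
    by (simp add: harmonic_inner_def mult.commute)
  assume f: "f \<in> \<H> p"
  {
    assume g: "g \<in> \<H> p" and h: "h \<in> \<H> p"
    have "(LINT x|sphere_measure. (f + g) x * h x) = (LINT x|sphere_measure. f x * h x) + (LINT x|sphere_measure. g x * h x)"
      using LINT_sphere_add[OF c[OF f h] c[OF g h]] by (simp add: distrib_right)
    then show "harmonic_inner p (f + g) h = harmonic_inner p f h + harmonic_inner p g h"
      by (simp add: harmonic_inner_def distrib_left)
  }
  show "harmonic_inner p (r *\<^sub>R f) h = r * harmonic_inner p f h" for r
    by (simp add: harmonic_inner_def scaleR_fun_def mult.assoc)
  assume ne: "f \<noteq> 0"
  then have "f \<noteq> (\<lambda>_. 0)" by (simp add: zero_fun_def)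
  then obtain u where u: "norm u = 1" "f u \<noteq> 0" using harmonic_nonzero_unit[OF f] by blast
  have "(LINT x|sphere_measure. f x * f x) > 0"
    by (rule LINT_sphere_pos[OF c[OF f f] _ u(1)]) (use u in auto)
  moreover have "?k > 0"
    by (rule divide_pos_pos) (use dim_harmonic_pos[OF f ne] measure_sphere_pos in auto)
  ultimately show "harmonic_inner p f f > 0"
    unfolding harmonic_inner_def by (intro mult_pos_pos)
qed

lemma harmonic_inner_orthogonal:
  fixes T :: "real^'n \<Rightarrow> real^'n"
  assumes "f \<in> \<H> p" "g \<in> \<H> p" "orthogonal_transformation T"
  shows "harmonic_inner p (\<lambda>x. f (T x)) (\<lambda>x. g (T x)) = harmonic_inner p f g"
  unfolding harmonic_inner_def
  using LINT_sphere_orthogonal[OF continuous_on_mult[OF harmonic_continuous[OF assms(1)] harmonic_continuous[OF assms(2)]] assms(3)]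
  by simp

lemma harmonic_inner_move:
  fixes T :: "real^'n \<Rightarrow> real^'n"
  assumes "f \<in> \<H> p" "g \<in> \<H> p" "orthogonal_transformation T"
  shows "harmonic_inner p (\<lambda>x. f (T x)) g = harmonic_inner p f (\<lambda>x. g (inv T x))"
proof -
  have iT: "orthogonal_transformation (inv T)" by (rule orthogonal_transformation_inv[OF assms(3)])
  have "inv T (T x) = x" for x
    by (rule inv_f_f[OF orthogonal_transformation_inj[OF assms(3)]])
  then show ?thesis
    using harmonic_inner_orthogonal[OF assms(1) harmonic_orthogonal[OF assms(2) iT] assms(3)] by simp
qed

lemma eval_functional: "harm.functional p (\<lambda>f. f x)"
  by (simp add: harm.functional_def scaleR_fun_def)

text \<open>The reproducing kernel of H_p: the Riesz representative of evaluation at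
  \<open>x\<close>, that is, the zonal harmonic with pole \<open>x\<close>.\<close>

definition zonal :: "nat \<Rightarrow> real^'n \<Rightarrow> real^'n \<Rightarrow> real" where
  "zonal p x = (SOME k. k \<in> \<H> p \<and> (\<forall>f\<in>\<H> p. harmonic_inner p f k = f x))"

lemma zonal_mem: "zonal p x \<in> \<H> p"
  and zonal_reproduce: "f \<in> \<H> p \<Longrightarrow> harmonic_inner p f (zonal p x) = f x"
proof -
  have "\<exists>k. k \<in> \<H> p \<and> (\<forall>f\<in>\<H> p. harmonic_inner p f k = f x)"
    using harm.riesz[OF eval_functional] by blast
  from someI_ex[OF this] show "zonal p x \<in> \<H> p" "f \<in> \<H> p \<Longrightarrow> harmonic_inner p f (zonal p x) = f x"
    unfolding zonal_def by blast+
qed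

lemma zonal_basis:
  assumes "harm.onbasis p H"
  shows "zonal p x y = (\<Sum>h\<in>H. h x * h y)"
proof -
  have "zonal p x y = (\<Sum>h\<in>H. harmonic_inner p (zonal p x) h *\<^sub>R h) y"
    by (simp add: harm.onbasis_expand[OF assms zonal_mem])
  also have "\<dots> = (\<Sum>h\<in>H. harmonic_inner p (zonal p x) h * h y)"
    by (simp add: sum_fun_apply scaleR_fun_def)
  also have "\<dots> = (\<Sum>h\<in>H. h x * h y)"
  proof (rule sum.cong[OF refl])
    fix h assume "h \<in> H"
    then have "h \<in> \<H> p" by (rule harm.onbasis_mem[OF assms])
    then show "harmonic_inner p (zonal p x) h * h y = h x * h y"
      using harm.ip_sym[OF zonal_mem, of h p x] zonal_reproduce[of h p x] by simp
  qed
  finally show ?thesis .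
qed

lemma zonal_sym: "zonal p x y = zonal p y x"
  using harm.ex_onbasis[of p] zonal_basis by (metis (no_types, lifting) mult.commute sum.cong)

text \<open>The scalar product is invariant, so the rotated kernel still represents evaluation at
  \<open>x\<close>, and representatives are unique.\<close>

lemma zonal_orthogonal:
  fixes T :: "real^'n \<Rightarrow> real^'n"
  assumes T: "orthogonal_transformation T"
  shows "zonal p (T x) (T y) = zonal p x y"
proof -
  have "(\<lambda>y. zonal p (T x) (T y)) = zonal p x"
  proof (rule harm.ip_eqI_right[OF harmonic_orthogonal[OF zonal_mem T] zonal_mem])
    fix f :: "real^'n \<Rightarrow> real" assume f: "f \<in> \<H> p"
    have iT: "orthogonal_transformation (inv T)" by (rule orthogonal_transformation_inv[OF T])
    have TT: "inv T (T x) = x" for x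
      by (rule inv_f_f[OF orthogonal_transformation_inj[OF T]])
    have fi: "(\<lambda>y. f (inv T y)) \<in> \<H> p" by (rule harmonic_orthogonal[OF f iT])
    have "harmonic_inner p f (\<lambda>y. zonal p (T x) (T y)) = harmonic_inner p (\<lambda>y. f (inv T y)) (zonal p (T x))"
      using harmonic_inner_orthogonal[OF fi zonal_mem T] by (simp add: TT)
    also have "\<dots> = f x" by (simp add: zonal_reproduce[OF fi] TT)
    finally show "harmonic_inner p f (\<lambda>y. zonal p (T x) (T y)) = harmonic_inner p f (zonal p x)"
      by (simp add: zonal_reproduce[OF f])
  qed
  then show ?thesis by metis
qed

lemma zonal_homog1: "zonal p (t *\<^sub>R x) y = t ^ p * zonal p x y"
  using harmonic_homog[OF zonal_mem, of p y t x] by (simp add: zonal_sym[of p _ y])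

lemma LINT_sphere_sum:
  fixes f :: "'i \<Rightarrow> real^'n \<Rightarrow> real"
  assumes "finite I" "\<And>i. i \<in> I \<Longrightarrow> continuous_on UNIV (f i)"
  shows "(LINT x|sphere_measure. (\<Sum>i\<in>I. f i x)) = (\<Sum>i\<in>I. LINT x|sphere_measure. f i x)"
  using assms
proof (induct I rule: finite_induct)
  case (insert i I)
  then have "continuous_on UNIV (f i)" "continuous_on UNIV (\<lambda>x. \<Sum>i\<in>I. f i x)"
    by (auto intro!: continuous_on_sum)
  then show ?case using insert by (simp add: LINT_sphere_add)
qed simp

text \<open>Transitivity makes the diagonal value constant on the sphere. In an orthonormal basis of
  dim elements each square integrates to vol/dim, so the diagonal integrates to vol and the constant
  is 1; this is what the factor dim/vol is for.\<close>

lemma zonal_diag_unit: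
  fixes x :: "real^'n"
  assumes nz: "\<exists>h::real^'n \<Rightarrow> real. h \<in> \<H> p \<and> h \<noteq> 0" and x: "norm x = 1"
  shows "zonal p x x = 1"
proof -
  let ?vol = "measure (sphere_measure :: (real^'n) measure) (sphere 0 1)"
  let ?d = "real (dim (\<H> p :: (real^'n \<Rightarrow> real) set))"
  have vol: "?vol > 0" by (rule measure_sphere_pos)
  have d: "?d > 0" using nz dim_harmonic_pos by auto
  obtain H where H: "harm.onbasis p (H :: (real^'n \<Rightarrow> real) set)" using harm.ex_onbasis by blast
  have const: "zonal p y y = zonal p x x" if "norm y = 1" for y :: "real^'n"
  proof -
    have "norm x = norm y" using that x by simp
    then obtain T where T: "orthogonal_transformation T" "T x = y"
      by (rule orthogonal_transformation_exists)
    show ?thesis using zonal_orthogonal[OF T(1), of p x x] T(2) by simp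
  qed
  have meas: "(\<lambda>y. zonal p y y) = (\<lambda>y. \<Sum>h\<in>H. h y * h y)"
    by (rule ext) (rule zonal_basis[OF H])
  have hc: "continuous_on UNIV (\<lambda>y. h y * h y)" if "h \<in> H" for h
    using harmonic_continuous[OF harm.onbasis_mem[OF H that]] by (intro continuous_on_mult)
  have "(LINT y|(sphere_measure :: (real^'n) measure). zonal p y y) = (\<Sum>h\<in>H. LINT y|sphere_measure. h y * h y)"
    unfolding meas by (rule LINT_sphere_sum[OF harm.onbasis_finite[OF H] hc])
  also have "\<dots> = (\<Sum>h\<in>H. ?vol / ?d)"
  proof (rule sum.cong[OF refl])
    fix h assume "h \<in> H"
    have "?d / ?vol * (LINT y|sphere_measure. h y * h y) = 1"
      using harm.onbasis_norm[OF H \<open>h \<in> H\<close>] unfolding harmonic_inner_def .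
    moreover have "I = v / r" if "r / v * I = 1" "v > 0" "r > 0" for I v r :: real
      using that by (simp add: field_simps)
    ultimately show "(LINT y|sphere_measure. h y * h y) = ?vol / ?d"
      using vol d by blast
  qed
  also have "\<dots> = ?vol" using d by (simp add: harm.onbasis_card[OF H])
  also have "(LINT y|(sphere_measure :: (real^'n) measure). zonal p y y) = (LINT y|(sphere_measure :: (real^'n) measure). zonal p x x)"
    by (rule Bochner_Integration.integral_cong)
      (auto simp: sphere_measure_def space_scale_measure space_restrict_space const)
  also have "\<dots> = zonal p x x * ?vol" by (rule LINT_sphere_const)
  finally show ?thesis using vol by simp
qed

text \<open>Riesz representation gives existence and definiteness gives uniqueness, so the definite
  description of the adjoint is justified.\<close>

lemma adjoint_props:
  fixes h' :: "real^'n \<Rightarrow> real"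
  assumes A: "A \<in> harmonic_Hom p q" and h': "h' \<in> \<H> q"
  shows "harmonic_adjoint p q A h' \<in> \<H> p"
    and "h \<in> \<H> p \<Longrightarrow> harmonic_inner q (A h) h' = harmonic_inner p h (harmonic_adjoint p q A h')"
proof -
  let ?P = "\<lambda>g. g \<in> \<H> p \<and> (\<forall>h\<in>\<H> p. harmonic_inner q (A h) h' = harmonic_inner p h g)"
  have "harm.functional p (\<lambda>h. harmonic_inner q (A h) h')"
    using A h' by (auto simp: harm.functional_def harmonic_Hom_def harm.ip_add harm.ip_scale)
  from harm.riesz[OF this] obtain g where "g \<in> \<H> p"
    "\<forall>h\<in>\<H> p. harmonic_inner p h g = harmonic_inner q (A h) h'" by blast
  then have g: "?P g" by simp
  have "?P (THE g. ?P g)"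
  proof (rule theI[of ?P, OF g])
    fix g' assume "?P g'"
    then show "g' = g" using g by (intro harm.ip_eqI_right[of g' p g]) auto
  qed
  then show "harmonic_adjoint p q A h' \<in> \<H> p"
    and "h \<in> \<H> p \<Longrightarrow> harmonic_inner q (A h) h' = harmonic_inner p h (harmonic_adjoint p q A h')"
    unfolding harmonic_adjoint_def by blast+
qed

section \<open>Equivariant maps into Hom(H_p, H_q)\<close>

lemma rot_matrix: "rotation_matrix a \<longleftrightarrow> rotation ((*v) (a :: real^'n^'n))"
proof -
  have "orthogonal_matrix a \<longleftrightarrow> orthogonal_transformation ((*v) a)"
    unfolding orthogonal_transformation_matrix matrix_of_matrix_vector_mul
    using matrix_vector_mul_linear by blast
  then show ?thesis
    by (simp add: rotation_matrix_def rotation_def)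
qed

lemma rot_orthogonal: "rotation T \<Longrightarrow> orthogonal_transformation T"
  by (simp add: rotation_def)

lemma rot_inv_left: "rotation T \<Longrightarrow> inv T (T x) = x"
  using orthogonal_transformation_inj[of T] by (simp add: rotation_def)

lemma rot_inv_right: "rotation T \<Longrightarrow> T (inv T x) = x"
  using orthogonal_right_inverse[of T] by (simp add: rotation_def)

lemma rot_inv:
  assumes "rotation T"
  shows "rotation (inv T)"
proof -
  have o: "orthogonal_transformation (inv T)"
    by (rule orthogonal_transformation_inv[OF rot_orthogonal[OF assms]])
  have lin: "linear T" "linear (inv T)"
    using o rot_orthogonal[OF assms] by (auto intro: orthogonal_transformation_linear)
  have id: "T \<circ> inv T = id" using rot_inv_right[OF assms] by auto
  have "det (matrix (T \<circ> inv T)) = det (matrix T) * det (matrix (inv T))"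
    unfolding matrix_compose[OF lin(2) lin(1)] by (rule det_mul)
  then have "det (matrix T) * det (matrix (inv T)) = 1"
    unfolding id matrix_id by (rule sym)
  then show ?thesis using o assms by (simp add: rotation_def)
qed

lemma orthonormal_basis_parseval:
  fixes U V :: "'w::euclidean_space"
  assumes "orthonormal_basis B"
  shows "(\<Sum>e\<in>B. (U \<bullet> e) * (V \<bullet> e)) = U \<bullet> V"
proof -
  have "V = (\<Sum>e\<in>B. (V \<bullet> e) *\<^sub>R e)"
    using assms orthonormal_basis_expand[of B V] pairwise_orthogonal_imp_finite[of B]
    unfolding orthonormal_basis_def by auto
  then have "U \<bullet> V = U \<bullet> (\<Sum>e\<in>B. (V \<bullet> e) *\<^sub>R e)" by simp
  then show ?thesis by (simp add: inner_sum_right mult.commute)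
qed

lemma linear_functional_inner:
  fixes u :: "'w::euclidean_space \<Rightarrow> real"
  assumes "linear u"
  obtains U where "\<And>e. u e = U \<bullet> e"
proof
  fix e :: 'w
  have "u e = u (\<Sum>b\<in>Basis. (e \<bullet> b) *\<^sub>R b)" by (simp add: euclidean_representation)
  also have "\<dots> = (\<Sum>b\<in>Basis. u b * (b \<bullet> e))"
    by (simp add: linear_sum[OF assms] linear_scale[OF assms] inner_commute mult.commute)
  also have "\<dots> = (\<Sum>b\<in>Basis. u b *\<^sub>R b) \<bullet> e"
    by (simp add: inner_sum_left)
  finally show "u e = (\<Sum>b\<in>Basis. u b *\<^sub>R b) \<bullet> e" .
qed

text \<open>Writing \<open>u\<close> and \<open>v\<close> as inner products with vectors
  \<open>U\<close> and \<open>V\<close> turns both sums into \<open>U \<bullet> V\<close> by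
  Parseval, since \<sigma> can be moved to the other side.\<close>

lemma trace_invariant:
  fixes \<sigma> :: "'w::euclidean_space \<Rightarrow> 'w"
  assumes B: "orthonormal_basis B" and \<sigma>: "orthogonal_transformation \<sigma>"
    and u: "linear u" and v: "linear (v :: 'w \<Rightarrow> real)"
  shows "(\<Sum>e\<in>B. u (\<sigma> e) * v (\<sigma> e)) = (\<Sum>e\<in>B. u e * v e)"
proof -
  obtain U where U: "\<And>e. u e = U \<bullet> e" using linear_functional_inner[OF u] by blast
  obtain V where V: "\<And>e. v e = V \<bullet> e" using linear_functional_inner[OF v] by blast
  have move: "X \<bullet> \<sigma> e = inv \<sigma> X \<bullet> e" for X e
  proof -
    have "\<sigma> (inv \<sigma> X) \<bullet> \<sigma> e = inv \<sigma> X \<bullet> e"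
      using \<sigma> by (simp add: orthogonal_transformation_def)
    then show ?thesis by (simp add: orthogonal_right_inverse[OF \<sigma>])
  qed
  have "inv \<sigma> U \<bullet> inv \<sigma> V = U \<bullet> V"
    using orthogonal_transformation_inv[OF \<sigma>] by (simp add: orthogonal_transformation_def)
  then show ?thesis
    unfolding U V move by (simp add: orthonormal_basis_parseval[OF B])
qed

lemma matrix_inv_eqI:
  fixes a b :: "real^'n^'n"
  assumes "a ** b = mat 1" "b ** a = mat 1"
  shows "matrix_inv a = b"
proof -
  have "\<exists>c. a ** c = mat 1 \<and> c ** a = mat 1" using assms by blast
  from someI_ex[OF this] have "a ** matrix_inv a = mat 1" unfolding matrix_inv_def by blast
  then have "b ** (a ** matrix_inv a) = b" by simp
  then show ?thesis by (simp add: matrix_mul_assoc assms(2))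
qed

locale equivariant_hom =
  fixes p q :: nat and \<rho> :: "real^'n^'n \<Rightarrow> 'w::euclidean_space \<Rightarrow> 'w"
    and D :: "'w \<Rightarrow> (real^'n \<Rightarrow> real) \<Rightarrow> (real^'n \<Rightarrow> real)" and B :: "'w set"
  assumes N: "CARD('n) \<ge> 2" and \<rho>: "orthogonal_SO_module \<rho>"
    and D: "module_hom_to_Hom p q \<rho> D" and D_nz: "\<exists>e. \<exists>h\<in>\<H> p. D e h \<noteq> 0"
    and B: "orthonormal_basis B"
begin

lemma finB: "finite B"
  using B pairwise_orthogonal_imp_finite unfolding orthonormal_basis_def by blast

lemma D_Hom: "D e \<in> harmonic_Hom p q"
  using D by (simp add: module_hom_to_Hom_def)

lemma D_mem: "h \<in> \<H> p \<Longrightarrow> D e h \<in> \<H> q"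
  using D_Hom[of e] by (simp add: harmonic_Hom_def)

lemma D_functional: "harm.functional p (\<lambda>h. D e h x)"
  using D_Hom[of e] by (simp add: harmonic_Hom_def harm.functional_def scaleR_fun_def)

lemma D_sum:
  assumes "\<And>i. i \<in> I \<Longrightarrow> f i \<in> \<H> p"
  shows "D e (\<lambda>x. \<Sum>i\<in>I. c i * f i x) x = (\<Sum>i\<in>I. c i * D e (f i) x)"
proof -
  have "(\<lambda>x. \<Sum>i\<in>I. c i * f i x) = (\<Sum>i\<in>I. c i *\<^sub>R f i)"
    by (simp add: fun_eq_iff sum_fun_apply scaleR_fun_def)
  then show ?thesis using harm.functional_sum[OF D_functional assms] by simp
qed

lemma D_linear: "h \<in> \<H> p \<Longrightarrow> linear (\<lambda>e. D e h x)"
proof -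
  assume "h \<in> \<H> p"
  then have "linear (\<lambda>e. D e h)" using D by (simp add: module_hom_to_Hom_def)
  then show ?thesis
    by (simp add: linear_iff scaleR_fun_def)
qed

text \<open>Equivariance rephrased without matrices: precomposing the polynomial with a rotation
  amounts to moving the evaluation point, at the cost of an isometry of the module.\<close>

lemma D_rot:
  assumes T: "rotation T"
  obtains \<sigma> where "orthogonal_transformation \<sigma>"
    "\<And>e g x. g \<in> \<H> p \<Longrightarrow> D (\<sigma> e) (\<lambda>y. g (T y)) x = D e g (T x)"
proof
  \<comment> \<open>\<open>rot_action\<close> composes with the inverse matrix, so the group element
    that acts by composition with \<open>T\<close> is the inverse of \<open>T\<close>.\<close>
  define a where "a = matrix (inv T)"
  have lT: "linear T" "linear (inv T)"
    using rot_orthogonal[OF T] rot_orthogonal[OF rot_inv[OF T]]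
    by (auto intro: orthogonal_transformation_linear)
  have av: "(*v) a = inv T" unfolding a_def by (rule matrix_vector_mul(2)[OF lT(2)])
  have ra: "rotation_matrix a" unfolding rot_matrix av by (rule rot_inv[OF T])
  have am: "a ** matrix T = mat 1" "matrix T ** a = mat 1"
  proof -
    have "inv T \<circ> T = id" "T \<circ> inv T = id" using rot_inv_left[OF T] rot_inv_right[OF T] by auto
    then show "a ** matrix T = mat 1" "matrix T ** a = mat 1"
      unfolding a_def matrix_compose[OF lT, symmetric] matrix_compose[OF lT(2) lT(1), symmetric]
      by (simp_all add: matrix_id_mat_1)
  qed
  have ia: "matrix_inv a = matrix T"
    by (rule matrix_inv_eqI[OF am])
  have iia: "matrix_inv (matrix T) = a"
    by (rule matrix_inv_eqI[OF am(2) am(1)])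
  have Tv: "matrix T *v x = T x" for x by (rule fun_cong[OF matrix_vector_mul(2)[OF lT(1)]])
  show "orthogonal_transformation (\<rho> a)"
    using \<rho> ra by (simp add: orthogonal_SO_module_def)
  fix e and g :: "real^'n \<Rightarrow> real" and x assume g: "g \<in> \<H> p"
  have gT: "(\<lambda>y. g (T y)) \<in> \<H> p" by (rule harmonic_orthogonal[OF g rot_orthogonal[OF T]])
  have "D (\<rho> a e) (\<lambda>y. g (T y)) = rot_action a (D e (rot_action (matrix_inv a) (\<lambda>y. g (T y))))"
    using D ra gT by (simp add: module_hom_to_Hom_def)
  also have "rot_action (matrix_inv a) (\<lambda>y. g (T y)) = g"
    by (simp add: rot_action_def ia iia av rot_inv_right[OF T])
  finally show "D (\<rho> a e) (\<lambda>y. g (T y)) x = D e g (T x)" by (simp add: rot_action_def ia Tv)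
qed

lemma D_trace:
  assumes "orthogonal_transformation \<sigma>" "f \<in> \<H> p" "g \<in> \<H> p"
  shows "(\<Sum>e\<in>B. D (\<sigma> e) f x * D (\<sigma> e) g y) = (\<Sum>e\<in>B. D e f x * D e g y)"
  by (rule trace_invariant[OF B assms(1) D_linear[OF assms(2)] D_linear[OF assms(3)]])

definition Hb :: "(real^'n \<Rightarrow> real) set" where
  "Hb = (SOME H. harm.onbasis p H)"

lemma Hb: "harm.onbasis p Hb"
  unfolding Hb_def using harm.ex_onbasis by (rule someI_ex)

lemma Hb_mem: "h \<in> Hb \<Longrightarrow> h \<in> \<H> p"
  by (rule harm.onbasis_mem[OF Hb])

lemma finHb: "finite Hb"
  by (rule harm.onbasis_finite[OF Hb])

text \<open>By Parseval both sides are scalar products of the Riesz representatives of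
  \<open>F\<close> and \<open>G\<close>, on the left after composing both with the inverse of
  \<open>T\<close>.\<close>

lemma functional_parseval_rot:
  fixes T :: "real^'n \<Rightarrow> real^'n"
  assumes F: "harm.functional p F" and G: "harm.functional p G" and T: "orthogonal_transformation T"
  shows "(\<Sum>h\<in>Hb. F (\<lambda>x. h (T x)) * G (\<lambda>x. h (T x))) = (\<Sum>h\<in>Hb. F h * G h)"
proof -
  obtain r where r: "r \<in> \<H> p" "\<And>f. f \<in> \<H> p \<Longrightarrow> harmonic_inner p f r = F f"
    using harm.riesz[OF F] by blast
  obtain s where s: "s \<in> \<H> p" "\<And>f. f \<in> \<H> p \<Longrightarrow> harmonic_inner p f s = G f"
    using harm.riesz[OF G] by blast
  have iT: "orthogonal_transformation (inv T)" by (rule orthogonal_transformation_inv[OF T])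
  let ?i = "\<lambda>f x. f (inv T x)"
  have ri: "?i r \<in> \<H> p" "?i s \<in> \<H> p" using harmonic_orthogonal[OF _ iT] r(1) s(1) by auto
  have pars: "(\<Sum>h\<in>Hb. harmonic_inner p h f * harmonic_inner p h g) = harmonic_inner p f g"
    if "f \<in> \<H> p" "g \<in> \<H> p" for f g
  proof -
    have "(\<Sum>h\<in>Hb. harmonic_inner p h f * harmonic_inner p h g) = (\<Sum>h\<in>Hb. harmonic_inner p f h * harmonic_inner p h g)"
      by (intro sum.cong refl) (simp add: harm.ip_sym[OF Hb_mem that(1)])
    then show ?thesis using harm.parseval[OF Hb that] by simp
  qed
  have "(\<Sum>h\<in>Hb. F (\<lambda>x. h (T x)) * G (\<lambda>x. h (T x))) = (\<Sum>h\<in>Hb. harmonic_inner p h (?i r) * harmonic_inner p h (?i s))"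
  proof (intro sum.cong refl)
    fix h assume "h \<in> Hb"
    then have h: "h \<in> \<H> p" by (rule Hb_mem)
    have hT: "(\<lambda>x. h (T x)) \<in> \<H> p" by (rule harmonic_orthogonal[OF h T])
    show "F (\<lambda>x. h (T x)) * G (\<lambda>x. h (T x)) = harmonic_inner p h (?i r) * harmonic_inner p h (?i s)"
      using r(2)[OF hT] s(2)[OF hT] harmonic_inner_move[OF h r(1) T] harmonic_inner_move[OF h s(1) T] by simp
  qed
  also have "\<dots> = harmonic_inner p (?i r) (?i s)" by (rule pars[OF ri])
  also have "\<dots> = harmonic_inner p r s" by (rule harmonic_inner_orthogonal[OF r(1) s(1) iT])
  also have "\<dots> = (\<Sum>h\<in>Hb. F h * G h)"
    using pars[OF r(1) s(1)] r(2)[OF Hb_mem] s(2)[OF Hb_mem] by simp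
  finally show ?thesis .
qed

text \<open>The integral kernel of the operator whose scalar value is c(D), namely the sum of D_e
  D_e^T over \<open>B\<close>.\<close>

definition \<gamma> :: "real^'n \<Rightarrow> real^'n \<Rightarrow> real" where
  "\<gamma> x y = (\<Sum>e\<in>B. \<Sum>h\<in>Hb. D e h x * D e h y)"

text \<open>Equivariance turns the rotation into \<sigma> on the module and composition with
  \<open>T\<close> on polynomials; the latter is absorbed by the basis of H_p and the former by the
  basis of \<open>'w\<close>.\<close>

lemma \<gamma>_rot:
  assumes T: "rotation T"
  shows "\<gamma> (T x) (T y) = \<gamma> x y"
proof -
  obtain \<sigma> where \<sigma>: "orthogonal_transformation \<sigma>"
    "\<And>e g x. g \<in> \<H> p \<Longrightarrow> D (\<sigma> e) (\<lambda>y. g (T y)) x = D e g (T x)"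
    using D_rot[OF T] by blast
  have "\<gamma> (T x) (T y) = (\<Sum>e\<in>B. \<Sum>h\<in>Hb. D (\<sigma> e) (\<lambda>y. h (T y)) x * D (\<sigma> e) (\<lambda>y. h (T y)) y)"
    unfolding \<gamma>_def by (intro sum.cong refl) (simp add: \<sigma>(2) Hb_mem)
  also have "\<dots> = (\<Sum>e\<in>B. \<Sum>h\<in>Hb. D (\<sigma> e) h x * D (\<sigma> e) h y)"
    by (intro sum.cong refl functional_parseval_rot D_functional rot_orthogonal[OF T])
  also have "\<dots> = (\<Sum>h\<in>Hb. \<Sum>e\<in>B. D (\<sigma> e) h x * D (\<sigma> e) h y)" by (rule sum.swap)
  also have "\<dots> = (\<Sum>h\<in>Hb. \<Sum>e\<in>B. D e h x * D e h y)"
    by (intro sum.cong refl D_trace[OF \<sigma>(1)] Hb_mem)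
  also have "\<dots> = \<gamma> x y" unfolding \<gamma>_def by (rule sum.swap)
  finally show ?thesis .
qed

lemma \<gamma>_sym: "\<gamma> x y = \<gamma> y x"
  by (simp add: \<gamma>_def mult.commute)

lemma \<gamma>_slice: "\<gamma> x \<in> \<H> q"
proof -
  have "\<gamma> x = (\<Sum>e\<in>B. \<Sum>h\<in>Hb. D e h x *\<^sub>R D e h)"
    by (simp add: fun_eq_iff \<gamma>_def sum_fun_apply scaleR_fun_def)
  also have "\<dots> \<in> \<H> q"
    by (intro subspace_sum subspace_scale subspace_harmonic D_mem Hb_mem)
  finally show ?thesis .
qed

text \<open>The base point is a coordinate axis because the vanishing theorem speaks of the
  stabiliser of such an axis.\<close>

definition unit0 :: "real^'n" where "unit0 = axis (SOME i. True) 1"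

definition c0 :: real where "c0 = \<gamma> unit0 unit0"

text \<open>Transitivity of the rotations, as opposed to all orthogonal maps, is where dimension at
  least 2 enters.\<close>

lemma unit_rot:
  assumes "norm x = 1"
  obtains T where "rotation T" "T unit0 = x"
proof -
  have "norm unit0 = norm x" using assms by (simp add: unit0_def)
  from rotation_exists[OF N this] obtain f where "orthogonal_transformation f" "det (matrix f) = 1" "f unit0 = x"
    by blast
  then show ?thesis using that by (simp add: rotation_def)
qed

lemma \<gamma>_diag_unit: "norm x = 1 \<Longrightarrow> \<gamma> x x = c0"
proof -
  assume "norm x = 1"
  then obtain T where "rotation T" "T unit0 = x" by (rule unit_rot)
  then show ?thesis using \<gamma>_rot[of T unit0 unit0] by (simp add: c0_def)
qed

lemma q_nz: "\<exists>h::real^'n \<Rightarrow> real. h \<in> \<H> q \<and> h \<noteq> 0"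
  using D_nz D_mem by blast

lemma p_nz: "\<exists>h::real^'n \<Rightarrow> real. h \<in> \<H> p \<and> h \<noteq> 0"
proof -
  obtain e h where eh: "h \<in> \<H> p" "D e h \<noteq> 0" using D_nz by blast
  have "h \<noteq> 0"
  proof
    assume "h = 0"
    then have "D e h x = 0" for x
      using D_sum[of "{}" "\<lambda>_. h" e "\<lambda>_. 0" x] by (simp add: zero_fun_def)
    with eh(2) show False by (simp add: fun_eq_iff)
  qed
  with eh(1) show ?thesis by blast
qed

text \<open>This replaces Schur's lemma: the difference of an invariant kernel and a suitable multiple of the
  reproducing kernel vanishes on the diagonal.\<close>

lemma \<gamma>_zonal: "\<gamma> x y = c0 * zonal q x y"
proof -
  define G where "G z = \<gamma> (fst z) (snd z) - c0 * zonal q (fst z) (snd z)" for z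
  obtain Hq where Hq: "harm.onbasis q (Hq :: (real^'n \<Rightarrow> real) set)" using harm.ex_onbasis by blast
  have pf: "poly_fun (\<lambda>z::(real^'n) \<times> (real^'n). f (fst z) * g (snd z))"
    if "f \<in> \<H> q" "g \<in> \<H> q" for f g :: "real^'n \<Rightarrow> real"
    by (intro poly_times poly_compose_linear[OF harmonic_poly[OF that(1)] bounded_linear_fst]
        poly_compose_linear[OF harmonic_poly[OF that(2)] bounded_linear_snd])
  have G_eq: "G z = (\<Sum>e\<in>B. \<Sum>h\<in>Hb. D e h (fst z) * D e h (snd z)) - c0 * (\<Sum>h\<in>Hq. h (fst z) * h (snd z))" for z
    by (simp add: G_def \<gamma>_def zonal_basis[OF Hq])
  have slice: "(\<lambda>x. G (x, y)) \<in> \<H> q" for y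
  proof -
    have "(\<lambda>x. G (x, y)) = \<gamma> y + (- c0) *\<^sub>R zonal q y"
      by (simp add: fun_eq_iff G_def \<gamma>_sym[of _ y] zonal_sym[of q _ y] scaleR_fun_def)
    then show ?thesis
      by (simp only: subspace_add[OF subspace_harmonic \<gamma>_slice subspace_scale[OF subspace_harmonic zonal_mem]])
  qed
  have "G = (\<lambda>_. 0)"
  proof (rule invariant_kernel_vanish[OF N])
    show "poly_fun G"
      unfolding G_eq[abs_def]
      by (intro real_polynomial_function_diff real_polynomial_function_sum finB finHb
          harm.onbasis_finite[OF Hq] poly_times[OF poly_of_const]
          pf D_mem Hb_mem harm.onbasis_mem[OF Hq])
    show "G (swap2 z) = G z" for z
      by (simp add: G_def \<gamma>_sym[of "snd z"] zonal_sym[of q "snd z"])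
    show "homog proj1 q G" by (rule homog_of_slices[OF slice])
    show "laplace lunit G z = 0" for z
      by (rule lap_of_slices[OF slice])
    show "G (y, y) = 0" for y
    proof -
      obtain u where u: "norm u = 1" "y = norm y *\<^sub>R u" by (rule unit_factor)
      have z: "G (u, u) = 0"
        by (simp add: G_def \<gamma>_diag_unit[OF u(1)] zonal_diag_unit[OF q_nz u(1)])
      have sy: "G (a, b) = G (b, a)" for a b
        by (simp add: G_def \<gamma>_sym[of a] zonal_sym[of q a])
      have "G (norm y *\<^sub>R u, u) = norm y ^ q * G (u, u)"
        by (rule harmonic_homog[OF slice])
      then have "G (norm y *\<^sub>R u, u) = 0" unfolding z by simp
      then have z': "G (u, norm y *\<^sub>R u) = 0" unfolding sy[of u] .
      have "G (norm y *\<^sub>R u, norm y *\<^sub>R u) = norm y ^ q * G (u, norm y *\<^sub>R u)"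
        by (rule harmonic_homog[OF slice])
      then show ?thesis unfolding z' unfolding u(2)[symmetric] by simp
    qed
    show "biinv i G" for i
      by (simp add: biinv_def G_def \<gamma>_rot zonal_orthogonal rot_orthogonal)
  qed
  then have "G (x, y) = 0" by simp
  then show ?thesis by (simp add: G_def)
qed

lemma D_adjoint_expand:
  assumes h': "h' \<in> \<H> q"
  shows "D e (harmonic_adjoint p q (D e) h') x = (\<Sum>h\<in>Hb. harmonic_inner q (D e h) h' * D e h x)"
proof -
  let ?a = "harmonic_adjoint p q (D e) h'"
  have a: "?a \<in> \<H> p" by (rule adjoint_props(1)[OF D_Hom h'])
  have c: "harmonic_inner p ?a h = harmonic_inner q (D e h) h'" if "h \<in> Hb" for h
    using adjoint_props(2)[OF D_Hom h' Hb_mem[OF that], of e] harm.ip_sym[OF a Hb_mem[OF that]] by simp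
  have "?a = (\<lambda>x. \<Sum>h\<in>Hb. harmonic_inner p ?a h * h x)"
    using harm.onbasis_expand[OF Hb a] by (simp add: fun_eq_iff sum_fun_apply scaleR_fun_def)
  then have "D e ?a x = D e (\<lambda>x. \<Sum>h\<in>Hb. harmonic_inner p ?a h * h x) x" by simp
  also have "\<dots> = (\<Sum>h\<in>Hb. harmonic_inner p ?a h * D e h x)" by (rule D_sum[OF Hb_mem])
  also have "\<dots> = (\<Sum>h\<in>Hb. harmonic_inner q (D e h) h' * D e h x)" by (simp add: c)
  finally show ?thesis .
qed

text \<open>The operator has kernel \<gamma>, which is \<open>c0\<close> times the reproducing
  kernel, and the reproducing kernel induces the identity.\<close>

lemma sum_D_adjoint:
  assumes h': "h' \<in> \<H> q"
  shows "(\<Sum>e\<in>B. D e (harmonic_adjoint p q (D e) h')) = c0 *\<^sub>R h'"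
proof
  fix x
  have g: "\<gamma> x = (\<Sum>z\<in>B \<times> Hb. D (fst z) (snd z) x *\<^sub>R D (fst z) (snd z))"
    by (simp add: fun_eq_iff \<gamma>_def sum_fun_apply scaleR_fun_def sum.cartesian_product split_def)
  have "(\<Sum>e\<in>B. D e (harmonic_adjoint p q (D e) h')) x
      = (\<Sum>z\<in>B \<times> Hb. D (fst z) (snd z) x * harmonic_inner q (D (fst z) (snd z)) h')"
    by (simp add: sum_fun_apply D_adjoint_expand[OF h'] sum.cartesian_product split_def mult.commute)
  also have "\<dots> = harmonic_inner q (\<gamma> x) h'"
    unfolding g by (rule harm.ip_sum[symmetric, OF _ h']) (auto intro!: D_mem Hb_mem)
  also have "\<gamma> x = c0 *\<^sub>R zonal q x"
    by (simp add: fun_eq_iff \<gamma>_zonal scaleR_fun_def)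
  also have "harmonic_inner q (c0 *\<^sub>R zonal q x) h' = c0 * h' x"
    using harm.ip_scale[OF zonal_mem h', of c0 x] harm.ip_sym[OF zonal_mem h', of x] zonal_reproduce[OF h'] by simp
  finally show "(\<Sum>e\<in>B. D e (harmonic_adjoint p q (D e) h')) x = (c0 *\<^sub>R h') x"
    by (simp add: scaleR_fun_def)
qed

text \<open>The scalar in the definite description is unique because H_q contains a nonzero element,
  supplied by \<open>D\<close> being nonzero.\<close>

lemma hom_constant_eq: "hom_constant p q B D = c0"
  unfolding hom_constant_def
proof (rule the_equality)
  show "\<forall>h'\<in>\<H> q. (\<Sum>e\<in>B. D e (harmonic_adjoint p q (D e) h')) = c0 *\<^sub>R h'"
    using sum_D_adjoint by blast
  fix c assume c: "\<forall>h'\<in>\<H> q. (\<Sum>e\<in>B. D e (harmonic_adjoint p q (D e) h')) = c *\<^sub>R h'"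
  obtain h :: "real^'n \<Rightarrow> real" where h: "h \<in> \<H> q" "h \<noteq> 0" using q_nz by blast
  have "c *\<^sub>R h = c0 *\<^sub>R h" using c[rule_format, OF h(1)] sum_D_adjoint[OF h(1)] by (rule trans[OF sym])
  then show "c = c0" using h(2) scaleR_cancel_right by blast
qed

text \<open>If \<open>c0\<close> were 0, the diagonal of \<gamma> would vanish everywhere, not only
  at the base point; being a sum of squares, it would force \<open>D\<close> to vanish on both bases
  and hence identically on H_p.\<close>

lemma c0_pos: "c0 > 0"
proof -
  have nn: "\<gamma> x x \<ge> 0" for x unfolding \<gamma>_def by (intro sum_nonneg) simp
  have "c0 \<noteq> 0"
  proof
    assume "c0 = 0"
    then have "\<gamma> x x = 0" for x by (simp add: \<gamma>_zonal)
    then have "\<forall>e\<in>B. (\<Sum>h\<in>Hb. D e h x * D e h x) = 0" for x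
      unfolding \<gamma>_def by (subst (asm) sum_nonneg_eq_0_iff) (auto simp: finB intro: sum_nonneg)
    then have "D e h x * D e h x = 0" if "e \<in> B" "h \<in> Hb" for e h x
      using that sum_nonneg_eq_0_iff[OF finHb, of "\<lambda>h. D e h x * D e h x"] by simp
    then have z: "D e h x = 0" if "e \<in> B" "h \<in> Hb" for e h x using that by simp
    obtain e h x where eh: "h \<in> \<H> p" "D e h x \<noteq> 0"
      using D_nz by (auto simp: fun_eq_iff)
    have e1: "D e' h x = 0" if "e' \<in> B" for e'
    proof -
      have "h = (\<lambda>x. \<Sum>k\<in>Hb. harmonic_inner p h k * k x)"
        using harm.onbasis_expand[OF Hb eh(1)] by (simp add: fun_eq_iff sum_fun_apply scaleR_fun_def)
      then have "D e' h x = D e' (\<lambda>x. \<Sum>k\<in>Hb. harmonic_inner p h k * k x) x" by simp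
      also have "\<dots> = (\<Sum>k\<in>Hb. harmonic_inner p h k * D e' k x)" by (rule D_sum[OF Hb_mem])
      also have "\<dots> = 0" by (simp add: z that)
      finally show ?thesis .
    qed
    have "e = (\<Sum>b\<in>B. (e \<bullet> b) *\<^sub>R b)"
      using B orthonormal_basis_expand[of B e] finB unfolding orthonormal_basis_def by auto
    then have "D e h x = D (\<Sum>b\<in>B. (e \<bullet> b) *\<^sub>R b) h x" by simp
    also have "\<dots> = (\<Sum>b\<in>B. (e \<bullet> b) * D b h x)"
      by (simp add: linear_sum[OF D_linear[OF eh(1)]] linear_scale[OF D_linear[OF eh(1)]])
    also have "\<dots> = 0" by (simp add: e1)
    finally show False using eh(2) by simp
  qed
  with nn[of unit0] show ?thesis by (simp add: c0_def)
qed

end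

section \<open>An invariant inner product on kernels vanishing on the diagonal\<close>

lemma norm_both:
  fixes T :: "real^'n \<Rightarrow> real^'n"
  assumes "orthogonal_transformation T"
  shows "norm (both T x) = norm x"
  by (simp add: norm_prod_def orthogonal_transformation_norm[OF assms])

lemma orthogonal_both:
  fixes T :: "real^'n \<Rightarrow> real^'n"
  assumes "orthogonal_transformation T"
  shows "orthogonal_transformation (both T)"
  unfolding orthogonal_transformation
  using norm_both[OF assms] linear_pair_maps(6)[OF orthogonal_transformation_linear[OF assms]] by blast

text \<open>Only invariance under simultaneous rotation of both variables is wanted. Such a rotation
  is an orthogonal map of the product space, so the unit ball of that space with Lebesgue measure
  provides it.\<close>

definition ball_ip :: "((real^'n) \<times> (real^'n) \<Rightarrow> real) \<Rightarrow> ((real^'n) \<times> (real^'n) \<Rightarrow> real) \<Rightarrow> real" where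
  "ball_ip Q R = (LINT x|lborel. indicator (ball 0 1) x *\<^sub>R (Q x * R x))"

lemma ball_ip_integrable:
  assumes "continuous_on UNIV Q" "continuous_on UNIV R"
  shows "integrable lborel (\<lambda>x. indicator (ball 0 1) x *\<^sub>R (Q x * R x :: real))"
proof -
  have c: "continuous_on UNIV (\<lambda>x. Q x * R x)" by (intro continuous_on_mult assms)
  have "compact ((\<lambda>x. Q x * R x) ` cball 0 1)"
    by (rule compact_continuous_image[OF continuous_on_subset[OF c]]) auto
  then have "bounded ((\<lambda>x. Q x * R x) ` cball 0 1)" by (rule compact_imp_bounded)
  then obtain C where C: "\<forall>y\<in>(\<lambda>x. Q x * R x) ` cball 0 1. norm y \<le> C"
    unfolding bounded_iff by blast
  show ?thesis
  proof (rule integrable_bounded_region[OF borel_measurable_continuous_onI[OF c]])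
    show "\<bar>Q x * R x\<bar> \<le> C" if "x \<in> ball 0 1" for x
      using C that by simp
  qed auto
qed

lemma ball_ip_orthogonal:
  fixes T :: "real^'n \<Rightarrow> real^'n"
  assumes c: "continuous_on UNIV Q" "continuous_on UNIV R" and T: "orthogonal_transformation T"
  shows "ball_ip (\<lambda>x. Q (both T x)) (\<lambda>x. R (both T x)) = ball_ip Q R"
proof -
  let ?g = "\<lambda>x. indicator (ball 0 1) x *\<^sub>R (Q x * R x)"
  have "(\<lambda>x. Q x * R x) \<in> borel_measurable borel"
    by (intro borel_measurable_continuous_onI continuous_on_mult c)
  then have "?g \<in> borel_measurable borel"
    by (intro borel_measurable_scaleR borel_measurable_indicator) auto
  from integral_lborel_orthogonal[OF orthogonal_both[OF T] this]
  have "(LINT x|lborel. ?g (both T x)) = (LINT x|lborel. ?g x)" .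
  moreover have "indicator (ball 0 1) (both T x) = (indicator (ball 0 1) x :: real)" for x
    using norm_both[OF T, of x] by (simp add: indicator_def)
  ultimately show ?thesis by (simp only: ball_ip_def)
qed

context equivariant_hom
begin

definition tens :: "((real^'n \<Rightarrow> real) \<times> (real^'n \<Rightarrow> real) \<Rightarrow> real) \<Rightarrow> (real^'n) \<times> (real^'n) \<Rightarrow> real" where
  "tens c x = (\<Sum>z\<in>Hb \<times> Hb. c z * (fst z (fst x) * snd z (snd x)))"

text \<open>The kernel of the restriction to the diagonal on the symmetric square of H_p, with
  elements of the tensor product realised as functions of two variables.\<close>

definition sym_null :: "((real^'n) \<times> (real^'n) \<Rightarrow> real) set" where
  "sym_null = {Q. (\<exists>c. Q = tens c) \<and> (\<forall>x. Q (swap2 x) = Q x) \<and> (\<forall>y. Q (y, y) = 0)}"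

lemma Hb_expand: "f \<in> \<H> p \<Longrightarrow> f y = (\<Sum>k\<in>Hb. harmonic_inner p f k * k y)"
  using fun_cong[OF harm.onbasis_expand[OF Hb], of f y] by (simp add: sum_fun_apply scaleR_fun_def)

text \<open>Expanding every factor in the fixed basis \<open>Hb\<close> brings arbitrary products
  into the normal form \<open>tens\<close>; it is needed for rotated basis elements and for the
  components of an eigenmap.\<close>

lemma tens_of_products:
  assumes "\<And>i. i \<in> I \<Longrightarrow> f i \<in> \<H> p" "\<And>i. i \<in> I \<Longrightarrow> g i \<in> \<H> p"
  shows "\<exists>c. (\<lambda>x. \<Sum>i\<in>I. a i * (f i (fst x) * g i (snd x))) = tens c"
proof
  let ?c = "\<lambda>z. \<Sum>i\<in>I. a i * (harmonic_inner p (f i) (fst z) * harmonic_inner p (g i) (snd z))"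
  have pr: "(\<Sum>k\<in>Hb. F k) * (\<Sum>l\<in>Hb. G l) = (\<Sum>z\<in>Hb \<times> Hb. F (fst z) * G (snd z))"
    for F G :: "(real^'n \<Rightarrow> real) \<Rightarrow> real"
    by (simp add: sum_product sum.cartesian_product split_def)
  show "(\<lambda>x. \<Sum>i\<in>I. a i * (f i (fst x) * g i (snd x))) = tens ?c"
  proof
    fix x
    have "(\<Sum>i\<in>I. a i * (f i (fst x) * g i (snd x)))
       = (\<Sum>i\<in>I. a i * ((\<Sum>k\<in>Hb. harmonic_inner p (f i) k * k (fst x)) * (\<Sum>l\<in>Hb. harmonic_inner p (g i) l * l (snd x))))"
    proof (rule sum.cong[OF refl])
      fix i assume i: "i \<in> I"
      show "a i * (f i (fst x) * g i (snd x)) = a i * ((\<Sum>k\<in>Hb. harmonic_inner p (f i) k * k (fst x)) * (\<Sum>l\<in>Hb. harmonic_inner p (g i) l * l (snd x)))"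
        unfolding Hb_expand[OF assms(1)[OF i], symmetric] Hb_expand[OF assms(2)[OF i], symmetric] ..
    qed
    also have "\<dots> = (\<Sum>i\<in>I. \<Sum>z\<in>Hb \<times> Hb. a i * ((harmonic_inner p (f i) (fst z) * fst z (fst x)) * (harmonic_inner p (g i) (snd z) * snd z (snd x))))"
      unfolding pr unfolding sum_distrib_left ..
    also have "\<dots> = (\<Sum>z\<in>Hb \<times> Hb. \<Sum>i\<in>I. a i * ((harmonic_inner p (f i) (fst z) * fst z (fst x)) * (harmonic_inner p (g i) (snd z) * snd z (snd x))))"
      by (rule sum.swap)
    also have "\<dots> = tens ?c x"
      unfolding tens_def sum_distrib_right by (intro sum.cong refl) (simp add: mult_ac)
    finally show "(\<Sum>i\<in>I. a i * (f i (fst x) * g i (snd x))) = tens ?c x" .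
  qed
qed

lemma tens_poly: "poly_fun (tens c)"
proof -
  have "poly_fun (\<lambda>x::(real^'n) \<times> (real^'n). f (fst x) * g (snd x))"
    if "f \<in> Hb" "g \<in> Hb" for f g
    by (intro poly_times poly_compose_linear[OF harmonic_poly[OF Hb_mem[OF that(1)]] bounded_linear_fst]
        poly_compose_linear[OF harmonic_poly[OF Hb_mem[OF that(2)]] bounded_linear_snd])
  then show ?thesis
    unfolding tens_def[abs_def]
    by (intro real_polynomial_function_sum finite_cartesian_product finHb
        poly_times[OF poly_of_const]) auto
qed

lemma tens_slice: "(\<lambda>y. tens c (y, z)) \<in> \<H> p"
proof -
  have "(\<lambda>y. tens c (y, z)) = (\<Sum>w\<in>Hb \<times> Hb. (c w * snd w z) *\<^sub>R fst w)"
    by (simp add: fun_eq_iff tens_def sum_fun_apply scaleR_fun_def mult_ac)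
  also have "\<dots> \<in> \<H> p"
    by (intro subspace_sum subspace_scale subspace_harmonic) (auto intro: Hb_mem)
  finally show ?thesis .
qed

lemma null_poly: "Q \<in> sym_null \<Longrightarrow> poly_fun Q"
  using tens_poly by (auto simp: sym_null_def)

lemma null_continuous: "Q \<in> sym_null \<Longrightarrow> continuous_on S Q"
  by (rule poly_continuous[OF null_poly])

lemma null_slice: "Q \<in> sym_null \<Longrightarrow> (\<lambda>y. Q (y, z)) \<in> \<H> p"
  using tens_slice by (auto simp: sym_null_def)

lemma null_sym: "Q \<in> sym_null \<Longrightarrow> Q (swap2 x) = Q x"
  by (simp add: sym_null_def)

text \<open>Joint homogeneity of degree 2p extends vanishing on the ball to the whole space, which
  makes \<open>ball_ip\<close> definite.\<close>

lemma null_scale: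
  assumes "Q \<in> sym_null"
  shows "Q (t *\<^sub>R x) = t ^ p * (t ^ p * Q x)"
proof -
  have "Q (t *\<^sub>R x) = Q (t *\<^sub>R fst x, t *\<^sub>R snd x)" by (simp add: scaleR_prod_def)
  also have "\<dots> = t ^ p * Q (fst x, t *\<^sub>R snd x)" by (rule harmonic_homog[OF null_slice[OF assms]])
  also have "Q (fst x, t *\<^sub>R snd x) = Q (t *\<^sub>R snd x, fst x)"
    using null_sym[OF assms, of "(t *\<^sub>R snd x, fst x)"] by simp
  also have "\<dots> = t ^ p * Q (snd x, fst x)" by (rule harmonic_homog[OF null_slice[OF assms]])
  also have "Q (snd x, fst x) = Q x" using null_sym[OF assms, of x] by simp
  finally show ?thesis .
qed

lemma tens_add: "tens c + tens d = tens (\<lambda>z. c z + d z)"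
  by (simp add: fun_eq_iff tens_def distrib_right sum.distrib)

lemma tens_scale: "r *\<^sub>R tens c = tens (\<lambda>z. r * c z)"
  by (simp add: fun_eq_iff tens_def scaleR_fun_def sum_distrib_left mult.assoc)

lemma null_diag: "Q \<in> sym_null \<Longrightarrow> Q (y, y) = 0"
  by (simp add: sym_null_def)

lemma null_intro:
  assumes "Q = tens c" "\<And>x. Q (swap2 x) = Q x" "\<And>y. Q (y, y) = 0"
  shows "Q \<in> sym_null"
  unfolding sym_null_def using assms by blast

lemma subspace_null: "subspace sym_null"
proof (rule subspaceI)
  have "0 = tens (\<lambda>_. 0)" by (simp add: fun_eq_iff tens_def)
  then show "0 \<in> sym_null" by (rule null_intro) simp_all
next
  fix Q R assume Q: "Q \<in> sym_null" and R: "R \<in> sym_null"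
  obtain c d where "Q = tens c" "R = tens d" using Q R unfolding sym_null_def by blast
  then have "Q + R = tens (\<lambda>z. c z + d z)" by (simp only: tens_add)
  then show "Q + R \<in> sym_null"
    by (rule null_intro) (simp_all only: plus_fun_apply null_sym[OF Q] null_sym[OF R] null_diag[OF Q] null_diag[OF R] add_0)
next
  fix r :: real and Q assume Q: "Q \<in> sym_null"
  obtain c where "Q = tens c" using Q unfolding sym_null_def by blast
  then have "r *\<^sub>R Q = tens (\<lambda>z. r * c z)" by (simp only: tens_scale)
  then show "r *\<^sub>R Q \<in> sym_null"
    by (rule null_intro) (simp_all only: scaleR_fun_def null_sym[OF Q] null_diag[OF Q] scale_zero_right)
qed

lemma fin_ip_null: "fin_ip sym_null ball_ip"
proof
  show "subspace sym_null" by (rule subspace_null)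
  let ?m = "\<lambda>(z::(real^'n \<Rightarrow> real) \<times> (real^'n \<Rightarrow> real)) (x::(real^'n) \<times> (real^'n)). fst z (fst x) * snd z (snd x)"
  have "tens c \<in> span (?m ` (Hb \<times> Hb))" for c
  proof -
    have "tens c = (\<Sum>z\<in>Hb \<times> Hb. c z *\<^sub>R ?m z)"
      by (simp add: fun_eq_iff tens_def sum_fun_apply scaleR_fun_def)
    also have "\<dots> \<in> span (?m ` (Hb \<times> Hb))"
      by (intro span_sum span_scale span_base imageI)
    finally show ?thesis .
  qed
  then have "sym_null \<subseteq> span (?m ` (Hb \<times> Hb))" unfolding sym_null_def by blast
  moreover have "finite (?m ` (Hb \<times> Hb))" by (intro finite_imageI finite_cartesian_product finHb)
  ultimately show "\<exists>S. finite S \<and> sym_null \<subseteq> span S" by blast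
  fix Q R S :: "(real^'n) \<times> (real^'n) \<Rightarrow> real"
  show "ball_ip Q R = ball_ip R Q" by (simp add: ball_ip_def mult.commute)
  show "ball_ip (r *\<^sub>R Q) S = r * ball_ip Q S" for r
  proof -
    have "ball_ip (r *\<^sub>R Q) S = (LINT x|lborel. r * (indicator (ball 0 1) x *\<^sub>R (Q x * S x)))"
      unfolding ball_ip_def by (rule arg_cong[where f = "integral\<^sup>L lborel"]) (simp add: fun_eq_iff scaleR_fun_def)
    then show ?thesis by (simp add: ball_ip_def)
  qed
  assume Q: "Q \<in> sym_null"
  {
    assume R: "R \<in> sym_null" and S: "S \<in> sym_null"
    have "ball_ip (Q + R) S = (LINT x|lborel. indicator (ball 0 1) x *\<^sub>R (Q x * S x) + indicator (ball 0 1) x *\<^sub>R (R x * S x))"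
      unfolding ball_ip_def by (rule arg_cong[where f = "integral\<^sup>L lborel"]) (simp add: fun_eq_iff distrib_left distrib_right)
    also have "\<dots> = ball_ip Q S + ball_ip R S"
      unfolding ball_ip_def
      by (intro Bochner_Integration.integral_add ball_ip_integrable null_continuous Q R S)
    finally show "ball_ip (Q + R) S = ball_ip Q S + ball_ip R S" .
  }
  assume "Q \<noteq> 0"
  have int: "integrable lborel (\<lambda>x. indicator (ball 0 1) x *\<^sub>R (Q x * Q x))"
    by (intro ball_ip_integrable null_continuous Q)
  have "ball_ip Q Q \<noteq> 0"
  proof
    assume 0: "ball_ip Q Q = 0"
    have z: "Q x * Q x = 0" if "x \<in> ball 0 1" for x
    proof (rule integral_open_eq_0_imp[OF int open_ball _ _ 0[unfolded ball_ip_def] that])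
      show "continuous_on (ball 0 1) (\<lambda>x. Q x * Q x)"
        by (intro continuous_on_mult null_continuous Q)
    qed simp
    have "Q x = 0" for x
    proof -
      \<comment> \<open>Any positive factor that brings \<open>x\<close> into the open unit ball
        would do; this one also covers \<open>x = 0\<close>.\<close>
      define t where "t = 1 / (1 + norm x)"
      have t: "t > 0" "t * norm x < 1" by (simp_all add: t_def field_simps add_pos_nonneg)
      have "t *\<^sub>R x \<in> ball 0 1" using t by simp
      then have "Q (t *\<^sub>R x) = 0" using z[of "t *\<^sub>R x"] by simp
      then show ?thesis using t(1) by (simp add: null_scale[OF Q])
    qed
    with \<open>Q \<noteq> 0\<close> show False by (simp add: fun_eq_iff)
  qed
  moreover have "ball_ip Q Q \<ge> 0"
    unfolding ball_ip_def by (intro integral_nonneg_AE) (simp add: indicator_def)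
  ultimately show "ball_ip Q Q > 0" by simp
qed

text \<open>The sum of D_e \<otimes> D_e over \<open>B\<close>, applied to a kernel and evaluated in
  both variables at the base point.\<close>

definition Dform :: "((real^'n) \<times> (real^'n) \<Rightarrow> real) \<Rightarrow> real" where
  "Dform Q = (\<Sum>e\<in>B. D e (\<lambda>y. D e (\<lambda>z. Q (y, z)) unit0) unit0)"

lemma Dform_sum:
  assumes f: "\<And>i. i \<in> I \<Longrightarrow> f i \<in> \<H> p" and g: "\<And>i. i \<in> I \<Longrightarrow> g i \<in> \<H> p"
  shows "Dform (\<lambda>x. \<Sum>i\<in>I. a i * (f i (fst x) * g i (snd x)))
    = (\<Sum>e\<in>B. \<Sum>i\<in>I. a i * (D e (f i) unit0 * D e (g i) unit0))"
  unfolding Dform_def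
proof (rule sum.cong[OF refl])
  fix e
  have "D e (\<lambda>z. \<Sum>i\<in>I. a i * (f i y * g i z)) unit0 = (\<Sum>i\<in>I. (a i * D e (g i) unit0) * f i y)" for y
  proof -
    have "D e (\<lambda>z. \<Sum>i\<in>I. (a i * f i y) * g i z) unit0 = (\<Sum>i\<in>I. (a i * f i y) * D e (g i) unit0)"
      by (rule D_sum[OF g])
    then show ?thesis by (simp add: mult_ac)
  qed
  then have "D e (\<lambda>y. D e (\<lambda>z. \<Sum>i\<in>I. a i * (f i (fst (y, z)) * g i (snd (y, z)))) unit0) unit0
     = D e (\<lambda>y. \<Sum>i\<in>I. (a i * D e (g i) unit0) * f i y) unit0" by simp
  also have "\<dots> = (\<Sum>i\<in>I. (a i * D e (g i) unit0) * D e (f i) unit0)"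
    by (rule D_sum[OF f])
  finally show "D e (\<lambda>y. D e (\<lambda>z. \<Sum>i\<in>I. a i * (f i (fst (y, z)) * g i (snd (y, z)))) unit0) unit0
     = (\<Sum>i\<in>I. a i * (D e (f i) unit0 * D e (g i) unit0))" by (simp add: mult_ac)
qed

lemma Dform_tens: "Dform (tens c) = (\<Sum>e\<in>B. \<Sum>z\<in>Hb \<times> Hb. c z * (D e (fst z) unit0 * D e (snd z) unit0))"
  unfolding tens_def[abs_def] by (rule Dform_sum) (auto intro: Hb_mem)

text \<open>The module isometry produced by equivariance disappears in the sum over the orthonormal
  basis, so rotating all polynomials only moves the evaluation point.\<close>

lemma rotate_sum:
  assumes T: "rotation T" and f: "\<And>i. i \<in> I \<Longrightarrow> f i \<in> \<H> p" and g: "\<And>i. i \<in> I \<Longrightarrow> g i \<in> \<H> p"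
  shows "(\<Sum>e\<in>B. \<Sum>i\<in>I. a i * (D e (\<lambda>x. f i (T x)) x * D e (\<lambda>x. g i (T x)) x))
    = (\<Sum>e\<in>B. \<Sum>i\<in>I. a i * (D e (f i) (T x) * D e (g i) (T x)))"
proof -
  obtain \<sigma> where \<sigma>: "orthogonal_transformation \<sigma>"
    "\<And>e g x. g \<in> \<H> p \<Longrightarrow> D (\<sigma> e) (\<lambda>y. g (T y)) x = D e g (T x)"
    using D_rot[OF T] by blast
  have h: "(\<Sum>e\<in>B. D e (\<lambda>x. f i (T x)) x * D e (\<lambda>x. g i (T x)) x) = (\<Sum>e\<in>B. D e (f i) (T x) * D e (g i) (T x))"
    if "i \<in> I" for i
    using D_trace[OF \<sigma>(1) harmonic_orthogonal[OF f[OF that] rot_orthogonal[OF T]]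
        harmonic_orthogonal[OF g[OF that] rot_orthogonal[OF T]], of x x]
    by (simp add: \<sigma>(2) f[OF that] g[OF that])
  have "(\<Sum>e\<in>B. \<Sum>i\<in>I. a i * (D e (\<lambda>x. f i (T x)) x * D e (\<lambda>x. g i (T x)) x))
      = (\<Sum>i\<in>I. a i * (\<Sum>e\<in>B. D e (\<lambda>x. f i (T x)) x * D e (\<lambda>x. g i (T x)) x))"
    unfolding sum_distrib_left by (rule sum.swap)
  also have "\<dots> = (\<Sum>i\<in>I. a i * (\<Sum>e\<in>B. D e (f i) (T x) * D e (g i) (T x)))"
    by (intro sum.cong refl) (simp add: h)
  also have "\<dots> = (\<Sum>e\<in>B. \<Sum>i\<in>I. a i * (D e (f i) (T x) * D e (g i) (T x)))"
    unfolding sum_distrib_left by (rule sum.swap)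
  finally show ?thesis .
qed

lemma Hb_rot: "rotation T \<Longrightarrow> h \<in> Hb \<Longrightarrow> (\<lambda>x. h (T x)) \<in> \<H> p"
  by (rule harmonic_orthogonal[OF Hb_mem rot_orthogonal])

lemma null_rot:
  assumes Q: "Q \<in> sym_null" and T: "rotation T"
  shows "(\<lambda>x. Q (both T x)) \<in> sym_null"
proof -
  obtain c where c: "Q = tens c" using Q unfolding sym_null_def by blast
  have e: "(\<lambda>x. Q (both T x)) = (\<lambda>x. \<Sum>z\<in>Hb \<times> Hb. c z * ((\<lambda>x. fst z (T x)) (fst x) * (\<lambda>x. snd z (T x)) (snd x)))"
    by (simp add: c tens_def)
  have "\<exists>d. (\<lambda>x. \<Sum>z\<in>Hb \<times> Hb. c z * ((\<lambda>x. fst z (T x)) (fst x) * (\<lambda>x. snd z (T x)) (snd x))) = tens d"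
    by (rule tens_of_products) (auto intro: Hb_rot[OF T])
  then obtain d where "(\<lambda>x. Q (both T x)) = tens d" unfolding e by blast
  then show ?thesis
  proof (rule null_intro)
    show "Q (both T (swap2 x)) = Q (both T x)" for x
      using null_sym[OF Q, of "both T x"] by simp
    show "Q (both T (y, y)) = 0" for y
      using null_diag[OF Q] by simp
  qed
qed

lemma Dform_rot:
  assumes Q: "Q \<in> sym_null" and T: "rotation T" "T unit0 = unit0"
  shows "Dform (\<lambda>x. Q (both T x)) = Dform Q"
proof -
  obtain c where c: "Q = tens c" using Q unfolding sym_null_def by blast
  have e: "(\<lambda>x. Q (both T x)) = (\<lambda>x. \<Sum>z\<in>Hb \<times> Hb. c z * ((\<lambda>x. fst z (T x)) (fst x) * (\<lambda>x. snd z (T x)) (snd x)))"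
    by (simp add: c tens_def)
  have "Dform (\<lambda>x. Q (both T x))
     = (\<Sum>e\<in>B. \<Sum>z\<in>Hb \<times> Hb. c z * (D e (\<lambda>x. fst z (T x)) unit0 * D e (\<lambda>x. snd z (T x)) unit0))"
    unfolding e by (rule Dform_sum) (auto intro: Hb_rot[OF T(1)])
  also have "\<dots> = (\<Sum>e\<in>B. \<Sum>z\<in>Hb \<times> Hb. c z * (D e (fst z) (T unit0) * D e (snd z) (T unit0)))"
    by (rule rotate_sum[OF T(1)]) (auto intro: Hb_mem)
  finally show ?thesis by (simp add: T(2) c Dform_tens)
qed

lemma Dform_functional: "fin_ip.functional sym_null Dform"
  unfolding fin_ip.functional_def[OF fin_ip_null]
proof (intro conjI ballI allI)
  fix Q R assume "Q \<in> sym_null" "R \<in> sym_null"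
  then obtain c d where "Q = tens c" "R = tens d" unfolding sym_null_def by blast
  then show "Dform (Q + R) = Dform Q + Dform R"
    by (simp add: tens_add Dform_tens distrib_right sum.distrib)
next
  fix r Q assume "Q \<in> sym_null"
  then obtain c where "Q = tens c" unfolding sym_null_def by blast
  then show "Dform (r *\<^sub>R Q) = r * Dform Q"
    by (simp add: tens_scale Dform_tens sum_distrib_left mult.assoc)
qed

text \<open>The representative of the invariant functional \<open>Dform\<close> is an invariant kernel vanishing on the diagonal.\<close>

lemma Dform_null:
  assumes Q: "Q \<in> sym_null"
  shows "Dform Q = 0"
proof -
  obtain R where R: "R \<in> sym_null" "\<And>Q. Q \<in> sym_null \<Longrightarrow> ball_ip Q R = Dform Q"
    using fin_ip.riesz[OF fin_ip_null Dform_functional] by blast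
  have "R = (\<lambda>_. 0)"
  proof (rule invariant_kernel_vanish[OF N null_poly[OF R(1)]])
    show "R (swap2 x) = R x" for x by (rule null_sym[OF R(1)])
    show "homog proj1 p R" by (rule homog_of_slices[OF null_slice[OF R(1)]])
    show "laplace lunit R z = 0" for z
      by (rule lap_of_slices[OF null_slice[OF R(1)]])
    show "R (y, y) = 0" for y by (rule null_diag[OF R(1)])
    show "biinv (SOME i. True) R"
      unfolding biinv_def
    proof (intro allI impI)
      fix T :: "real^'n \<Rightarrow> real^'n" and x
      assume T: "rotation T" "T (axis (SOME i. True) 1) = axis (SOME i. True) 1"
      have Tu: "T unit0 = unit0" using T(2) by (simp add: unit0_def)
      have iT: "rotation (inv T)" "inv T unit0 = unit0"
        using rot_inv[OF T(1)] rot_inv_left[OF T(1), of unit0] by (simp_all add: Tu)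
      \<comment> \<open>Both sides represent the same functional: moving the rotation to the test
        kernel is allowed by invariance of \<open>ball_ip\<close>, and \<open>Dform\<close> ignores
        it there.\<close>
      have "(\<lambda>x. R (both T x)) = R"
      proof (rule fin_ip.ip_eqI_right[OF fin_ip_null null_rot[OF R(1) T(1)] R(1)])
        fix S assume S: "S \<in> sym_null"
        let ?S = "\<lambda>x. S (both (inv T) x)"
        have Si: "?S \<in> sym_null" by (rule null_rot[OF S iT(1)])
        have "ball_ip S (\<lambda>x. R (both T x)) = ball_ip (\<lambda>x. ?S (both T x)) (\<lambda>x. R (both T x))"
          by (simp add: rot_inv_left[OF T(1)])
        also have "\<dots> = ball_ip ?S R"
          by (rule ball_ip_orthogonal[OF null_continuous[OF Si] null_continuous[OF R(1)] rot_orthogonal[OF T(1)]])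
        also have "\<dots> = Dform ?S" by (rule R(2)[OF Si])
        also have "\<dots> = Dform S" by (rule Dform_rot[OF S iT])
        also have "\<dots> = ball_ip S R" by (rule R(2)[OF S, symmetric])
        finally show "ball_ip S (\<lambda>x. R (both T x)) = ball_ip S R" .
      qed
      then show "R (both T x) = R x" by (rule fun_cong)
    qed
  qed
  then show ?thesis using R(2)[OF Q] by (simp add: ball_ip_def)
qed

lemma zonal_diag:
  fixes y :: "real^'n"
  shows "zonal p y y = (norm y ^ p)\<^sup>2"
proof -
  obtain u where u: "norm u = 1" "y = norm y *\<^sub>R u" by (rule unit_factor)
  have "zonal p y y = zonal p (norm y *\<^sub>R u) (norm y *\<^sub>R u)" unfolding u(2)[symmetric] ..
  also have "\<dots> = norm y ^ p * (norm y ^ p * zonal p u u)"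
    unfolding zonal_homog1 zonal_sym[of p u "norm y *\<^sub>R u"] ..
  finally show ?thesis by (simp add: zonal_diag_unit[OF p_nz u(1)] power2_eq_square)
qed

text \<open>The same sum taken over an orthonormal basis of H_p is \<open>c0\<close> by definition
  of \<gamma>. An eigenmap and such a basis have kernels that agree on the diagonal, so they differ
  by an element of \<open>sym_null\<close>, which \<open>Dform\<close> does not see.\<close>

theorem D_eigenmap:
  fixes f :: "'j \<Rightarrow> real^'n \<Rightarrow> real"
  assumes J: "finite J" and f: "\<And>j. j \<in> J \<Longrightarrow> f j \<in> \<H> p"
    and sph: "\<And>x. norm x = 1 \<Longrightarrow> (\<Sum>j\<in>J. (f j x)\<^sup>2) = 1" and x: "norm x = 1"
  shows "(\<Sum>e\<in>B. \<Sum>j\<in>J. (D e (f j) x)\<^sup>2) = c0"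
proof -
  obtain T where T: "rotation T" "T unit0 = x" using unit_rot[OF x] by blast
  have oT: "orthogonal_transformation T" by (rule rot_orthogonal[OF T(1)])
  \<comment> \<open>A disjoint union with signs 1 and -1 puts the difference of the two kernels into
    the form of a single finite sum; composing the \<open>f j\<close> with \<open>T\<close> brings
    the evaluation point \<open>x\<close> to the base point.\<close>
  define I where "I = J <+> Hb"
  define g where "g = case_sum (\<lambda>j x. f j (T x)) (\<lambda>h::real^'n \<Rightarrow> real. h)"
  define a where "a = case_sum (\<lambda>_::'j. 1::real) (\<lambda>_::real^'n \<Rightarrow> real. -1)"
  have gm: "g i \<in> \<H> p" if "i \<in> I" for i
    using that f by (auto simp: I_def g_def Hb_mem harmonic_orthogonal[OF _ oT])
  have split: "(\<Sum>i\<in>I. a i * F (g i)) = (\<Sum>j\<in>J. F (\<lambda>x. f j (T x))) - (\<Sum>h\<in>Hb. F h)" for F :: "(real^'n \<Rightarrow> real) \<Rightarrow> real"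
    unfolding I_def by (simp add: sum.Plus[OF J finHb] g_def a_def sum_negf)
  define Q where "Q = (\<lambda>x. \<Sum>i\<in>I. a i * (g i (fst x) * g i (snd x)))"
  have Qd: "Q (y, y) = 0" for y
  proof -
    obtain u where u: "norm u = 1" "y = norm y *\<^sub>R u" by (rule unit_factor)
    have lT: "linear T" by (rule orthogonal_transformation_linear[OF oT])
    have fy: "f j (T y) = norm y ^ p * f j (T u)" if "j \<in> J" for j
    proof -
      have "T y = norm y *\<^sub>R T u" using linear_scale[OF lT, of "norm y" u] unfolding u(2)[symmetric] .
      then show ?thesis using harmonic_homog[OF f[OF that]] by simp
    qed
    have "(\<Sum>j\<in>J. f j (T y) * f j (T y)) = (norm y ^ p)\<^sup>2 * (\<Sum>j\<in>J. (f j (T u))\<^sup>2)"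
      by (simp add: fy sum_distrib_left power2_eq_square mult_ac)
    also have "(\<Sum>j\<in>J. (f j (T u))\<^sup>2) = 1"
      by (rule sph) (simp add: orthogonal_transformation_norm[OF oT] u(1))
    finally have "(\<Sum>j\<in>J. f j (T y) * f j (T y)) = (norm y ^ p)\<^sup>2" by simp
    moreover have "(\<Sum>h\<in>Hb. h y * h y) = (norm y ^ p)\<^sup>2"
      using zonal_basis[OF Hb, of y y] zonal_diag[of y] by simp
    ultimately show ?thesis
      using split[of "\<lambda>k. k y * k y"] by (simp add: Q_def)
  qed
  have "Q \<in> sym_null"
    unfolding sym_null_def
  proof (intro CollectI conjI allI)
    show "\<exists>c. Q = tens c" unfolding Q_def by (rule tens_of_products[OF gm gm])
    show "Q (swap2 x) = Q x" for x by (simp add: Q_def mult_ac)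
    show "Q (y, y) = 0" for y by (rule Qd)
  qed
  then have "Dform Q = 0" by (rule Dform_null)
  then have 0: "(\<Sum>e\<in>B. \<Sum>i\<in>I. a i * (D e (g i) unit0 * D e (g i) unit0)) = 0"
    unfolding Q_def by (simp add: Dform_sum[OF gm gm])
  have "(\<Sum>e\<in>B. \<Sum>i\<in>I. a i * (D e (g i) unit0 * D e (g i) unit0))
     = (\<Sum>e\<in>B. \<Sum>j\<in>J. 1 * (D e (\<lambda>x. f j (T x)) unit0 * D e (\<lambda>x. f j (T x)) unit0)) - \<gamma> unit0 unit0"
    unfolding \<gamma>_def sum_subtractf[symmetric]
  proof (rule sum.cong[OF refl])
    fix e
    show "(\<Sum>i\<in>I. a i * (D e (g i) unit0 * D e (g i) unit0))
       = (\<Sum>j\<in>J. 1 * (D e (\<lambda>x. f j (T x)) unit0 * D e (\<lambda>x. f j (T x)) unit0)) - (\<Sum>h\<in>Hb. D e h unit0 * D e h unit0)"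
      unfolding mult_1 by (rule split)
  qed
  also have "(\<Sum>e\<in>B. \<Sum>j\<in>J. 1 * (D e (\<lambda>x. f j (T x)) unit0 * D e (\<lambda>x. f j (T x)) unit0))
     = (\<Sum>e\<in>B. \<Sum>j\<in>J. 1 * (D e (f j) (T unit0) * D e (f j) (T unit0)))"
    by (rule rotate_sum[OF T(1) f f])
  finally show ?thesis
    using 0 by (simp add: T(2) c0_def power2_eq_square)
qed

end

section \<open>Radially normalised harmonic polynomials\<close>

text \<open>The result is again a combination of polynomials divided by powers of the norm, so the
  formula can be applied a second time.\<close>

lemma has_deriv_div_norm_power:
  fixes f :: "real^'n \<Rightarrow> real"
  assumes f: "poly_fun f" and x: "x \<noteq> 0"
  shows "((\<lambda>t. f (x + t *\<^sub>R axis i 1) / norm (x + t *\<^sub>R axis i 1) ^ k) has_real_derivative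
     dird (axis i 1) f x / norm x ^ k - k * (x $ i * f x) / norm x ^ (k + 2)) (at 0)"
proof -
  let ?n = "\<lambda>t. norm (x + t *\<^sub>R axis i 1)"
  have nx: "norm x > 0" using x by simp
  have "((\<lambda>t. x + t *\<^sub>R axis i 1) has_derivative (\<lambda>t. t *\<^sub>R axis i 1)) (at 0)"
    by (auto intro!: derivative_eq_intros)
  moreover have "(norm has_derivative (\<lambda>h. h \<bullet> sgn (x + 0 *\<^sub>R axis i 1))) (at (x + 0 *\<^sub>R axis i 1))"
    by (rule has_derivative_norm) (simp add: x)
  ultimately have "(?n has_derivative (\<lambda>t. (t *\<^sub>R axis i 1) \<bullet> sgn (x + 0 *\<^sub>R axis i 1))) (at 0)"
    by (rule has_derivative_compose)
  moreover have "(\<lambda>t. (t *\<^sub>R axis i 1) \<bullet> sgn (x + 0 *\<^sub>R axis i 1)) = (*) (x $ i / norm x)"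
    by (rule ext) (simp add: inner_axis inner_commute[of "axis i 1"] sgn_div_norm divide_inverse)
  ultimately have n: "(?n has_real_derivative x $ i / norm x) (at 0)"
    unfolding has_field_derivative_def by simp
  have nk: "((\<lambda>t. ?n t ^ k) has_real_derivative k * norm x ^ (k - 1) * (x $ i / norm x)) (at 0)"
    using DERIV_power[OF n, of k] by (simp add: mult_ac)
  have "((\<lambda>t. f (x + t *\<^sub>R axis i 1) / ?n t ^ k) has_real_derivative
     (dird (axis i 1) f x * norm x ^ k - f x * (k * norm x ^ (k - 1) * (x $ i / norm x))) / (norm x ^ k * norm x ^ k)) (at 0)"
    using DERIV_divide[OF has_dird_0[OF f] nk] x by simp
  \<comment> \<open>The case split is for k = 0, where the exponent \<open>k - 1\<close> is
    truncated but carries the factor 0.\<close>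
  moreover have "(a * N ^ k - b * (k * N ^ (k - 1) * (c / N))) / (N ^ k * N ^ k) = a / N ^ k - k * (c * b) / N ^ (k + 2)"
    if "N > 0" for a b c N :: real
  proof (cases k)
    case (Suc l)
    then show ?thesis using that by (simp add: field_simps)
  qed simp
  ultimately show ?thesis using nx by simp
qed

definition radial :: "nat \<Rightarrow> (real^'n \<Rightarrow> real) \<Rightarrow> real^'n \<Rightarrow> real" where
  "radial q h x = h x / norm x ^ q"

definition radial1 :: "nat \<Rightarrow> (real^'n \<Rightarrow> real) \<Rightarrow> 'n \<Rightarrow> real^'n \<Rightarrow> real" where
  "radial1 q h i x = radial q (dird (axis i 1) h) x - q * radial (q + 2) (\<lambda>x. x $ i * h x) x"

definition radial2 :: "nat \<Rightarrow> (real^'n \<Rightarrow> real) \<Rightarrow> 'n \<Rightarrow> real^'n \<Rightarrow> real" where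
  "radial2 q h i x = dird (axis i 1) (dird (axis i 1) h) x / norm x ^ q
     - 2 * real q * (x $ i * dird (axis i 1) h x) / norm x ^ (q + 2)
     - real q * h x / norm x ^ (q + 2) + real q * (real q + 2) * ((x $ i)\<^sup>2 * h x) / norm x ^ (q + 4)"

lemma radial_deriv:
  assumes "poly_fun h" "x \<noteq> 0"
  shows "((\<lambda>t. radial q h (x + t *\<^sub>R axis i 1)) has_real_derivative radial1 q h i x) (at 0)"
  unfolding radial_def radial1_def using has_deriv_div_norm_power[OF assms, of i q] by simp

lemma coord_mult_poly: "poly_fun h \<Longrightarrow> poly_fun (\<lambda>x::real^'n. x $ i * h x)"
  by (rule poly_times[OF poly_of_linear[OF bounded_linear_vec_nth]])

lemma radial1_deriv:
  fixes h :: "real^'n \<Rightarrow> real"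
  assumes h: "poly_fun h" and x: "x \<noteq> 0"
  shows "((\<lambda>t. radial1 q h i (x + t *\<^sub>R axis i 1)) has_real_derivative radial2 q h i x) (at 0)"
proof -
  have d: "dird (axis i 1) (\<lambda>x. x $ i * h x) x = h x + x $ i * dird (axis i 1) h x" for x :: "real^'n"
    using dird_mult[OF poly_of_linear[OF bounded_linear_vec_nth[of i]] h, of "axis i 1"]
      dird_linear[OF bounded_linear_vec_nth[of i], of "axis i 1"]
    by (simp add: fun_eq_iff)
  have "((\<lambda>t. radial1 q h i (x + t *\<^sub>R axis i 1)) has_real_derivative
      (dird (axis i 1) (dird (axis i 1) h) x / norm x ^ q - q * (x $ i * dird (axis i 1) h x) / norm x ^ (q + 2))
      - q * (dird (axis i 1) (\<lambda>x. x $ i * h x) x / norm x ^ (q + 2)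
         - real (q + 2) * (x $ i * (x $ i * h x)) / norm x ^ (q + 2 + 2))) (at 0)"
    unfolding radial1_def radial_def
    by (intro DERIV_diff DERIV_cmult has_deriv_div_norm_power poly_dird coord_mult_poly h x)
  moreover have "(a / M - q * (c * b) / M2) - q * ((e + c * b) / M2 - real (q + 2) * (c * (c * e)) / M4)
     = a / M - 2 * real q * (c * b) / M2 - real q * e / M2 + real q * (real q + 2) * (c\<^sup>2 * e) / M4" for a b c e M M2 M4 :: real
    by (simp add: algebra_simps add_divide_distrib power2_eq_square)
  moreover have "q + 2 + 2 = q + 4" by simp
  ultimately show ?thesis unfolding d radial2_def by metis
qed

text \<open>The Laplacian of \<open>h\<close> drops out and Euler's relation evaluates the mixed
  term; with N variables the coefficients combine to -2 q^2 - N q + q (q + 2) = -q (q + N -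
  2).\<close>

lemma radial_laplacian:
  fixes h :: "real^'n \<Rightarrow> real"
  assumes h: "h \<in> \<H> q" and x: "x \<noteq> 0"
  shows "(\<Sum>i\<in>UNIV. radial2 q h i x) = - (real q * (real q + real CARD('n) - 2) / (norm x)\<^sup>2) * radial q h x"
proof -
  have e: "(\<Sum>i\<in>UNIV. x $ i * dird (axis i 1) h x) = q * h x"
    using homog_euler_coord[OF harmonic_poly[OF h]] h unfolding harmonic_iff by blast
  have n: "(\<Sum>i\<in>UNIV. (x $ i)\<^sup>2) = (norm x)\<^sup>2"
    by (simp add: norm_vec_def L2_set_def sum_nonneg)
  have "(\<Sum>i\<in>UNIV. radial2 q h i x)
    = (\<Sum>i\<in>UNIV. dird (axis i 1) (dird (axis i 1) h) x) / norm x ^ q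
     - 2 * real q * (\<Sum>i\<in>UNIV. x $ i * dird (axis i 1) h x) / norm x ^ (q + 2)
     - real CARD('n) * (real q * h x / norm x ^ (q + 2)) + real q * (real q + 2) * ((\<Sum>i\<in>UNIV. (x $ i)\<^sup>2) * h x) / norm x ^ (q + 4)"
    unfolding radial2_def
    by (simp only: sum.distrib sum_subtractf sum_divide_distrib sum_distrib_left sum_distrib_right sum_constant)
  also have "\<dots> = - 2 * real q * (real q * h x) / norm x ^ (q + 2)
     - real CARD('n) * (real q * h x / norm x ^ (q + 2)) + real q * (real q + 2) * ((norm x)\<^sup>2 * h x) / norm x ^ (q + 4)"
    unfolding e n harmonic_lap[OF h] by simp
  also have "\<dots> = - (real q * (real q + real CARD('n) - 2) / (norm x)\<^sup>2) * radial q h x"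
  proof -
    have "- 2 * real q * (real q * a) / M ^ (q + 2) - c * (real q * a / M ^ (q + 2)) + real q * (real q + 2) * (M\<^sup>2 * a) / M ^ (q + 4)
      = - (real q * (real q + c - 2) / M\<^sup>2) * (a / M ^ q)" if "M > 0" for a M c :: real
    proof -
      have M: "M ^ (q + 4) = M\<^sup>2 * (M\<^sup>2 * M ^ q)" "M ^ (q + 2) = M\<^sup>2 * M ^ q"
        by (simp_all add: power_add power2_eq_square power4_eq_xxxx mult_ac)
      have "- 2 * real q * (real q * a) / (K * P) - c * (real q * a / (K * P)) + real q * (real q + 2) * (K * a) / (K * (K * P))
        = - (real q * (real q + c - 2) / K) * (a / P)" if "K > 0" "P > 0" for K P :: real
        using that by (simp add: field_simps)
      from this[of "M\<^sup>2" "M ^ q"] show ?thesis unfolding M using that by simp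
    qed
    then show ?thesis using x by (simp add: radial_def)
  qed
  finally show ?thesis .
qed

lemma radial_unit:
  assumes "h \<in> \<H> q" "x \<noteq> 0"
  shows "radial q h x = h (x /\<^sub>R norm x)"
  using harmonic_homog[OF assms(1), of "inverse (norm x)" x]
  by (simp add: radial_def divide_inverse power_inverse mult.commute)

text \<open>The formula for \<open>F\<close> is known only off the origin; a coordinate line through
  \<open>x\<close> avoids the origin near \<open>x\<close>, which suffices for the
  derivative.\<close>

lemma partial_off_origin:
  fixes F :: "real^'n \<Rightarrow> 'b::real_normed_vector"
  assumes F: "\<And>y. y \<noteq> 0 \<Longrightarrow> F y = (\<Sum>s\<in>S. a s y *\<^sub>R w s)" and x: "x \<noteq> 0"
    and d: "\<And>s. s \<in> S \<Longrightarrow> ((\<lambda>t. a s (x + t *\<^sub>R axis i 1)) has_real_derivative b s) (at 0)"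
  shows "partial i F x = (\<Sum>s\<in>S. b s *\<^sub>R w s)"
proof -
  have "((\<lambda>t. \<Sum>s\<in>S. a s (x + t *\<^sub>R axis i 1) *\<^sub>R w s) has_vector_derivative (\<Sum>s\<in>S. b s *\<^sub>R w s)) (at 0)"
  proof (rule has_vector_derivative_sum)
    fix s assume "s \<in> S"
    then show "((\<lambda>t. a s (x + t *\<^sub>R axis i 1) *\<^sub>R w s) has_vector_derivative b s *\<^sub>R w s) (at 0)"
      using has_vector_derivative_scaleR[OF d has_vector_derivative_const[of "w s"]] by simp
  qed
  moreover have "open {t. x + t *\<^sub>R axis i 1 \<noteq> 0}"
    by (intro open_Collect_neq continuous_intros)
  ultimately have "((\<lambda>t. F (x + t *\<^sub>R axis i 1)) has_vector_derivative (\<Sum>s\<in>S. b s *\<^sub>R w s)) (at 0)"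
    by (rule has_vector_derivative_transform_within_open) (use x F in auto)
  then show ?thesis unfolding partial_def by (rule vector_derivative_at)
qed

text \<open>Differentiating \<open>\<bar>\<nu>\<bar>\<^sup>2 = 1\<close> twice gives \<open>\<bar>\<nabla>\<nu>\<bar>\<^sup>2 = - \<nu> \<bullet> \<Delta>\<nu>\<close>, so the energy density is the eigenvalue.\<close>

lemma radial_eigenmap:
  fixes F :: "real^'n \<Rightarrow> 'b::real_inner"
  assumes S: "finite S" and h: "\<And>s. s \<in> S \<Longrightarrow> h s \<in> \<H> q"
    and orth: "\<And>s t. s \<in> S \<Longrightarrow> t \<in> S \<Longrightarrow> w s \<bullet> w t = (if s = t then 1 else 0)"
    and F: "\<And>y. y \<noteq> 0 \<Longrightarrow> F y = (\<Sum>s\<in>S. radial q (h s) y *\<^sub>R w s)"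
    and sph: "\<And>y. norm y = 1 \<Longrightarrow> (\<Sum>s\<in>S. (h s y)\<^sup>2) = 1" and x: "x \<noteq> 0"
  shows "(norm (F x))\<^sup>2 = 1"
    and "energy_density F x = real q * (real q + real CARD('n) - 2) / (norm x)\<^sup>2"
    and "laplacian F x + energy_density F x *\<^sub>R F x = 0"
proof -
  define \<Lambda> where "\<Lambda> = real q * (real q + real CARD('n) - 2) / (norm x)\<^sup>2"
  note hp = harmonic_poly[OF h]
  have nsum: "(norm (\<Sum>s\<in>S. a s *\<^sub>R w s))\<^sup>2 = (\<Sum>s\<in>S. (a s)\<^sup>2)" for a
  proof -
    have "(norm (\<Sum>s\<in>S. a s *\<^sub>R w s))\<^sup>2 = (\<Sum>s\<in>S. \<Sum>t\<in>S. (a s * a t) * (w t \<bullet> w s))"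
      unfolding power2_norm_eq_inner by (simp add: inner_sum_left inner_sum_right sum_distrib_left mult.assoc)
    also have "\<dots> = (\<Sum>s\<in>S. \<Sum>t\<in>S. if s = t then a s * a t else 0)"
      by (intro sum.cong refl) (simp add: orth)
    also have "\<dots> = (\<Sum>s\<in>S. (a s)\<^sup>2)"
      using S by (simp add: power2_eq_square)
    finally show ?thesis .
  qed
  have one: "(\<Sum>s\<in>S. (radial q (h s) y)\<^sup>2) = 1" if "y \<noteq> 0" for y
  proof -
    have "(\<Sum>s\<in>S. (radial q (h s) y)\<^sup>2) = (\<Sum>s\<in>S. (h s (y /\<^sub>R norm y))\<^sup>2)"
      using radial_unit[OF h that] by simp
    then show ?thesis using sph[of "y /\<^sub>R norm y"] that by simp
  qed
  show n1: "(norm (F x))\<^sup>2 = 1"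
    unfolding F[OF x] nsum by (rule one[OF x])
  have p1: "partial i F y = (\<Sum>s\<in>S. radial1 q (h s) i y *\<^sub>R w s)" if "y \<noteq> 0" for y i
    by (rule partial_off_origin[OF F that radial_deriv[OF hp that]])
  have p2: "partial i (partial i F) x = (\<Sum>s\<in>S. radial2 q (h s) i x *\<^sub>R w s)" for i
    by (rule partial_off_origin[OF p1 x radial1_deriv[OF hp x]])
  \<comment> \<open>The identities below hold only off the origin, so constancy is available just
    near 0 on the coordinate line.\<close>
  have const_deriv: "d = 0"
    if g: "(g has_real_derivative d) (at 0)" and c: "\<And>t. x + t *\<^sub>R axis i 1 \<noteq> 0 \<Longrightarrow> g t = c"
      and x0: "x \<noteq> 0" for g c d and x :: "real^'n" and i :: 'n
  proof -
    have nbhd: "open {t. x + t *\<^sub>R axis i 1 \<noteq> 0}"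
      by (intro open_Collect_neq continuous_intros)
    have "((\<lambda>_. c) has_real_derivative d) (at 0)"
      by (rule has_field_derivative_transform_within_open[OF g nbhd]) (use x0 c in auto)
    then show ?thesis using DERIV_unique DERIV_const by blast
  qed
  have o1: "(\<Sum>s\<in>S. radial q (h s) y * radial1 q (h s) i y) = 0" if y: "y \<noteq> 0" for y i
  proof -
    have "((\<lambda>t. \<Sum>s\<in>S. radial q (h s) (y + t *\<^sub>R axis i 1) * radial q (h s) (y + t *\<^sub>R axis i 1)) has_real_derivative
        (\<Sum>s\<in>S. radial1 q (h s) i y * radial q (h s) (y + 0 *\<^sub>R axis i 1) + radial1 q (h s) i y * radial q (h s) (y + 0 *\<^sub>R axis i 1))) (at 0)"
      by (intro DERIV_sum DERIV_mult radial_deriv hp y)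
    from const_deriv[OF this _ y, of i 1]
    have "(\<Sum>s\<in>S. radial1 q (h s) i y * radial q (h s) y + radial1 q (h s) i y * radial q (h s) y) = 0"
      using one by (simp add: power2_eq_square)
    then have "2 * (\<Sum>s\<in>S. radial q (h s) y * radial1 q (h s) i y) = 0"
      by (simp add: sum_distrib_left mult.commute)
    then show ?thesis by simp
  qed
  \<comment> \<open>Obtained by differentiating the orthogonality relation \<open>o1\<close> once
    more in the same direction.\<close>
  have o2: "(\<Sum>s\<in>S. (radial1 q (h s) i x)\<^sup>2) = - (\<Sum>s\<in>S. radial q (h s) x * radial2 q (h s) i x)" for i
  proof -
    have "((\<lambda>t. \<Sum>s\<in>S. radial q (h s) (x + t *\<^sub>R axis i 1) * radial1 q (h s) i (x + t *\<^sub>R axis i 1)) has_real_derivative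
        (\<Sum>s\<in>S. radial1 q (h s) i x * radial1 q (h s) i (x + 0 *\<^sub>R axis i 1) + radial2 q (h s) i x * radial q (h s) (x + 0 *\<^sub>R axis i 1))) (at 0)"
      by (intro DERIV_sum DERIV_mult radial_deriv radial1_deriv hp x)
    from const_deriv[OF this _ x, of i 0]
    have "(\<Sum>s\<in>S. radial1 q (h s) i x * radial1 q (h s) i x + radial2 q (h s) i x * radial q (h s) x) = 0"
      using o1 by simp
    then show ?thesis by (simp add: sum.distrib power2_eq_square mult.commute)
  qed
  have lap: "laplacian F x = - \<Lambda> *\<^sub>R F x"
  proof -
    have "laplacian F x = (\<Sum>s\<in>S. (\<Sum>i\<in>UNIV. radial2 q (h s) i x) *\<^sub>R w s)"
      unfolding laplacian_def p2 scaleR_sum_left by (rule sum.swap)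
    also have "\<dots> = (\<Sum>s\<in>S. (- \<Lambda> * radial q (h s) x) *\<^sub>R w s)"
      by (intro sum.cong refl) (simp add: radial_laplacian[OF h x] \<Lambda>_def)
    also have "\<dots> = - \<Lambda> *\<^sub>R F x"
      unfolding F[OF x] scaleR_sum_right scaleR_scaleR ..
    finally show ?thesis .
  qed
  have en: "energy_density F x = \<Lambda>"
  proof -
    have "energy_density F x = (\<Sum>i\<in>UNIV. - (\<Sum>s\<in>S. radial q (h s) x * radial2 q (h s) i x))"
      unfolding energy_density_def p1[OF x] nsum o2 ..
    also have "\<dots> = - (\<Sum>s\<in>S. radial q (h s) x * (\<Sum>i\<in>UNIV. radial2 q (h s) i x))"
      unfolding sum_negf sum_distrib_left by (subst sum.swap) (rule refl)
    also have "\<dots> = - (\<Sum>s\<in>S. radial q (h s) x * (- \<Lambda> * radial q (h s) x))"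
      using radial_laplacian[OF h x] by (simp add: \<Lambda>_def)
    also have "\<dots> = \<Lambda> * (\<Sum>s\<in>S. (radial q (h s) x)\<^sup>2)"
      by (simp add: sum_distrib_left sum_negf power2_eq_square mult_ac)
    finally show ?thesis by (simp add: one[OF x])
  qed
  show "energy_density F x = real q * (real q + real CARD('n) - 2) / (norm x)\<^sup>2"
    unfolding en \<Lambda>_def ..
  show "laplacian F x + energy_density F x *\<^sub>R F x = 0"
    unfolding lap en by simp
qed

theorem theorem1p1:
  fixes m d p q :: nat
    and \<phi> \<Phi> \<nu>\<^sub>p :: "real^'n \<Rightarrow> real^'k"
    and \<rho> :: "real^'n^'n \<Rightarrow> 'w::euclidean_space \<Rightarrow> 'w"
    and D :: "'w \<Rightarrow> (real^'n \<Rightarrow> real) \<Rightarrow> (real^'n \<Rightarrow> real)"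
    and B :: "'w set"
    and \<nu>\<^sub>q :: "real^'n \<Rightarrow> 'w^'k"
  assumes "m > 0" "d > 0" "p > 0" "q > 0"
    and "CARD('n) = m + 1" "CARD('k) = d + 1"
    and "eigenmap p \<phi>"
    and "\<forall>j. (\<lambda>x. \<Phi> x $ j) \<in> \<H> p"
    and "\<forall>x\<in>sphere 0 1. \<Phi> x = \<phi> x"
    and "\<forall>x. x \<noteq> 0 \<longrightarrow> \<nu>\<^sub>p x = (1 / norm x ^ p) *\<^sub>R \<Phi> x"
    and "orthogonal_SO_module \<rho>"
    and "module_hom_to_Hom p q \<rho> D"
    and "\<exists>e. \<exists>h\<in>\<H> p. D e h \<noteq> 0"
    and "orthonormal_basis B"
    and "\<forall>x. x \<noteq> 0 \<longrightarrow>
           \<nu>\<^sub>q x = (1 / norm x ^ q) *\<^sub>R D_transform p q B D (\<lambda>y. norm y ^ p *\<^sub>R \<nu>\<^sub>p y) x"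
  shows "(\<forall>j. \<forall>e\<in>B. \<exists>P. homogeneous_polynomial q P \<and>
             (\<forall>x. x \<noteq> 0 \<longrightarrow> \<nu>\<^sub>q x $ j \<bullet> e = P (x /\<^sub>R norm x)))
       \<and> (\<forall>x. x \<noteq> 0 \<longrightarrow> (norm (\<nu>\<^sub>q x))\<^sup>2 = 1)
       \<and> (\<forall>x. x \<noteq> 0 \<longrightarrow>
             energy_density \<nu>\<^sub>q x = real q * (real q + real m - 1) / (norm x)\<^sup>2)
       \<and> (\<forall>x. x \<noteq> 0 \<longrightarrow> laplacian \<nu>\<^sub>q x + energy_density \<nu>\<^sub>q x *\<^sub>R \<nu>\<^sub>q x = 0)"
proof -
  interpret E: equivariant_hom p q \<rho> D B
    by unfold_locales (use assms in auto)
  define c where "c = E.c0"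
  have c: "c > 0" unfolding c_def by (rule E.c0_pos)
  define r where "r = c powr (-1/2)"
  have rr: "r * r = 1 / c"
  proof -
    have "r * r = c powr (- 1)" unfolding r_def by (subst powr_add[symmetric]) simp
    then show ?thesis using c by (simp add: powr_minus_divide)
  qed
  define f where "f j x = \<Phi> x $ j" for j x
  have f: "f j \<in> \<H> p" for j using assms(8) by (simp add: f_def[abs_def])
  \<comment> \<open>\<open>D e\<close> acts on whole functions, so equality is needed at the origin
    as well, where the value of \<open>\<nu>\<^sub>p\<close> is unspecified; there both sides vanish
    because p > 0.\<close>
  have ext: "(\<lambda>y. (norm y ^ p *\<^sub>R \<nu>\<^sub>p y) $ j) = f j" for j
  proof
    fix y :: "real^'n"
    show "(norm y ^ p *\<^sub>R \<nu>\<^sub>p y) $ j = f j y"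
    proof (cases "y = 0")
      case True
      have "f j (0 *\<^sub>R y) = 0 ^ p * f j y" by (rule harmonic_homog[OF f])
      then show ?thesis using True \<open>p > 0\<close> by (simp add: zero_power)
    next
      case False
      then show ?thesis using assms(10) by (simp add: f_def)
    qed
  qed
  have sph: "(\<Sum>j\<in>UNIV. (f j x)\<^sup>2) = 1" if "norm x = 1" for x
  proof -
    have "norm (\<Phi> x) = 1"
      using assms(7,9) that unfolding eigenmap_def by auto
    moreover have "(\<Sum>j\<in>UNIV. (f j x)\<^sup>2) = (norm (\<Phi> x))\<^sup>2"
      by (simp add: f_def norm_vec_def L2_set_def sum_nonneg)
    ultimately show ?thesis by simp
  qed
  define h where "h s = r *\<^sub>R D (snd s) (f (fst s))" for s
  have h: "h s \<in> \<H> q" for s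
    unfolding h_def by (intro subspace_scale subspace_harmonic E.D_mem f)
  have hx: "h s x = r * D (snd s) (f (fst s)) x" for s x
    by (simp add: h_def scaleR_fun_def)
  \<comment> \<open>Indices of an orthonormal basis of the tensor product: \<open>w s\<close> is the
    basis vector of \<open>'w\<close> placed in one coordinate of \<open>'w^'k\<close>.\<close>
  define S where "S = (UNIV :: 'k set) \<times> B"
  define w where "w s = (axis (fst s) (snd s) :: 'w^'k)" for s :: "'k \<times> 'w"
  have finS: "finite S" unfolding S_def using E.finB by simp
  have Bo: "e \<bullet> e' = (if e = e' then 1 else 0)" if "e \<in> B" "e' \<in> B" for e e'
    using assms(14) that unfolding orthonormal_basis_def pairwise_def orthogonal_def
    by (auto simp: norm_eq_1)
  have orth: "w s \<bullet> w t = (if s = t then 1 else 0)" if "s \<in> S" "t \<in> S" for s t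
    using that Bo by (auto simp: w_def S_def inner_axis_axis prod_eq_iff)
  have comp: "\<nu>\<^sub>q x $ j = (\<Sum>e\<in>B. radial q (h (j, e)) x *\<^sub>R e)" if "x \<noteq> 0" for x j
  proof -
    have "\<nu>\<^sub>q x $ j = (1 / norm x ^ q) *\<^sub>R (\<Sum>e\<in>B. (r * D e (f j) x) *\<^sub>R e)"
    proof -
      have "\<nu>\<^sub>q x $ j = (1 / norm x ^ q) *\<^sub>R (D_transform p q B D (\<lambda>y. norm y ^ p *\<^sub>R \<nu>\<^sub>p y) x $ j)"
        using assms(15) that by simp
      then show ?thesis
        unfolding D_transform_def ext E.hom_constant_eq r_def c_def by simp
    qed
    then show ?thesis by (simp add: scaleR_sum_right radial_def hx)
  qed
  have F: "\<nu>\<^sub>q x = (\<Sum>s\<in>S. radial q (h s) x *\<^sub>R w s)" if "x \<noteq> 0" for x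
  proof (rule vec_eq_iff[THEN iffD2], rule allI)
    fix j
    have "(\<Sum>s\<in>S. radial q (h s) x *\<^sub>R w s) $ j
        = (\<Sum>i\<in>UNIV. \<Sum>e\<in>B. radial q (h (i, e)) x *\<^sub>R (if i = j then e else 0))"
      unfolding S_def by (simp add: sum.cartesian_product split_def w_def axis_def cong: if_cong) (simp add: eq_commute)
    also have "\<dots> = (\<Sum>i\<in>UNIV. if i = j then \<Sum>e\<in>B. radial q (h (i, e)) x *\<^sub>R e else 0)"
      by (intro sum.cong refl) simp
    also have "\<dots> = \<nu>\<^sub>q x $ j" by (simp add: comp[OF that])
    finally show "\<nu>\<^sub>q x $ j = (\<Sum>s\<in>S. radial q (h s) x *\<^sub>R w s) $ j" ..
  qed
  have one: "(\<Sum>s\<in>S. (h s y)\<^sup>2) = 1" if y: "norm y = 1" for y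
  proof -
    have "(\<Sum>s\<in>S. (h s y)\<^sup>2) = (r * r) * (\<Sum>j\<in>UNIV. \<Sum>e\<in>B. (D e (f j) y)\<^sup>2)"
      unfolding S_def sum_distrib_left
      by (simp add: sum.cartesian_product split_def hx power2_eq_square mult_ac)
    also have "(\<Sum>j\<in>UNIV. \<Sum>e\<in>B. (D e (f j) y)\<^sup>2) = (\<Sum>e\<in>B. \<Sum>j\<in>UNIV. (D e (f j) y)\<^sup>2)"
      by (rule sum.swap)
    also have "\<dots> = c" unfolding c_def by (rule E.D_eigenmap[OF finite f sph y])
    finally show ?thesis using c by (simp add: rr)
  qed
  \<comment> \<open>The sphere has dimension m in m + 1 variables, so the shift by -2 becomes m -
    1.\<close>
  have N: "real q * (real q + real CARD('n) - 2) = real q * (real q + real m - 1)"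
    by (simp add: assms(5))
  note main = radial_eigenmap[where F = \<nu>\<^sub>q and w = w, OF finS h orth F one]
  have "\<exists>P. homogeneous_polynomial q P \<and> (\<forall>x. x \<noteq> 0 \<longrightarrow> \<nu>\<^sub>q x $ j \<bullet> e = P (x /\<^sub>R norm x))"
    if e: "e \<in> B" for j e
  proof (intro exI conjI allI impI)
    show "homogeneous_polynomial q (h (j, e))"
      using h by (simp add: harmonic_polynomials_def)
    fix x :: "real^'n" assume x: "x \<noteq> 0"
    have "\<nu>\<^sub>q x $ j \<bullet> e = (\<Sum>e'\<in>B. if e' = e then radial q (h (j, e')) x else 0)"
      unfolding comp[OF x] inner_sum_left by (intro sum.cong refl) (simp add: Bo e)
    also have "\<dots> = radial q (h (j, e)) x" using e E.finB by simp
    also have "\<dots> = h (j, e) (x /\<^sub>R norm x)" by (rule radial_unit[OF h x])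
    finally show "\<nu>\<^sub>q x $ j \<bullet> e = h (j, e) (x /\<^sub>R norm x)" .
  qed
  then show ?thesis
    using main N by simp
qed
end
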